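(* Let $1\le j\le k$ be integers, $n_1,\dots,n_k\ge 0$ integers, $Y=\mathbb{P}^{n_1}\times\cdots\times\mathbb{P}^{n_j}$ and $X=Y\times\mathbb{P}^{n_{j+1}}\times\cdots\times\mathbb{P}^{n_k}$ (over $\mathbb{C}$). Let $r,d_1,\dots,d_j$ be positive integers such that $r(\dim Y+1)\le\dim_{\mathbb{C}}S[X]_{(d_1,\dots,d_j,0,\dots,0)}$ and such that $(Y,\mathcal{O}_Y(d_1,\dots,d_j))$ is not-$r$-secant defective. If $[I]\in\mathrm{Slip}_{r,X}$, then for all integers $e_1\ge d_1,\dots,e_j\ge d_j$, $$H_{S[X]/I^2}(e_1,\dots,e_j,0,\dots,0)\ \ge\ r(\dim Y+1).$$
   Context: $S[X]=\mathbb{C}[\alpha_{i,l}: 1\le i\le k,\ 0\le l\le n_i]$ is the $\mathbb{Z}^k$-graded Cox ring of $X$, with $\deg\alpha_{i,l}$ the $i$-th standard basis vector of $\mathbb{Z}^k$. $B_X=(S[X]_{(1,\dots,1)})$ is the irrelevant ideal; an ideal $J$ is $B_X$-saturated if $(J:B_X)=J$. The Hilbert function of a $\mathbb{Z}^k$-graded module $M$ is $H_M(\mathbf u)=\dim_{\mathbb{C}}M_{\mathbf u}$. Put $h_{r,X}(\mathbf u)=\min\{r,\dim_{\mathbb{C}}S[X]_{\mathbf u}\}$ for $\mathbf u\in\mathbb{Z}^k$. $\mathrm{Hilb}_{S[X]}^{h}$ is the multigraded Hilbert scheme of Haiman–Sturmfels: the projective scheme representing the functor sending a $\mathbb{C}$-algebra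 $R$ to the set of homogeneous ideals $I\subseteq R\otimes_{\mathbb{C}}S[X]$ such that each $(R\otimes S[X]/I)_{\mathbf u}$ is locally free of rank $h(\mathbf u)$ over $R$. Its closed points $[I]$ correspond to $\mathbb{Z}^k$-homogeneous ideals $I\subseteq S[X]$ with $H_{S[X]/I}=h$. $\mathrm{Slip}_{r,X}$ is the Zariski closure in $\mathrm{Hilb}_{S[X]}^{h_{r,X}}$ of the set of points $[I]$ such that $I$ is radical and $B_X$-saturated. For a very ample line bundle $\mathcal{L}$ on a variety $Y$, $\sigma_r(Y,\mathcal{L})$ is the $r$-th secant variety of $Y\subseteq\mathbb{P}(H^0(Y,\mathcal{L})^\vee)$, i.e. the Zariski closure of the union of the projective linear spans $\langle x_1,\dots,x_r\rangle$ with $x_1,\dots,x_r\in Y$. The pair $(Y,\mathcal{L})$ is not-$r$-secant defective if $\dim\sigma_r(Y,\mathcal{L})=\min\{h^0(Y,\mathcal{L})-1,\ r(\dim Y+1)-1\}$. *)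

theory Defs
  imports
    "HOL-Algebra.Module"
    "HOL-Algebra.Ideal_Product"
    "HOL-Library.Poly_Mapping"
    "HOL-Library.Extended_Nat"
    "HOL-Analysis.Abstract_Topology"
begin

section \<open>Cox rings of products of projective spaces\<close>

text \<open>
  The pair \<open>(i, l)\<close> stands for the variable \<open>\<alpha>\<^sub>i\<^sub>,\<^sub>l\<close>.  An element of \<open>\<int>\<^sup>k\<close> is a function
  \<open>u :: nat \<Rightarrow> int\<close> of which only the values on \<open>{1..k}\<close> matter.
\<close>

type_synonym mono = "(nat \<times> nat) \<Rightarrow>\<^sub>0 nat"
type_synonym cpoly = "mono \<Rightarrow>\<^sub>0 complex"

definition cox_vars :: "nat \<Rightarrow> (nat \<Rightarrow> nat) \<Rightarrow> (nat \<times> nat) set" where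
  "cox_vars k n = (SIGMA i:{1..k}. {..n i})"

definition cox_monos :: "nat \<Rightarrow> (nat \<Rightarrow> nat) \<Rightarrow> mono set" where
  "cox_monos k n = {m. Poly_Mapping.keys m \<subseteq> cox_vars k n}"

definition has_mdeg :: "nat \<Rightarrow> (nat \<Rightarrow> nat) \<Rightarrow> mono \<Rightarrow> (nat \<Rightarrow> int) \<Rightarrow> bool" where
  "has_mdeg k n m u \<longleftrightarrow> (\<forall>i\<in>{1..k}. int (\<Sum>l\<le>n i. Poly_Mapping.lookup m (i, l)) = u i)"

definition cox_monos_deg :: "nat \<Rightarrow> (nat \<Rightarrow> nat) \<Rightarrow> (nat \<Rightarrow> int) \<Rightarrow> mono set" where
  "cox_monos_deg k n u = {m \<in> cox_monos k n. has_mdeg k n m u}"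

definition cox_ring :: "nat \<Rightarrow> (nat \<Rightarrow> nat) \<Rightarrow> cpoly ring" where
  "cox_ring k n =
     \<lparr>carrier = {p. Poly_Mapping.keys p \<subseteq> cox_monos k n}, mult = (*), one = 1, zero = 0, add = (+)\<rparr>"

definition cox_piece :: "nat \<Rightarrow> (nat \<Rightarrow> nat) \<Rightarrow> (nat \<Rightarrow> int) \<Rightarrow> cpoly set" where
  "cox_piece k n u = {p. Poly_Mapping.keys p \<subseteq> cox_monos_deg k n u}"

definition cscale :: "complex \<Rightarrow> cpoly \<Rightarrow> cpoly" where
  "cscale c p = Poly_Mapping.single 0 c * p"

global_interpretation cpoly: vector_space cscale
proof
  fix a b :: complex and x y :: cpoly
  show "cscale a (x + y) = cscale a x + cscale a y"
    by (simp add: cscale_def distrib_left)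
  show "cscale (a + b) x = cscale a x + cscale b x"
    by (simp add: cscale_def single_add distrib_right)
  show "cscale a (cscale b x) = cscale (a * b) x"
    by (simp add: cscale_def mult_single flip: mult.assoc)
  show "cscale 1 x = x"
    by (simp add: cscale_def)
qed

abbreviation cox_dim :: "nat \<Rightarrow> (nat \<Rightarrow> nat) \<Rightarrow> (nat \<Rightarrow> int) \<Rightarrow> nat" where
  "cox_dim k n u \<equiv> cpoly.dim (cox_piece k n u)"

definition mdeg_component :: "nat \<Rightarrow> (nat \<Rightarrow> nat) \<Rightarrow> (nat \<Rightarrow> int) \<Rightarrow> cpoly \<Rightarrow> cpoly" where
  "mdeg_component k n u p =
     (\<Sum>m\<in>{m \<in> Poly_Mapping.keys p. has_mdeg k n m u}. Poly_Mapping.single m (Poly_Mapping.lookup p m))"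

definition homogeneous_ideal :: "nat \<Rightarrow> (nat \<Rightarrow> nat) \<Rightarrow> cpoly set \<Rightarrow> bool" where
  "homogeneous_ideal k n J \<longleftrightarrow>
     ideal J (cox_ring k n) \<and> (\<forall>p\<in>J. \<forall>u. mdeg_component k n u p \<in> J)"

text \<open>
  For a homogeneous ideal \<open>J\<close>, the degree \<open>u\<close> part of \<open>S[X]/J\<close> is the quotient of the
  finite-dimensional space \<open>cox_piece k n u\<close> by its subspace \<open>J \<inter> cox_piece k n u\<close>.
\<close>

definition hilb_fun :: "nat \<Rightarrow> (nat \<Rightarrow> nat) \<Rightarrow> cpoly set \<Rightarrow> (nat \<Rightarrow> int) \<Rightarrow> nat" where
  "hilb_fun k n J u = cox_dim k n u - cpoly.dim (J \<inter> cox_piece k n u)"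

definition irrelevant_ideal :: "nat \<Rightarrow> (nat \<Rightarrow> nat) \<Rightarrow> cpoly set" where
  "irrelevant_ideal k n = genideal (cox_ring k n) (cox_piece k n (\<lambda>_. 1))"

definition colon :: "nat \<Rightarrow> (nat \<Rightarrow> nat) \<Rightarrow> cpoly set \<Rightarrow> cpoly set \<Rightarrow> cpoly set" where
  "colon k n J B = {p \<in> carrier (cox_ring k n). \<forall>b\<in>B. p * b \<in> J}"

definition saturated :: "nat \<Rightarrow> (nat \<Rightarrow> nat) \<Rightarrow> cpoly set \<Rightarrow> bool" where
  "saturated k n J \<longleftrightarrow> colon k n J (irrelevant_ideal k n) = J"

definition radical_ideal :: "nat \<Rightarrow> (nat \<Rightarrow> nat) \<Rightarrow> cpoly set \<Rightarrow> bool" where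
  "radical_ideal k n J \<longleftrightarrow> (\<forall>p\<in>carrier (cox_ring k n). \<forall>t::nat. p ^ t \<in> J \<longrightarrow> p \<in> J)"

definition h_generic :: "nat \<Rightarrow> nat \<Rightarrow> (nat \<Rightarrow> nat) \<Rightarrow> (nat \<Rightarrow> int) \<Rightarrow> nat" where
  "h_generic r k n u = min r (cox_dim k n u)"


section \<open>The multigraded Hilbert functor and the Zariski topology on its complex points\<close>

definition complex_ring :: "complex ring" where
  "complex_ring = \<lparr>carrier = UNIV, mult = (*), one = 1, zero = 0, add = (+)\<rparr>"

text \<open>
  \<open>R \<otimes>\<^sub>\<complex> S[X]\<close>, i.e. polynomials over \<open>R\<close> in the Cox variables, as finitely supported
  coefficient functions.
\<close>

definition cox_ring_over ::
    "('r, 'b) ring_scheme \<Rightarrow> nat \<Rightarrow> (nat \<Rightarrow> nat) \<Rightarrow> (mono \<Rightarrow> 'r) ring" where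
  "cox_ring_over R k n =
     \<lparr>carrier = {f. (\<forall>m. f m \<in> carrier R) \<and> (\<forall>m. m \<notin> cox_monos k n \<longrightarrow> f m = \<zero>\<^bsub>R\<^esub>) \<and>
                   finite {m. f m \<noteq> \<zero>\<^bsub>R\<^esub>}},
      mult = (\<lambda>f g m. finsum R (\<lambda>(a, b). f a \<otimes>\<^bsub>R\<^esub> g b) {(a, b). a + b = m}),
      one = (\<lambda>m. if m = 0 then \<one>\<^bsub>R\<^esub> else \<zero>\<^bsub>R\<^esub>),
      zero = (\<lambda>m. \<zero>\<^bsub>R\<^esub>),
      add = (\<lambda>f g m. f m \<oplus>\<^bsub>R\<^esub> g m)\<rparr>"

definition piece_over ::
    "('r, 'b) ring_scheme \<Rightarrow> nat \<Rightarrow> (nat \<Rightarrow> nat) \<Rightarrow> (nat \<Rightarrow> int) \<Rightarrow> (mono \<Rightarrow> 'r) set" where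
  "piece_over R k n u =
     {f \<in> carrier (cox_ring_over R k n). \<forall>m. f m \<noteq> \<zero>\<^bsub>R\<^esub> \<longrightarrow> has_mdeg k n m u}"

definition homogeneous_ideal_over ::
    "('r, 'b) ring_scheme \<Rightarrow> nat \<Rightarrow> (nat \<Rightarrow> nat) \<Rightarrow> (mono \<Rightarrow> 'r) set \<Rightarrow> bool" where
  "homogeneous_ideal_over R k n J \<longleftrightarrow>
     ideal J (cox_ring_over R k n) \<and>
     (\<forall>f\<in>J. \<forall>u. (\<lambda>m. if has_mdeg k n m u then f m else \<zero>\<^bsub>R\<^esub>) \<in> J)"

text \<open>
  The localisation \<open>(N/K)\<^sub>f\<close> is a free \<open>R\<^sub>f\<close>-module of rank \<open>t\<close>, where \<open>K \<subseteq> N\<close> are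
  \<open>R\<close>-modules of coefficient functions.  A basis can be taken to consist of classes of
  elements of \<open>N\<close>; equality in a localisation at \<open>f\<close> is equality after multiplication with a
  power of \<open>f\<close>.
\<close>

definition free_quotient_at ::
    "('r, 'b) ring_scheme \<Rightarrow> (mono \<Rightarrow> 'r) set \<Rightarrow> (mono \<Rightarrow> 'r) set \<Rightarrow> 'r \<Rightarrow> nat \<Rightarrow> bool" where
  "free_quotient_at R N K f t \<longleftrightarrow>
     (\<exists>b :: nat \<Rightarrow> mono \<Rightarrow> 'r.
        (\<forall>i<t. b i \<in> N) \<and>
        (\<forall>x\<in>N. \<exists>q::nat. \<exists>c\<in>{..<t} \<rightarrow> carrier R.
           (\<lambda>m. (f [^]\<^bsub>R\<^esub> q \<otimes>\<^bsub>R\<^esub> x m) \<ominus>\<^bsub>R\<^esub> (\<Oplus>\<^bsub>R\<^esub>i\<in>{..<t}. c i \<otimes>\<^bsub>R\<^esub> b i m)) \<in> K) \<and>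
        (\<forall>c\<in>{..<t} \<rightarrow> carrier R.
           (\<lambda>m. \<Oplus>\<^bsub>R\<^esub>i\<in>{..<t}. c i \<otimes>\<^bsub>R\<^esub> b i m) \<in> K \<longrightarrow>
           (\<exists>q::nat. \<forall>i<t. f [^]\<^bsub>R\<^esub> q \<otimes>\<^bsub>R\<^esub> c i = \<zero>\<^bsub>R\<^esub>)))"

definition locally_free_quotient ::
    "('r, 'b) ring_scheme \<Rightarrow> (mono \<Rightarrow> 'r) set \<Rightarrow> (mono \<Rightarrow> 'r) set \<Rightarrow> nat \<Rightarrow> bool" where
  "locally_free_quotient R N K t \<longleftrightarrow>
     (\<forall>P. primeideal P R \<longrightarrow> (\<exists>f\<in>carrier R - P. free_quotient_at R N K f t))"

definition hilb_functor ::
    "('r, 'b) ring_scheme \<Rightarrow> nat \<Rightarrow> (nat \<Rightarrow> nat) \<Rightarrow> ((nat \<Rightarrow> int) \<Rightarrow> nat)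
       \<Rightarrow> (mono \<Rightarrow> 'r) set set" where
  "hilb_functor R k n h =
     {J. homogeneous_ideal_over R k n J \<and>
         (\<forall>u. locally_free_quotient R (piece_over R k n u) (J \<inter> piece_over R k n u) (h u))}"

definition hilb_points ::
    "nat \<Rightarrow> (nat \<Rightarrow> nat) \<Rightarrow> ((nat \<Rightarrow> int) \<Rightarrow> nat) \<Rightarrow> cpoly set set" where
  "hilb_points k n h = {J. homogeneous_ideal k n J \<and> (\<forall>u. hilb_fun k n J u = h u)}"

definition complex_points :: "(complex, 'r) module \<Rightarrow> ('r \<Rightarrow> complex) set" where
  "complex_points R =
     {\<phi> \<in> ring_hom R complex_ring. \<forall>c. \<forall>x\<in>carrier R. \<phi> (c \<odot>\<^bsub>R\<^esub> x) = c * \<phi> x}"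

text \<open>
  The functorial image of a family under a point \<open>\<phi> : R \<rightarrow> \<complex>\<close>.  The map
  \<open>R \<otimes> S[X] \<rightarrow> S[X]\<close> induced by \<open>\<phi>\<close> is surjective, so the plain image is an ideal.
\<close>

definition family_fibre ::
    "nat \<Rightarrow> (nat \<Rightarrow> nat) \<Rightarrow> ('r \<Rightarrow> complex) \<Rightarrow> (mono \<Rightarrow> 'r) set \<Rightarrow> cpoly set" where
  "family_fibre k n \<phi> J =
     {p \<in> carrier (cox_ring k n). \<exists>f\<in>J. \<forall>m. Poly_Mapping.lookup p m = \<phi> (f m)}"

text \<open>
  A set \<open>Z\<close> of closed points of the scheme representing the Hilbert functor is Zariski closed
  iff for every family over an affine scheme of finite type \<open>Spec R\<close>, i.e. for every morphism
  from \<open>Spec R\<close> to that scheme, its preimage in the complex points of \<open>Spec R\<close> is the zero set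
  of some \<open>E \<subseteq> R\<close>: closed sets pull back to closed sets, and closedness can be tested on an
  affine open cover.  The condition below ranges over all \<open>\<complex>\<close>-algebras carried by a fixed type;
  that type contains the quotients \<open>\<complex>[y\<^sub>0, y\<^sub>1, ..., y\<^sub>m]/\<aa>\<close> as sets of cosets, hence every
  finitely generated \<open>\<complex>\<close>-algebra up to isomorphism.
\<close>

type_synonym alg_elem = "((nat \<Rightarrow>\<^sub>0 nat) \<Rightarrow>\<^sub>0 complex) set"

definition hilb_closed ::
    "nat \<Rightarrow> (nat \<Rightarrow> nat) \<Rightarrow> ((nat \<Rightarrow> int) \<Rightarrow> nat) \<Rightarrow> cpoly set set \<Rightarrow> bool" where
  "hilb_closed k n h Z \<longleftrightarrow>
     Z \<subseteq> hilb_points k n h \<and>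
     (\<forall>(R :: (complex, alg_elem) module) J.
        Module.algebra complex_ring R \<and> J \<in> hilb_functor R k n h \<longrightarrow>
        (\<exists>E\<subseteq>carrier R. \<forall>\<phi>\<in>complex_points R.
           family_fibre k n \<phi> J \<in> Z \<longleftrightarrow> (\<forall>x\<in>E. \<phi> x = 0)))"

definition hilb_topology ::
    "nat \<Rightarrow> (nat \<Rightarrow> nat) \<Rightarrow> ((nat \<Rightarrow> int) \<Rightarrow> nat) \<Rightarrow> cpoly set topology" where
  "hilb_topology k n h =
     topology_generated_by {hilb_points k n h - Z | Z. hilb_closed k n h Z}"

definition slip :: "nat \<Rightarrow> nat \<Rightarrow> (nat \<Rightarrow> nat) \<Rightarrow> cpoly set set" where
  "slip r k n =
     hilb_topology k n (h_generic r k n) closure_of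
       {J \<in> hilb_points k n (h_generic r k n). radical_ideal k n J \<and> saturated k n J}"


section \<open>Projective spaces, Krull dimension and secant varieties\<close>

text \<open>
  For a finite index set \<open>M\<close>, the projective space of lines in \<open>\<complex>\<^sup>M\<close>, where \<open>\<complex>\<^sup>M\<close> consists of
  the functions vanishing outside \<open>M\<close>.
\<close>

definition line_of :: "('m \<Rightarrow> complex) \<Rightarrow> ('m \<Rightarrow> complex) set" where
  "line_of v = {(\<lambda>m. c * v m) | c. True}"

definition proj_space :: "'m set \<Rightarrow> ('m \<Rightarrow> complex) set set" where
  "proj_space M = {line_of v | v. v \<noteq> (\<lambda>_. 0) \<and> (\<forall>m. m \<notin> M \<longrightarrow> v m = 0)}"

definition poly_eval :: "(('m \<Rightarrow>\<^sub>0 nat) \<Rightarrow>\<^sub>0 complex) \<Rightarrow> ('m \<Rightarrow> complex) \<Rightarrow> complex" where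
  "poly_eval f v = (\<Sum>t\<in>Poly_Mapping.keys f. Poly_Mapping.lookup f t * (\<Prod>m\<in>Poly_Mapping.keys t. v m ^ Poly_Mapping.lookup t m))"

definition form_on :: "'m set \<Rightarrow> (('m \<Rightarrow>\<^sub>0 nat) \<Rightarrow>\<^sub>0 complex) \<Rightarrow> bool" where
  "form_on M f \<longleftrightarrow>
     (\<exists>D. \<forall>t\<in>Poly_Mapping.keys f. Poly_Mapping.keys t \<subseteq> M \<and> (\<Sum>m\<in>Poly_Mapping.keys t. Poly_Mapping.lookup t m) = D)"

definition zariski_proj :: "'m set \<Rightarrow> ('m \<Rightarrow> complex) set topology" where
  "zariski_proj M =
     topology_generated_by
       {{L \<in> proj_space M. \<exists>v\<in>L. poly_eval f v \<noteq> 0} | f. form_on M f}"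

definition irreducible_in :: "'a topology \<Rightarrow> 'a set \<Rightarrow> bool" where
  "irreducible_in T A \<longleftrightarrow>
     A \<subseteq> topspace T \<and> A \<noteq> {} \<and>
     (\<forall>B C. closedin T B \<and> closedin T C \<and> A \<subseteq> B \<union> C \<longrightarrow> A \<subseteq> B \<or> A \<subseteq> C)"

definition krull_dim :: "'a topology \<Rightarrow> enat" where
  "krull_dim T =
     Sup {enat N | N. \<exists>Z :: nat \<Rightarrow> 'a set.
            (\<forall>i\<le>N. closedin T (Z i) \<and> irreducible_in T (Z i)) \<and> (\<forall>i<N. Z i \<subset> Z (Suc i))}"

definition proj_span :: "'m set \<Rightarrow> nat \<Rightarrow> (nat \<Rightarrow> ('m \<Rightarrow> complex) set) \<Rightarrow> ('m \<Rightarrow> complex) set set"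
  where
  "proj_span M r x =
     {L \<in> proj_space M. L \<subseteq> {(\<lambda>m. \<Sum>s<r. w s m) | w. \<forall>s<r. w s \<in> x s}}"

definition secant_variety ::
    "'m set \<Rightarrow> ('m \<Rightarrow> complex) set set \<Rightarrow> nat \<Rightarrow> ('m \<Rightarrow> complex) set set" where
  "secant_variety M Y r =
     zariski_proj M closure_of (\<Union>x\<in>{x. \<forall>s<r. x s \<in> Y}. proj_span M r x)"

text \<open>
  \<open>Y = \<P>\<^bsup>n 1\<^esup> \<times> ... \<times> \<P>\<^bsup>n j\<^esup>\<close> embedded by \<open>\<O>\<^sub>Y(d\<^sub>1, ..., d\<^sub>j)\<close>.  Since
  \<open>H\<^sup>0(Y, \<O>\<^sub>Y(d))\<close> is the degree \<open>d\<close> part of the Cox ring of \<open>Y\<close>, its dual is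
  \<open>\<complex>\<^sup>M\<close> for \<open>M = cox_monos_deg j n d\<close>, in the coordinates dual to the monomial basis, and
  evaluation at the point with homogeneous coordinates \<open>y\<close> becomes the vector of all
  monomials of degree \<open>d\<close> at \<open>y\<close>.
\<close>

definition hom_coords :: "nat \<Rightarrow> (nat \<Rightarrow> nat) \<Rightarrow> (nat \<times> nat \<Rightarrow> complex) set" where
  "hom_coords j n = {y. \<forall>i\<in>{1..j}. \<exists>l\<le>n i. y (i, l) \<noteq> 0}"

definition eval_vector ::
    "nat \<Rightarrow> (nat \<Rightarrow> nat) \<Rightarrow> (nat \<Rightarrow> int) \<Rightarrow> (nat \<times> nat \<Rightarrow> complex) \<Rightarrow> mono \<Rightarrow> complex" where
  "eval_vector j n d y =
     (\<lambda>m. if m \<in> cox_monos_deg j n d then \<Prod>v\<in>Poly_Mapping.keys m. y v ^ Poly_Mapping.lookup m v else 0)"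

definition embedded_product ::
    "nat \<Rightarrow> (nat \<Rightarrow> nat) \<Rightarrow> (nat \<Rightarrow> int) \<Rightarrow> (mono \<Rightarrow> complex) set set" where
  "embedded_product j n d = {line_of (eval_vector j n d y) | y. y \<in> hom_coords j n}"

definition dim_product :: "nat \<Rightarrow> (nat \<Rightarrow> nat) \<Rightarrow> nat" where
  "dim_product j n = (\<Sum>i=1..j. n i)"

definition not_secant_defective :: "nat \<Rightarrow> nat \<Rightarrow> (nat \<Rightarrow> nat) \<Rightarrow> (nat \<Rightarrow> int) \<Rightarrow> bool" where
  "not_secant_defective r j n d \<longleftrightarrow>
     (let M = cox_monos_deg j n d in
      krull_dim (subtopology (zariski_proj M) (secant_variety M (embedded_product j n d) r)) =
        enat (min (cox_dim j n d - 1) (r * (dim_product j n + 1) - 1)))"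

definition extend_by_zero :: "nat \<Rightarrow> (nat \<Rightarrow> int) \<Rightarrow> nat \<Rightarrow> int" where
  "extend_by_zero j d = (\<lambda>i. if i \<le> j then d i else 0)"

end

theory Submission
  imports
    Defs
    "HOL-Library.FuncSet"
    "HOL-Computational_Algebra.Fundamental_Theorem_Algebra"
begin

text \<open>
  The condition \<open>H(S/I\<^sup>2) \<ge> c\<close> in a fixed degree is closed, because the rank of the degree piece of
  \<open>I\<^sup>2\<close> is lower semicontinuous in flat families.  It therefore suffices to treat a radical saturated
  \<open>I\<close>.  Since \<open>H(S/I) \<le> r\<close>, a dehomogenised eigenvalue argument gives a Nullstellensatz for \<open>I\<close>, and
  \<open>I\<close> is, in the relevant degrees, the ideal of \<open>r\<close> points that impose independent conditions
  wherever \<open>I\<close> is nonzero.  Move these points along lines to a configuration at which the tangent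
  spaces of the cone over \<open>Y\<close> are independent; such a configuration exists by Terracini's lemma
  and nondefectivity.  By Cramer's rule products of elements of \<open>I\<close> deform to products of forms
  vanishing at the moved points, which therefore vanish doubly there, and linear independence is an
  open condition in the parameter of the line.  The \<open>r (dim Y + 1)\<close> functionals "value" and "partial
  derivative" at the moved points are independent in degree \<open>d\<close>, hence, after multiplication with powers
  of the coordinates \<open>\<alpha>\<^sub>i\<^sub>,\<^sub>0\<close>, in every degree \<open>e \<ge> d\<close>, and they kill the deformed products.

  Terracini's lemma needs that a chain of irreducible closed subsets of length \<open>N\<close> in the secant
  variety yields \<open>N + 1\<close> forms that are algebraically independent on the cone, and that algebraically
  independent functions have a generically invertible Jacobian matrix.
\<close>

text \<open>Nondefectivity concerns general points only, whereas the zeros of \<open>I\<close> may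
  have dependent tangent spaces, so no count is possible at these zeros themselves. The comparison
  with general points still goes in the right direction: independent products stay independent for
  general \<open>t\<close>, so the square of \<open>I\<close> is in each degree at most as large as
  the space of forms vanishing doubly at general points. A factor can be deformed only if the points
  impose independent conditions in its degree; where they do not, \<open>I\<close> has no nonzero
  element of that degree and there is nothing to deform.

  The functions of the parameter form rings without division. This is why elimination is
  fraction-free and why open conditions are witnessed by products of pivots.

  The number \<open>r * (dim Y + 1)\<close> counts the parameters of the affine cone over the secant
  variety (\<open>r\<close> scalars and \<open>r\<close> points of an affine chart). It is also one
  more than the length of the chain of closed sets, so the forms obtained from the chain match the
  parameters exactly, as the Jacobian criterion demands.\<close>

abbreviation (input) "lookup \<equiv> Poly_Mapping.lookup"
abbreviation (input) "keys \<equiv> Poly_Mapping.keys"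
abbreviation (input) "single \<equiv> Poly_Mapping.single"

section \<open>Linear algebra in families\<close>

text \<open>Linear independence of the rows \<open>a q\<close> of a matrix with columns
  \<open>M\<close>. Explicit entries let the same notion serve evaluation functionals and
  coefficient vectors of polynomials, and let the entries depend on a parameter.\<close>

definition indep_on :: "'q set \<Rightarrow> 'm set \<Rightarrow> ('q \<Rightarrow> 'm \<Rightarrow> complex) \<Rightarrow> bool" where
  "indep_on Q M a \<longleftrightarrow> (\<forall>x. (\<forall>m\<in>M. (\<Sum>q\<in>Q. x q * a q m) = 0) \<longrightarrow> (\<forall>q\<in>Q. x q = 0))"

lemma indep_onI:
  assumes "\<And>x q. (\<And>m. m \<in> M \<Longrightarrow> (\<Sum>q\<in>Q. x q * a q m) = 0) \<Longrightarrow> q \<in> Q \<Longrightarrow> x q = 0"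
  shows "indep_on Q M a"
  using assms unfolding indep_on_def by blast

lemma indep_onD:
  assumes "indep_on Q M a" "\<And>m. m \<in> M \<Longrightarrow> (\<Sum>q\<in>Q. x q * a q m) = 0" "q \<in> Q"
  shows "x q = 0"
  using assms unfolding indep_on_def by blast

text \<open>Gaussian elimination by induction on the equations: an unknown \<open>a0\<close> that
  occurs in equation \<open>b\<close> is eliminated from the others, and the remaining unknowns
  still outnumber the remaining equations.\<close>

lemma underdetermined:
  fixes c :: "'q \<Rightarrow> 'm \<Rightarrow> 'a::field"
  assumes "finite B" "finite A" "card B < card A"
  shows "\<exists>x. (\<exists>a\<in>A. x a \<noteq> 0) \<and> (\<forall>b\<in>B. (\<Sum>a\<in>A. x a * c a b) = 0)"
  using assms
proof (induction B arbitrary: A c rule: finite_induct)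
  case empty
  then have "A \<noteq> {}" by auto
  then show ?case by (intro exI[of _ "\<lambda>_. 1"]) auto
next
  case (insert b B)
  show ?case
  proof (cases "\<forall>a\<in>A. c a b = 0")
    case True
    have "card B < card A" using insert by simp
    from insert.IH[OF insert.prems(1) this, of c] True show ?thesis by auto
  next
    case False
    then obtain a0 where a0: "a0 \<in> A" "c a0 b \<noteq> 0" by auto
    have "card B < card (A - {a0})" using insert a0 by (simp add: card_Diff_singleton)
    from insert.IH[OF _ this, of "\<lambda>a b'. c a b' - c a b / c a0 b * c a0 b'"] insert.prems
    obtain x where x: "\<exists>a\<in>A - {a0}. x a \<noteq> 0"
      "\<And>b'. b' \<in> B \<Longrightarrow> (\<Sum>a\<in>A - {a0}. x a * (c a b' - c a b / c a0 b * c a0 b')) = 0"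
      by auto
    \<comment> \<open>The value of the unknown \<open>a0\<close> that makes equation
      \<open>b\<close> hold once the other unknowns are fixed.\<close>
    define s where "s = - (\<Sum>a\<in>A - {a0}. x a * c a b) / c a0 b"
    define y where "y = x(a0 := s)"
    have split: "(\<Sum>a\<in>A. y a * c a b') = s * c a0 b' + (\<Sum>a\<in>A - {a0}. x a * c a b')" for b'
      using sum.remove[OF insert.prems(1) a0(1), of "\<lambda>a. y a * c a b'"]
      by (simp add: y_def)
    have "(\<Sum>a\<in>A. y a * c a b) = 0" unfolding split s_def using a0 by simp
    moreover have "(\<Sum>a\<in>A. y a * c a b') = 0" if "b' \<in> B" for b'
    proof -
      have "0 = (\<Sum>a\<in>A - {a0}. x a * c a b') - (\<Sum>a\<in>A - {a0}. x a * c a b) / c a0 b * c a0 b'"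
        using x(2)[OF that] by (simp add: algebra_simps sum_subtractf sum_distrib_left sum_divide_distrib)
      then show ?thesis unfolding split s_def by (simp add: algebra_simps)
    qed
    moreover have "\<exists>a\<in>A. y a \<noteq> 0" using x(1) by (auto simp: y_def)
    ultimately show ?thesis by (intro exI[of _ y]) auto
  qed
qed

lemma indep_on_card_le:
  assumes "finite Q" "finite M" "indep_on Q M a"
  shows "card Q \<le> card M"
proof (rule ccontr)
  assume "\<not> ?thesis"
  with underdetermined[of M Q a] assms obtain x where
    "\<exists>q\<in>Q. x q \<noteq> 0" "\<forall>m\<in>M. (\<Sum>q\<in>Q. x q * a q m) = 0" by auto
  then show False using indep_onD[OF assms(3), of x] by blast
qed

lemma sum_Plus:
  fixes f :: "'a + 'b \<Rightarrow> 'c::comm_monoid_add"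
  assumes "finite A" "finite B"
  shows "(\<Sum>x\<in>A <+> B. f x) = (\<Sum>a\<in>A. f (Inl a)) + (\<Sum>b\<in>B. f (Inr b))"
  using assms by (simp add: sum.Plus)

text \<open>
  The bilinear pairing is isotropic over the complex numbers; conjugating one of the two families
  turns it into a definite Hermitian form.
\<close>

lemma indep_on_orthogonal_card:
  assumes fin: "finite Q" "finite P" "finite M"
    and Q: "indep_on Q M a" and P: "indep_on P M b"
    and orth: "\<And>q p. q \<in> Q \<Longrightarrow> p \<in> P \<Longrightarrow> (\<Sum>m\<in>M. a q m * b p m) = 0"
  shows "card Q + card P \<le> card M"
proof (rule ccontr)
  assume "\<not> ?thesis"
  then have "card M < card (Q <+> P)" using fin by (simp add: card_Plus)
  from underdetermined[OF fin(3) _ this, of "case_sum (\<lambda>q m. - cnj (a q m)) b"] fin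
  obtain x where nz: "\<exists>s\<in>Q <+> P. x s \<noteq> 0"
    and eq: "\<And>m. m \<in> M \<Longrightarrow> (\<Sum>s\<in>Q <+> P. x s * case_sum (\<lambda>q m. - cnj (a q m)) b s m) = 0"
    by (metis finite_Plus)
  \<comment> \<open>\<open>w\<close> lies in the span of the \<open>b p\<close> and also in that of
    the conjugated \<open>a q\<close>; orthogonality therefore makes its Hermitian norm
    zero.\<close>
  define w where "w m = (\<Sum>p\<in>P. x (Inr p) * b p m)" for m
  have w: "w m = (\<Sum>q\<in>Q. x (Inl q) * cnj (a q m))" if "m \<in> M" for m
    using eq[OF that] fin by (simp add: sum_Plus w_def sum_negf)
  have "(\<Sum>m\<in>M. w m * cnj (w m)) = (\<Sum>m\<in>M. w m * (\<Sum>q\<in>Q. cnj (x (Inl q)) * a q m))"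
    by (intro sum.cong refl) (simp add: w)
  also have "\<dots> = (\<Sum>q\<in>Q. cnj (x (Inl q)) * (\<Sum>p\<in>P. x (Inr p) * (\<Sum>m\<in>M. a q m * b p m)))"
  proof -
    let ?T = "\<lambda>q p m. cnj (x (Inl q)) * (x (Inr p) * (a q m * b p m))"
    have "(\<Sum>m\<in>M. w m * (\<Sum>q\<in>Q. cnj (x (Inl q)) * a q m)) = (\<Sum>m\<in>M. \<Sum>q\<in>Q. \<Sum>p\<in>P. ?T q p m)"
      unfolding w_def sum_distrib_left sum_distrib_right
      by (intro sum.cong refl) (simp add: algebra_simps)
    also have "\<dots> = (\<Sum>q\<in>Q. \<Sum>m\<in>M. \<Sum>p\<in>P. ?T q p m)" by (rule sum.swap)
    also have "\<dots> = (\<Sum>q\<in>Q. \<Sum>p\<in>P. \<Sum>m\<in>M. ?T q p m)" by (intro sum.cong refl sum.swap)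
    finally show ?thesis by (simp add: sum_distrib_left)
  qed
  also have "\<dots> = 0" by (simp add: orth)
  finally have "(\<Sum>m\<in>M. (cmod (w m))\<^sup>2) = 0"
    by (simp add: complex_norm_square[symmetric] flip: of_real_sum of_real_power)
  then have w0: "w m = 0" if "m \<in> M" for m
    using that fin by (simp add: sum_nonneg_eq_0_iff)
  have "x (Inr p) = 0" if "p \<in> P" for p
    by (rule indep_onD[OF P _ that, where x = "\<lambda>p. x (Inr p)"]) (use w0 in \<open>simp add: w_def\<close>)
  moreover have "cnj (x (Inl q)) = 0" if "q \<in> Q" for q
  proof (rule indep_onD[OF Q _ that, where x = "\<lambda>q. cnj (x (Inl q))"])
    fix m assume "m \<in> M"
    then have "cnj (\<Sum>q\<in>Q. x (Inl q) * cnj (a q m)) = 0" using w w0 by (metis complex_cnj_zero)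
    then show "(\<Sum>q\<in>Q. cnj (x (Inl q)) * a q m) = 0" by simp
  qed
  ultimately show False using nz by auto
qed

text \<open>The two families are treated differently on purpose: \<open>f\<close> pairs to zero with
  the functionals \<open>a q\<close>, but is Hermitian orthogonal to the vectors \<open>b p\<close>.
  Being nonzero on \<open>M\<close>, it cannot agree there with a combination of the
  \<open>b p\<close>; this is how forms outside a given subspace are found later.\<close>

lemma orthogonal_exists:
  assumes fin: "finite Q" "finite P" "finite M" and card: "card Q + card P < card M"
  shows "\<exists>f. (\<exists>m\<in>M. f m \<noteq> (0::complex)) \<and> (\<forall>q\<in>Q. (\<Sum>m\<in>M. f m * a q m) = 0) \<and>
             (\<forall>p\<in>P. (\<Sum>m\<in>M. f m * cnj (b p m)) = 0)"
proof -
  have "card (Q <+> P) < card M" using fin card by (simp add: card_Plus)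
  from underdetermined[OF finite_Plus[OF fin(1,2)] fin(3) this,
      of "\<lambda>m. case_sum (\<lambda>q. a q m) (\<lambda>p. cnj (b p m))"]
  obtain f where f: "\<exists>m\<in>M. f m \<noteq> 0"
    "\<And>s. s \<in> Q <+> P \<Longrightarrow> (\<Sum>m\<in>M. f m * case_sum (\<lambda>q. a q m) (\<lambda>p. cnj (b p m)) s) = 0"
    by blast
  show ?thesis
    using f(1) f(2)[OF InlI] f(2)[OF InrI] by (intro exI[of _ f]) simp
qed

section \<open>Linear algebra with entries in an algebra of functions\<close>

text \<open>The dependence on a parameter that the linear algebra allows. Three instances occur:
  polynomial functions of one variable, polynomial functions on a coordinate space, and functions on
  the complex points of an algebra that are induced by its elements.\<close>

definition fun_alg :: "('t \<Rightarrow> complex) set \<Rightarrow> bool" where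
  "fun_alg F \<longleftrightarrow> (\<forall>c. (\<lambda>_. c) \<in> F) \<and> (\<forall>f\<in>F. \<forall>g\<in>F. (\<lambda>t. f t + g t) \<in> F \<and> (\<lambda>t. f t * g t) \<in> F)"

lemma fun_alg_const: "fun_alg F \<Longrightarrow> (\<lambda>_. c) \<in> F"
  and fun_alg_add: "fun_alg F \<Longrightarrow> f \<in> F \<Longrightarrow> g \<in> F \<Longrightarrow> (\<lambda>t. f t + g t) \<in> F"
  and fun_alg_mult: "fun_alg F \<Longrightarrow> f \<in> F \<Longrightarrow> g \<in> F \<Longrightarrow> (\<lambda>t. f t * g t) \<in> F"
  by (auto simp: fun_alg_def)

lemma fun_alg_uminus: "fun_alg F \<Longrightarrow> f \<in> F \<Longrightarrow> (\<lambda>t. - f t) \<in> F"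
  using fun_alg_mult[of F "\<lambda>_. -1" f] fun_alg_const[of F "-1"] by simp

lemma fun_alg_diff: "fun_alg F \<Longrightarrow> f \<in> F \<Longrightarrow> g \<in> F \<Longrightarrow> (\<lambda>t. f t - g t) \<in> F"
  using fun_alg_add[of F f "\<lambda>t. - g t"] fun_alg_uminus[of F g] by simp

lemma fun_alg_sum:
  assumes "fun_alg F" "\<And>i. i \<in> A \<Longrightarrow> (\<lambda>t. f t i) \<in> F"
  shows "(\<lambda>t. \<Sum>i\<in>A. f t i) \<in> F"
  using assms(2)
proof (induction A rule: infinite_finite_induct)
  case (insert x A)
  then show ?case using fun_alg_add[OF assms(1), of "\<lambda>t. f t x" "\<lambda>t. \<Sum>i\<in>A. f t i"] by simp
qed (simp_all add: fun_alg_const[OF assms(1)])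

lemma fun_alg_prod:
  assumes "fun_alg F" "\<And>i. i \<in> A \<Longrightarrow> (\<lambda>t. f t i) \<in> F"
  shows "(\<lambda>t. \<Prod>i\<in>A. f t i) \<in> F"
  using assms(2)
proof (induction A rule: infinite_finite_induct)
  case (insert x A)
  then show ?case using fun_alg_mult[OF assms(1), of "\<lambda>t. f t x" "\<lambda>t. \<Prod>i\<in>A. f t i"] by simp
qed (simp_all add: fun_alg_const[OF assms(1)])

lemma fun_alg_power: "fun_alg F \<Longrightarrow> f \<in> F \<Longrightarrow> (\<lambda>t. f t ^ n) \<in> F"
  using fun_alg_prod[of F "{..<n}" "\<lambda>t _. f t"] by simp

lemma fun_alg_poly: "fun_alg {f. \<exists>p. \<forall>t. f t = poly p t}"
  unfolding fun_alg_def
proof (intro conjI allI ballI)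
  show "(\<lambda>_. c) \<in> {f. \<exists>p. \<forall>t. f t = poly p t}" for c :: complex
    by (auto intro!: exI[of _ "[:c:]"])
  fix f g :: "complex \<Rightarrow> complex"
  assume "f \<in> {f. \<exists>p. \<forall>t. f t = poly p t}" "g \<in> {f. \<exists>p. \<forall>t. f t = poly p t}"
  then obtain p q where "\<And>t. f t = poly p t" "\<And>t. g t = poly q t" by auto
  then show "(\<lambda>t. f t + g t) \<in> {f. \<exists>p. \<forall>t. f t = poly p t}"
    "(\<lambda>t. f t * g t) \<in> {f. \<exists>p. \<forall>t. f t = poly p t}"
    using poly_add[of p q, symmetric] poly_mult[of p q, symmetric] by (simp_all, blast+)
qed

text \<open>Fraction-free elimination with pivot \<open>a q0 m0\<close>: each row is multiplied by
  the pivot and a multiple of row \<open>q0\<close> is subtracted, which clears column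
  \<open>m0\<close>. A relation among the new rows becomes one among the old rows when
  \<open>q0\<close> receives the matching coefficient.\<close>

lemma indep_on_eliminate:
  assumes fin: "finite Q" and q0: "q0 \<notin> Q" and m0: "m0 \<in> M"
    and ind: "indep_on (insert q0 Q) M a"
  shows "a q0 m0 \<noteq> 0 \<Longrightarrow> indep_on Q (M - {m0}) (\<lambda>q m. a q0 m0 * a q m - a q m0 * a q0 m)"
proof (rule indep_onI)
  fix x q assume nz: "a q0 m0 \<noteq> 0" and q: "q \<in> Q"
    and eq: "\<And>m. m \<in> M - {m0} \<Longrightarrow> (\<Sum>q\<in>Q. x q * (a q0 m0 * a q m - a q m0 * a q0 m)) = 0"
  define y where "y = (\<lambda>q. a q0 m0 * x q)(q0 := - (\<Sum>q\<in>Q. x q * a q m0))"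
  have "y q = 0"
  proof (rule indep_onD[OF ind])
    fix m assume "m \<in> M"
    have ys: "(\<Sum>q\<in>Q. y q * a q m) = (\<Sum>q\<in>Q. a q0 m0 * x q * a q m)"
      by (intro sum.cong refl) (use q0 in \<open>auto simp: y_def\<close>)
    have "(\<Sum>q\<in>insert q0 Q. y q * a q m) = (\<Sum>q\<in>Q. x q * (a q0 m0 * a q m - a q m0 * a q0 m))"
      using fin q0 ys
      by (simp add: y_def algebra_simps sum_subtractf sum_distrib_left)
    also have "\<dots> = 0" using eq[of m] \<open>m \<in> M\<close> by (cases "m = m0") (auto simp: algebra_simps)
    finally show "(\<Sum>q\<in>insert q0 Q. y q * a q m) = 0" .
  qed (use q in auto)
  then show "x q = 0" using nz q q0 by (auto simp: y_def split: if_splits)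
qed

text \<open>The converse step. It carries independence of the reduced matrix back to the full one at
  every parameter where the pivot is nonzero.\<close>

lemma indep_on_insert_uneliminate:
  assumes fin: "finite Q" and q0: "q0 \<notin> Q" and m0: "m0 \<in> M" and nz: "a q0 m0 \<noteq> 0"
    and ind: "indep_on Q (M - {m0}) (\<lambda>q m. a q0 m0 * a q m - a q m0 * a q0 m)"
  shows "indep_on (insert q0 Q) M a"
proof (rule indep_onI)
  fix x q assume q: "q \<in> insert q0 Q"
    and eq: "\<And>m. m \<in> M \<Longrightarrow> (\<Sum>q\<in>insert q0 Q. x q * a q m) = 0"
  have e: "x q0 * a q0 m + (\<Sum>q\<in>Q. x q * a q m) = 0" if "m \<in> M" for m
    using eq[OF that] fin q0 by simp
  have xQ: "x q = 0" if "q \<in> Q" for q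
  proof (rule indep_onD[OF ind _ that])
    fix m assume "m \<in> M - {m0}"
    have "(\<Sum>q\<in>Q. x q * (a q0 m0 * a q m - a q m0 * a q0 m)) =
        a q0 m0 * (\<Sum>q\<in>Q. x q * a q m) - a q0 m * (\<Sum>q\<in>Q. x q * a q m0)"
      by (simp add: algebra_simps sum_subtractf sum_distrib_left)
    also have "\<dots> = 0" using e[of m] e[OF m0] \<open>m \<in> M - {m0}\<close> by (simp add: add_eq_0_iff)
    finally show "(\<Sum>q\<in>Q. x q * (a q0 m0 * a q m - a q m0 * a q0 m)) = 0" .
  qed
  moreover have "x q0 = 0" using e[OF m0] xQ nz by simp
  ultimately show "x q = 0" using q by auto
qed

lemma indep_on_insert_pivot:
  assumes fin: "finite Q" and ind: "indep_on (insert q0 Q) M a" and q0: "q0 \<notin> Q"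
  shows "\<exists>m0\<in>M. a q0 m0 \<noteq> 0"
proof (rule ccontr)
  assume np: "\<not> ?thesis"
  then have "(if q0 = q0 then 1 else 0 :: complex) = 0"
  proof (intro indep_onD[OF ind, where x = "\<lambda>q. if q = q0 then 1 else 0"])
    fix m assume "m \<in> M"
    have "(\<Sum>q\<in>insert q0 Q. (if q = q0 then 1 else 0) * a q m) = (\<Sum>q\<in>insert q0 Q. if q = q0 then a q m else 0)"
      by (intro sum.cong) auto
    also have "\<dots> = a q0 m" using fin by (simp add: sum.delta)
    finally show "(\<Sum>q\<in>insert q0 Q. (if q = q0 then 1 else 0) * a q m) = 0"
      using np \<open>m \<in> M\<close> by auto
  qed auto
  then show False by simp
qed

text \<open>The witness \<open>g\<close> is the product of the pivots chosen at \<open>t0\<close>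
  during the elimination; wherever it is nonzero the same pivots work. It plays the role of a
  maximal minor that is nonzero at \<open>t0\<close>.\<close>

lemma indep_on_open:
  assumes F: "fun_alg F" and fin: "finite Q"
    and a: "\<And>q m. q \<in> Q \<Longrightarrow> m \<in> M \<Longrightarrow> (\<lambda>t. a t q m) \<in> F"
    and ind: "indep_on Q M (a t0)"
  shows "\<exists>g\<in>F. g t0 \<noteq> 0 \<and> (\<forall>t. g t \<noteq> 0 \<longrightarrow> indep_on Q M (a t))"
  using fin a ind
proof (induction Q arbitrary: M a rule: finite_induct)
  case empty
  then show ?case using fun_alg_const[OF F, of 1] by (intro bexI[of _ "\<lambda>_. 1"]) (auto simp: indep_on_def)
next
  case (insert q0 Q)
  obtain m0 where m0: "m0 \<in> M" "a t0 q0 m0 \<noteq> 0"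
    using indep_on_insert_pivot[OF insert.hyps(1) insert.prems(2) insert.hyps(2)] by blast
  define b where "b t q m = a t q0 m0 * a t q m - a t q m0 * a t q0 m" for t q m
  have "\<exists>g\<in>F. g t0 \<noteq> 0 \<and> (\<forall>t. g t \<noteq> 0 \<longrightarrow> indep_on Q (M - {m0}) (b t))"
  proof (rule insert.IH)
    show "(\<lambda>t. b t q m) \<in> F" if "q \<in> Q" "m \<in> M - {m0}" for q m
      unfolding b_def using that m0 insert.prems(1)
      by (intro fun_alg_diff[OF F] fun_alg_mult[OF F]) auto
    show "indep_on Q (M - {m0}) (b t0)"
      unfolding b_def by (rule indep_on_eliminate[OF insert.hyps m0(1) insert.prems(2) m0(2)])
  qed
  then obtain g where g: "g \<in> F" "g t0 \<noteq> 0" "\<And>t. g t \<noteq> 0 \<Longrightarrow> indep_on Q (M - {m0}) (b t)"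
    by blast
  have "(\<lambda>t. a t q0 m0 * g t) \<in> F" using insert.prems(1) m0(1) g(1) by (intro fun_alg_mult[OF F]) auto
  moreover have "indep_on (insert q0 Q) M (a t)" if "a t q0 m0 * g t \<noteq> 0" for t
    using indep_on_insert_uneliminate[OF insert.hyps m0(1), of "a t"] g(3)[of t] that unfolding b_def by auto
  ultimately show ?case using g(2) m0(2) by (intro bexI[of _ "\<lambda>t. a t q0 m0 * g t"]) auto
qed

text \<open>Cramer's rule without division.\<close>

lemma kernel_vector_extends:
  assumes F: "fun_alg F" and fin: "finite Q" "finite M"
    and a: "\<And>q m. q \<in> Q \<Longrightarrow> m \<in> M \<Longrightarrow> (\<lambda>t. a t q m) \<in> F"
    and ind: "indep_on Q M (a t0)"
    and ker: "\<And>q. q \<in> Q \<Longrightarrow> (\<Sum>m\<in>M. a t0 q m * f m) = 0"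
  shows "\<exists>h c. c \<noteq> 0 \<and> (\<forall>m\<in>M. (\<lambda>t. h t m) \<in> F) \<and> (\<forall>t. \<forall>q\<in>Q. (\<Sum>m\<in>M. a t q m * h t m) = 0) \<and>
           (\<forall>m\<in>M. h t0 m = c * f m)"
  using fin a ind ker
proof (induction Q arbitrary: M a rule: finite_induct)
  case empty
  show ?case
    by (intro exI[of _ "\<lambda>_. f"] exI[of _ "1"]) (simp add: fun_alg_const[OF F])
next
  case (insert q0 Q)
  obtain m0 where m0: "m0 \<in> M" "a t0 q0 m0 \<noteq> 0"
    using indep_on_insert_pivot[OF insert.hyps(1) insert.prems(3) insert.hyps(2)] by blast
  define b where "b t q m = a t q0 m0 * a t q m - a t q m0 * a t q0 m" for t q m
  define M' where "M' = M - {m0}"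
  have finM': "finite M'" using insert.prems(1) by (simp add: M'_def)
  have split: "(\<Sum>m\<in>M. g m) = g m0 + (\<Sum>m\<in>M'. g m)" for g :: "'c \<Rightarrow> complex"
    unfolding M'_def using insert.prems(1) m0(1) by (simp add: sum.remove)
  have "\<exists>h c. c \<noteq> 0 \<and> (\<forall>m\<in>M'. (\<lambda>t. h t m) \<in> F) \<and> (\<forall>t. \<forall>q\<in>Q. (\<Sum>m\<in>M'. b t q m * h t m) = 0) \<and>
           (\<forall>m\<in>M'. h t0 m = c * f m)"
  proof (rule insert.IH[OF finM'])
    show "(\<lambda>t. b t q m) \<in> F" if "q \<in> Q" "m \<in> M'" for q m
      unfolding b_def using that m0 insert.prems(2)
      by (intro fun_alg_diff[OF F] fun_alg_mult[OF F]) (auto simp: M'_def)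
    show "indep_on Q M' (b t0)"
      unfolding b_def M'_def by (rule indep_on_eliminate[OF insert.hyps m0(1) insert.prems(3) m0(2)])
    show "(\<Sum>m\<in>M'. b t0 q m * f m) = 0" if "q \<in> Q" for q
    proof -
      have 1: "a t0 q m0 * f m0 + (\<Sum>m\<in>M'. a t0 q m * f m) = 0"
        using insert.prems(4)[of q] that split by simp
      have 2: "a t0 q0 m0 * f m0 + (\<Sum>m\<in>M'. a t0 q0 m * f m) = 0"
        using insert.prems(4)[of q0] split by simp
      have "(\<Sum>m\<in>M'. b t0 q m * f m) =
        a t0 q0 m0 * (\<Sum>m\<in>M'. a t0 q m * f m) - a t0 q m0 * (\<Sum>m\<in>M'. a t0 q0 m * f m)"
        by (simp add: b_def algebra_simps sum_subtractf sum_distrib_left)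
      also have "\<dots> = 0" using 1 2 by (simp add: add_eq_0_iff)
      finally show ?thesis .
    qed
  qed
  then obtain h c where h: "c \<noteq> 0" "\<And>m. m \<in> M' \<Longrightarrow> (\<lambda>t. h t m) \<in> F"
      "\<And>t q. q \<in> Q \<Longrightarrow> (\<Sum>m\<in>M'. b t q m * h t m) = 0" "\<And>m. m \<in> M' \<Longrightarrow> h t0 m = c * f m"
    by blast
  \<comment> \<open>Back substitution: the solution of the reduced system is multiplied by the
    pivot, so that the entry at \<open>m0\<close> solving row \<open>q0\<close> is found without
    division. The constant relating \<open>k t0\<close> to \<open>f\<close> thus collects the pivots
    at \<open>t0\<close>.\<close>
  define k where "k t = (\<lambda>m. a t q0 m0 * h t m)(m0 := - (\<Sum>m\<in>M'. a t q0 m * h t m))" for t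
  have kM': "(\<Sum>m\<in>M'. a t q m * k t m) = a t q0 m0 * (\<Sum>m\<in>M'. a t q m * h t m)" for t q
    unfolding sum_distrib_left by (intro sum.cong refl) (auto simp: k_def M'_def)
  have km0: "k t m0 = - (\<Sum>m\<in>M'. a t q0 m * h t m)" for t by (simp add: k_def)
  show ?case
  proof (intro exI[of _ k] exI[of _ "a t0 q0 m0 * c"] conjI allI ballI)
    show "a t0 q0 m0 * c \<noteq> 0" using m0 h by simp
    show "(\<lambda>t. k t m) \<in> F" if "m \<in> M" for m
    proof (cases "m = m0")
      case True
      have "(\<lambda>t. - (\<Sum>m\<in>M'. a t q0 m * h t m)) \<in> F"
        using insert.prems(2) h(2)
        by (intro fun_alg_uminus[OF F] fun_alg_sum[OF F] fun_alg_mult[OF F]) (auto simp: M'_def)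
      then show ?thesis using True km0 by simp
    next
      case False
      then have "(\<lambda>t. a t q0 m0 * h t m) \<in> F"
        using insert.prems(2) h(2) m0 that by (intro fun_alg_mult[OF F]) (auto simp: M'_def)
      then show ?thesis using False by (simp add: k_def)
    qed
    show "(\<Sum>m\<in>M. a t q m * k t m) = 0" if q: "q \<in> insert q0 Q" for t q
    proof (cases "q = q0")
      case True then show ?thesis unfolding split kM' km0 by simp
    next
      case False
      then have "(\<Sum>m\<in>M'. b t q m * h t m) = 0" using h(3) q by simp
      then have "a t q0 m0 * (\<Sum>m\<in>M'. a t q m * h t m) - a t q m0 * (\<Sum>m\<in>M'. a t q0 m * h t m) = 0"
        by (simp add: b_def algebra_simps sum_subtractf sum_distrib_left)
      then show ?thesis unfolding split kM' km0 by (simp add: algebra_simps)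
    qed
    show "k t0 m = a t0 q0 m0 * c * f m" if "m \<in> M" for m
    proof (cases "m = m0")
      case True
      have 2: "a t0 q0 m0 * f m0 = - (\<Sum>m\<in>M'. a t0 q0 m * f m)"
        using insert.prems(4)[of q0] split by (simp add: add_eq_0_iff)
      have "(\<Sum>m\<in>M'. a t0 q0 m * h t0 m) = c * (\<Sum>m\<in>M'. a t0 q0 m * f m)"
        unfolding sum_distrib_left by (intro sum.cong refl) (simp add: h(4))
      then have "k t0 m0 = c * (a t0 q0 m0 * f m0)" unfolding km0 2 by simp
      then show ?thesis using True by (simp add: algebra_simps)
    next
      case False then show ?thesis using that h(4)[of m] by (simp add: k_def M'_def)
    qed
  qed
qed

section \<open>Polynomial functions and the Jacobian criterion\<close>

definition mon :: "('v \<Rightarrow>\<^sub>0 nat) \<Rightarrow> ('v \<Rightarrow> complex) \<Rightarrow> complex" where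
  "mon m y = (\<Prod>v\<in>keys m. y v ^ lookup m v)"

lemma mon_superset:
  assumes "finite A" "keys m \<subseteq> A"
  shows "mon m y = (\<Prod>v\<in>A. y v ^ lookup m v)"
  unfolding mon_def
  by (rule prod.mono_neutral_left) (use assms in \<open>auto simp: in_keys_iff\<close>)

lemma mon_0 [simp]: "mon 0 y = 1"
  by (simp add: mon_def)

lemma mon_single [simp]: "mon (single v k) y = y v ^ k"
  by (simp add: mon_superset[of "{v}"])

lemma mon_add: "mon (m + m') y = mon m y * mon m' y"
proof -
  define A where "A = keys m \<union> keys m'"
  have "finite A" "keys m \<subseteq> A" "keys m' \<subseteq> A" "keys (m + m') \<subseteq> A"
    using Poly_Mapping.keys_add[of m m'] by (auto simp: A_def)
  then show ?thesis
    by (simp add: mon_superset[of A] lookup_add power_add prod.distrib)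
qed

lemma mon_eq_0_iff: "mon m y = 0 \<longleftrightarrow> (\<exists>v\<in>keys m. y v = 0)"
  by (auto simp: mon_def in_keys_iff)

lemma poly_eval_eq: "poly_eval f y = (\<Sum>t\<in>keys f. lookup f t * mon t y)"
  by (simp add: poly_eval_def mon_def)

lemma poly_eval_superset:
  assumes "finite A" "keys f \<subseteq> A"
  shows "poly_eval f y = (\<Sum>t\<in>A. lookup f t * mon t y)"
  unfolding poly_eval_eq
  by (rule sum.mono_neutral_left) (use assms in \<open>auto simp: in_keys_iff\<close>)

lemma poly_eval_0 [simp]: "poly_eval 0 y = 0"
  by (simp add: poly_eval_eq)

lemma poly_eval_single [simp]: "poly_eval (single m c) y = c * mon m y"
  by (simp add: poly_eval_superset[of "{m}"])

lemma poly_eval_1 [simp]: "poly_eval 1 y = 1"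
  using poly_eval_single[of 0 1 y] by simp

lemma poly_eval_add: "poly_eval (f + g) y = poly_eval f y + poly_eval g y"
proof -
  define A where "A = keys f \<union> keys g"
  have "finite A" "keys f \<subseteq> A" "keys g \<subseteq> A" "keys (f + g) \<subseteq> A"
    using Poly_Mapping.keys_add[of f g] by (auto simp: A_def)
  then show ?thesis
    by (simp add: poly_eval_superset[of A] lookup_add ring_distribs sum.distrib)
qed

lemma poly_eval_sum: "poly_eval (\<Sum>i\<in>I. f i) y = (\<Sum>i\<in>I. poly_eval (f i) y)"
  by (induction I rule: infinite_finite_induct) (simp_all add: poly_eval_add)

lemma poly_mapping_sum_single:
  fixes f :: "'a \<Rightarrow>\<^sub>0 'b::comm_monoid_add"
  shows "f = (\<Sum>t\<in>keys f. single t (lookup f t))"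
  by (rule poly_mapping_eqI)
    (simp add: lookup_sum lookup_single when_def sum.delta in_keys_iff)

lemma poly_mapping_mult_sum:
  fixes f g :: "'a::monoid_add \<Rightarrow>\<^sub>0 'b::semiring_0"
  shows "f * g = (\<Sum>t\<in>keys f. \<Sum>t'\<in>keys g.
    single (t + t') (lookup f t * lookup g t'))"
proof -
  have "f * g = (\<Sum>t\<in>keys f. single t (lookup f t)) *
      (\<Sum>t\<in>keys g. single t (lookup g t))"
    by (simp flip: poly_mapping_sum_single)
  then show ?thesis by (simp add: sum_product mult_single)
qed

lemma poly_eval_mult: "poly_eval (f * g) y = poly_eval f y * poly_eval g y"
  unfolding poly_mapping_mult_sum[of f g] poly_eval_sum poly_eval_single mon_add
  unfolding poly_eval_eq[of f] poly_eval_eq[of g] sum_product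
  by (intro sum.cong refl) (simp add: algebra_simps)

lemma poly_eval_power: "poly_eval (f ^ n) y = poly_eval f y ^ n"
  by (induction n) (simp_all add: poly_eval_mult)

lemma poly_eval_prod: "poly_eval (\<Prod>i\<in>I. f i) y = (\<Prod>i\<in>I. poly_eval (f i) y)"
  by (induction I rule: infinite_finite_induct) (simp_all add: poly_eval_mult)

text \<open>Polynomial functions are generated inductively instead of being given by coefficients,
  so that substitution into any function algebra and differentiation are handled by rule
  induction.\<close>

inductive polyfun :: "'q set \<Rightarrow> (('q \<Rightarrow> complex) \<Rightarrow> complex) \<Rightarrow> bool" for Q where
  const: "polyfun Q (\<lambda>_. c)"
| coord: "q \<in> Q \<Longrightarrow> polyfun Q (\<lambda>z. z q)"
| add: "polyfun Q f \<Longrightarrow> polyfun Q g \<Longrightarrow> polyfun Q (\<lambda>z. f z + g z)"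
| mult: "polyfun Q f \<Longrightarrow> polyfun Q g \<Longrightarrow> polyfun Q (\<lambda>z. f z * g z)"

lemma fun_alg_polyfun: "fun_alg (Collect (polyfun Q))"
  by (auto simp: fun_alg_def intro: polyfun.intros)

lemmas polyfun_sum = fun_alg_sum[OF fun_alg_polyfun, simplified]
  and polyfun_prod = fun_alg_prod[OF fun_alg_polyfun, simplified]
  and polyfun_power = fun_alg_power[OF fun_alg_polyfun, simplified]

lemma polyfun_compose:
  assumes "polyfun M f" "fun_alg A" "\<And>m. m \<in> M \<Longrightarrow> (\<lambda>t. g t m) \<in> A"
  shows "(\<lambda>t. f (g t)) \<in> A"
  using assms(1)
  by induction (auto intro: fun_alg_const fun_alg_add fun_alg_mult assms)

lemma polyfun_mon: "keys m \<subseteq> Q \<Longrightarrow> polyfun Q (mon m)"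
  unfolding mon_def
  by (intro polyfun_prod polyfun_power polyfun.coord) auto

lemma polyfun_poly_eval: "(\<And>t. t \<in> keys f \<Longrightarrow> keys t \<subseteq> Q) \<Longrightarrow> polyfun Q (poly_eval f)"
  unfolding poly_eval_eq
  by (intro polyfun_sum polyfun.mult polyfun.const polyfun_mon) auto

lemma polyfun_line:
  assumes "polyfun Q f"
  shows "\<exists>p. \<forall>t. f (\<lambda>q. a q + t * b q) = poly p t"
proof -
  have "(\<lambda>t. f (\<lambda>q. a q + t * b q)) \<in> {f. \<exists>p. \<forall>t. f t = poly p t}"
  proof (rule polyfun_compose[OF assms fun_alg_poly])
    show "(\<lambda>t. a q + t * b q) \<in> {f. \<exists>p. \<forall>t. f t = poly p t}" for q
      by (auto intro!: exI[of _ "[:a q, b q:]"])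
  qed
  then show ?thesis by auto
qed

text \<open>The chain rule along a path on which every inner coordinate is stationary; induction on
  the construction of \<open>f\<close> avoids writing down a gradient.\<close>

lemma polyfun_deriv_zero:
  assumes "polyfun M f" "\<And>m. m \<in> M \<Longrightarrow> ((\<lambda>t. g t m) has_field_derivative 0) (at (t0::complex))"
  shows "((\<lambda>t. f (g t)) has_field_derivative 0) (at t0)"
  using assms(1)
proof induction
  case (add f h)
  then show ?case using DERIV_add[OF add.IH] by simp
next
  case (mult f h)
  then show ?case using DERIV_mult[OF mult.IH] by simp
qed (auto intro: assms)

text \<open>Nonempty Zariski open subsets of affine space meet: on the line joining a common nonzero
  of the earlier functions to a nonzero of the new one, each function restricts to a nonzero
  polynomial, which has finitely many roots.\<close>

lemma polyfun_nonzero_common: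
  assumes "finite I" "\<And>i. i \<in> I \<Longrightarrow> polyfun Q (f i)" "\<And>i. i \<in> I \<Longrightarrow> \<exists>z. f i z \<noteq> 0"
  shows "\<exists>z. \<forall>i\<in>I. f i z \<noteq> 0"
  using assms
proof (induction I rule: finite_induct)
  case (insert i I)
  obtain a where a: "\<forall>i\<in>I. f i a \<noteq> 0" using insert by auto
  obtain b where b: "f i b \<noteq> 0" using insert.prems by auto
  have fin: "finite {t. f i' (\<lambda>q. a q + t * (b q - a q)) = 0}" if i': "i' \<in> insert i I" for i'
  proof -
    obtain p where p: "\<And>t. f i' (\<lambda>q. a q + t * (b q - a q)) = poly p t"
      using polyfun_line[OF insert.prems(1)[OF i'], of a "\<lambda>q. b q - a q"] by blast
    have "poly p 0 \<noteq> 0 \<or> poly p 1 \<noteq> 0"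
      using a b i' p[of 0] p[of 1] by auto
    then have "p \<noteq> 0" by auto
    then show ?thesis unfolding p by (rule poly_roots_finite)
  qed
  then have "finite (\<Union>i'\<in>insert i I. {t. f i' (\<lambda>q. a q + t * (b q - a q)) = 0})"
    using insert.hyps by blast
  then obtain t where "t \<notin> (\<Union>i'\<in>insert i I. {t. f i' (\<lambda>q. a q + t * (b q - a q)) = 0})"
    using ex_new_if_finite[OF infinite_UNIV_char_0] by blast
  then show ?case by blast
qed auto

section \<open>Degree bounds, algebraic relations and their derivatives\<close>

text \<open>The bound concerns the degree in each variable separately. For finite \<open>Q\<close>
  the functions of bound \<open>D\<close> are then spanned by \<open>(D + 1) ^ card Q\<close>
  monomials, which is easy to compare with a number of exponent vectors.\<close>

inductive bdeg :: "'q set \<Rightarrow> nat \<Rightarrow> (('q \<Rightarrow> complex) \<Rightarrow> complex) \<Rightarrow> bool" for Q D where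
  monom: "(\<And>q. q \<in> Q \<Longrightarrow> b q \<le> D) \<Longrightarrow> bdeg Q D (\<lambda>z. c * (\<Prod>q\<in>Q. z q ^ b q))"
| add: "bdeg Q D f \<Longrightarrow> bdeg Q D g \<Longrightarrow> bdeg Q D (\<lambda>z. f z + g z)"

lemma bdeg_mono: "bdeg Q D f \<Longrightarrow> D \<le> D' \<Longrightarrow> bdeg Q D' f"
  by (induction rule: bdeg.induct) (auto intro: bdeg.intros order_trans)

lemma bdeg_const: "bdeg Q D (\<lambda>_. c)"
  using bdeg.monom[of Q "\<lambda>_. 0" D c] by simp

lemma bdeg_coord: "finite Q \<Longrightarrow> q \<in> Q \<Longrightarrow> bdeg Q 1 (\<lambda>z. z q)"
  using bdeg.monom[of Q "\<lambda>q'. if q' = q then 1 else 0" 1 1]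
  by (simp add: if_distrib prod.delta cong: if_cong)

lemma bdeg_mult:
  assumes "bdeg Q D f" "bdeg Q D' g"
  shows "bdeg Q (D + D') (\<lambda>z. f z * g z)"
  using assms(1)
proof induction
  case (monom b c)
  from assms(2) show ?case
  proof induction
    case (monom b' c')
    have "bdeg Q (D + D') (\<lambda>z. (c * c') * (\<Prod>q\<in>Q. z q ^ (b q + b' q)))"
      using monom \<open>\<And>q. q \<in> Q \<Longrightarrow> b q \<le> D\<close> by (intro bdeg.monom add_mono) auto
    then show ?case by (simp add: power_add prod.distrib algebra_simps)
  next
    case (add f g)
    then show ?case using bdeg.add[OF add.IH] by (simp add: algebra_simps)
  qed
next
  case (add f g)
  then show ?case using bdeg.add[OF add.IH] by (simp add: algebra_simps)
qed

lemma bdeg_power: "bdeg Q D f \<Longrightarrow> bdeg Q (n * D) (\<lambda>z. f z ^ n)"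
  by (induction n) (auto intro: bdeg_const dest: bdeg_mult)

lemma bdeg_prod:
  assumes "finite K" "\<And>k. k \<in> K \<Longrightarrow> bdeg Q (D k) (f k)"
  shows "bdeg Q (\<Sum>k\<in>K. D k) (\<lambda>z. \<Prod>k\<in>K. f k z)"
  using assms by (induction K rule: finite_induct) (auto intro: bdeg_const bdeg_mult)

lemma polyfun_bdeg: "polyfun Q f \<Longrightarrow> finite Q \<Longrightarrow> \<exists>D. bdeg Q D f"
proof (induction rule: polyfun.induct)
  case (add f g)
  then obtain D D' where "bdeg Q D f" "bdeg Q D' g" by auto
  then have "bdeg Q (max D D') (\<lambda>z. f z + g z)"
    by (intro bdeg.add) (auto intro: bdeg_mono)
  then show ?case by blast
qed (auto intro: bdeg_const bdeg_coord bdeg_mult)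

lemma bdeg_expand:
  assumes "bdeg Q D f" "finite Q"
  shows "\<exists>c. \<forall>z. f z = (\<Sum>b\<in>Q \<rightarrow>\<^sub>E {..D}. c b * (\<Prod>q\<in>Q. z q ^ b q))"
  using assms(1)
proof induction
  case (monom b c)
  have fin: "finite (Q \<rightarrow>\<^sub>E {..D})" using assms(2) by (simp add: finite_PiE)
  have mem: "restrict b Q \<in> Q \<rightarrow>\<^sub>E {..D}" using monom by auto
  show ?case
  proof (intro exI[of _ "\<lambda>b'. if b' = restrict b Q then c else 0"] allI)
    fix z :: "'a \<Rightarrow> complex"
    have "(\<Sum>b'\<in>Q \<rightarrow>\<^sub>E {..D}. (if b' = restrict b Q then c else 0) * (\<Prod>q\<in>Q. z q ^ b' q)) =
       (\<Sum>b'\<in>Q \<rightarrow>\<^sub>E {..D}. if b' = restrict b Q then c * (\<Prod>q\<in>Q. z q ^ restrict b Q q) else 0)"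
      by (intro sum.cong) auto
    then show "c * (\<Prod>q\<in>Q. z q ^ b q) = (\<Sum>b'\<in>Q \<rightarrow>\<^sub>E {..D}. (if b' =
        restrict b Q then c else 0) * (\<Prod>q\<in>Q. z q ^ b' q))"
      using fin mem by (simp add: sum.delta)
  qed
next
  case (add f g)
  then obtain c c' where "\<And>z. f z = (\<Sum>b\<in>Q \<rightarrow>\<^sub>E {..D}. c b * (\<Prod>q\<in>Q. z q ^ b q))"
    "\<And>z. g z = (\<Sum>b\<in>Q \<rightarrow>\<^sub>E {..D}. c' b * (\<Prod>q\<in>Q. z q ^ b q))" by blast
  then show ?case by (intro exI[of _ "\<lambda>b. c b + c' b"]) (simp add: ring_distribs sum.distrib)
qed

text \<open>A coordinate and \<open>card Q\<close> polynomial functions are one function more than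
  there are variables. For large exponents there are more products of them than monomials needed to
  expand these products, so a linear relation exists.\<close>

lemma algebraic_relation:
  assumes Q: "finite Q" "i \<in> Q" and G: "\<And>k. k < card Q \<Longrightarrow> polyfun Q (G k)"
  shows "\<exists>A B c. finite B \<and> B \<subseteq> extensional {..<card Q} \<and> (\<exists>a\<le>A. \<exists>b\<in>B. c a b \<noteq> (0::complex)) \<and>
    (\<forall>z. (\<Sum>a\<le>A. \<Sum>b\<in>B. c a b * (z i ^ a * (\<Prod>k<card Q. G k z ^ b k))) = 0)"
proof -
  define R where "R = card Q"
  have "\<forall>k<R. \<exists>D. bdeg Q D (G k)" using polyfun_bdeg[OF G Q(1)] by (auto simp: R_def)
  then obtain D where D: "\<And>k. k < R \<Longrightarrow> bdeg Q (D k) (G k)" by metis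
  define d where "d = (\<Sum>k<R. D k)"
  have Dd: "bdeg Q d (G k)" if "k < R" for k
    using D[OF that] by (rule bdeg_mono) (use that in \<open>auto simp: d_def intro!: member_le_sum\<close>)
  \<comment> \<open>With exponents at most \<open>K\<close> there are
    \<open>(K + 1) ^ (R + 1)\<close> products, each of degree at most \<open>E\<close> in every
    variable, and \<open>E + 1 \<le> (K + 1) * (R * d + 1)\<close>. This \<open>K\<close> turns the
    bound \<open>(E + 1) ^ R\<close> for the monomials into \<open>(K + 1) ^ R * K\<close>, just
    below the number of products.\<close>
  define K where "K = (R * d + 1) ^ R"
  define E where "E = K * (R * d + 1)"
  \<comment> \<open>Extensional functions, so that distinct elements of \<open>B\<close> are
    distinct exponent vectors.\<close>
  define B where "B = {..<R} \<rightarrow>\<^sub>E {..K}"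
  have finB: "finite B" by (simp add: B_def finite_PiE)
  have "bdeg Q E (\<lambda>z. z i ^ a * (\<Prod>k<R. G k z ^ b k))" if "a \<le> K" "b \<in> B" for a b
  proof (rule bdeg_mono)
    show "bdeg Q (a * 1 + (\<Sum>k<R. b k * d)) (\<lambda>z. z i ^ a * (\<Prod>k<R. G k z ^ b k))"
      by (intro bdeg_mult bdeg_power bdeg_prod bdeg_coord Q Dd) auto
    have "(\<Sum>k<R. b k * d) \<le> (\<Sum>k<R. K * d)"
      by (intro sum_mono mult_right_mono) (use that in \<open>auto simp: B_def\<close>)
    then show "a * 1 + (\<Sum>k<R. b k * d) \<le> E" using that by (simp add: E_def algebra_simps)
  qed
  from bdeg_expand[OF this Q(1)]
  have "\<forall>p\<in>{..K} \<times> B. \<exists>c. \<forall>z. z i ^ fst p * (\<Prod>k<R. G k z ^ snd p k) =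
      (\<Sum>g\<in>Q \<rightarrow>\<^sub>E {..E}. c g * (\<Prod>q\<in>Q. z q ^ g q))" by auto
  from bchoice[OF this] obtain C where C: "\<And>p z. p \<in> {..K} \<times> B \<Longrightarrow> z i ^ fst p * (\<Prod>k<R. G k z ^ snd p k) =
      (\<Sum>g\<in>Q \<rightarrow>\<^sub>E {..E}. C p g * (\<Prod>q\<in>Q. z q ^ g q))" by blast
  have "card (Q \<rightarrow>\<^sub>E {..E}) = (E + 1) ^ R" using Q by (simp add: card_PiE R_def)
  also have "\<dots> \<le> ((K + 1) * (R * d + 1)) ^ R" by (intro power_mono) (auto simp: E_def)
  also have "\<dots> = (K + 1) ^ R * K" unfolding power_mult_distrib by (simp only: K_def)
  also have "\<dots> < (K + 1) ^ R * (K + 1)" by simp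
  also have "\<dots> = card ({..K} \<times> B)" by (simp add: B_def card_PiE card_cartesian_product)
  finally have "card (Q \<rightarrow>\<^sub>E {..E}) < card ({..K} \<times> B)" .
  from underdetermined[OF _ _ this, of C] obtain x where
    x: "\<exists>p\<in>{..K} \<times> B. x p \<noteq> 0" "\<And>g. g \<in> Q \<rightarrow>\<^sub>E {..E} \<Longrightarrow> (\<Sum>p\<in>{..K} \<times> B. x p * C p g) = 0"
    using finB Q(1) by (auto simp: finite_PiE)
  have "(\<Sum>a\<le>K. \<Sum>b\<in>B. x (a, b) * (z i ^ a * (\<Prod>k<R. G k z ^ b k))) = 0" for z
  proof -
    have "(\<Sum>a\<le>K. \<Sum>b\<in>B. x (a, b) * (z i ^ a * (\<Prod>k<R. G k z ^ b k))) =
      (\<Sum>p\<in>{..K} \<times> B. x p * (z i ^ fst p * (\<Prod>k<R. G k z ^ snd p k)))"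
      by (simp add: sum.cartesian_product case_prod_unfold)
    also have "\<dots> = (\<Sum>p\<in>{..K} \<times> B. \<Sum>g\<in>Q \<rightarrow>\<^sub>E {..E}. x p * C p g * (\<Prod>q\<in>Q. z q ^ g q))"
      by (intro sum.cong refl) (simp add: C sum_distrib_left mult.assoc)
    also have "\<dots> = (\<Sum>g\<in>Q \<rightarrow>\<^sub>E {..E}. \<Sum>p\<in>{..K} \<times> B. x p * C p g * (\<Prod>q\<in>Q. z q ^ g q))"
      by (rule sum.swap)
    also have "\<dots> = (\<Sum>g\<in>Q \<rightarrow>\<^sub>E {..E}. (\<Sum>p\<in>{..K} \<times> B. x p * C p g) * (\<Prod>q\<in>Q. z q ^ g q))"
      by (simp only: sum_distrib_right)
    also have "\<dots> = 0" by (intro sum.neutral ballI) (simp only: x(2) mult_zero_left)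
    finally show ?thesis .
  qed
  moreover have "B \<subseteq> extensional {..<R}" by (auto simp: B_def PiE_def)
  ultimately show ?thesis
    using x(1) finB unfolding R_def
    by (intro exI[of _ K] exI[of _ B] exI[of _ "\<lambda>a b. x (a, b)"]) auto
qed

text \<open>
  The Jacobian criterion in characteristic zero.  By a dimension count every coordinate satisfies a
  polynomial relation over the \<open>F k \<circ> \<Phi>\<close>; in a relation of minimal degree the derivative with respect to
  the coordinate does not vanish identically, and differentiating along a vector in the kernel of
  the differential of \<open>\<Phi>\<close> shows that the corresponding entry of that vector is zero.
\<close>

lemma algebraic_relation_separable:
  assumes Q: "finite Q" "i \<in> Q" and G: "\<And>k. k < card Q \<Longrightarrow> polyfun Q (G k)"
    and indep: "\<And>B c. finite B \<Longrightarrow> B \<subseteq> extensional {..<card Q} \<Longrightarrow>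
      (\<And>z. (\<Sum>b\<in>B. c b * (\<Prod>k<card Q. G k z ^ b k)) = 0) \<Longrightarrow> \<forall>b\<in>B. c b = (0::complex)"
  shows "\<exists>A B c. finite B \<and>
    (\<forall>z. (\<Sum>a\<le>A. \<Sum>b\<in>B. c a b * (z i ^ a * (\<Prod>k<card Q. G k z ^ b k))) = 0) \<and>
    (\<exists>z. (\<Sum>a<A. \<Sum>b\<in>B. of_nat (Suc a) * c (Suc a) b * (z i ^ a * (\<Prod>k<card Q. G k z ^ b k))) \<noteq> 0)"
proof -
  define rel where "rel A \<longleftrightarrow> (\<exists>B c. finite B \<and> B \<subseteq> extensional {..<card Q} \<and> (\<exists>a\<le>A. \<exists>b\<in>B. c a b \<noteq> (0::complex)) \<and>
    (\<forall>z. (\<Sum>a\<le>A. \<Sum>b\<in>B. c a b * (z i ^ a * (\<Prod>k<card Q. G k z ^ b k))) = 0))" for A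
  have "\<exists>A. rel A" unfolding rel_def by (rule algebraic_relation[OF Q G])
  then have least: "rel (LEAST A. rel A)" by (rule LeastI_ex)
  define A where "A = (LEAST A. rel A)"
  obtain B c where Bc: "finite B \<and> B \<subseteq> extensional {..<card Q} \<and> (\<exists>a\<le>A. \<exists>b\<in>B. c a b \<noteq> (0::complex)) \<and>
    (\<forall>z. (\<Sum>a\<le>A. \<Sum>b\<in>B. c a b * (z i ^ a * (\<Prod>k<card Q. G k z ^ b k))) = 0)"
    using least[folded A_def, unfolded rel_def] by (elim exE) (rule that)
  note B = Bc[THEN conjunct1] Bc[THEN conjunct2, THEN conjunct1]
  note nz = Bc[THEN conjunct2, THEN conjunct2, THEN conjunct1]
  note eq = Bc[THEN conjunct2, THEN conjunct2, THEN conjunct2, rule_format]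
  have "\<exists>z. (\<Sum>a<A. \<Sum>b\<in>B. of_nat (Suc a) * c (Suc a) b * (z i ^ a * (\<Prod>k<card Q. G k z ^ b k))) \<noteq> 0"
  proof (rule ccontr)
    assume "\<not> ?thesis"
    then have z: "(\<Sum>a<A. \<Sum>b\<in>B. of_nat (Suc a) * c (Suc a) b * (z i ^ a * (\<Prod>k<card Q. G k z ^ b k))) = 0" for z
      by blast
    \<comment> \<open>If a coefficient of positive degree were nonzero, the derivative would be a
      nontrivial relation of degree \<open>A - 1\<close>, against the minimality of
      \<open>A\<close>. Characteristic zero enters through the factor
      \<open>of_nat (Suc a)\<close>.\<close>
    have c0: "c (Suc a) b = 0" if ab: "a < A" "b \<in> B" for a b
    proof (rule ccontr)
      assume ne: "c (Suc a) b \<noteq> 0"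
      have le: "{..A - 1} = {..<A}" using ab by auto
      have "rel (A - 1)" unfolding rel_def
        using B z ne ab
        by (intro exI[of _ B] exI[of _ "\<lambda>a b. of_nat (Suc a) * c (Suc a) b"])
          (auto simp: le[unfolded One_nat_def] simp del: of_nat_Suc intro!: exI[of _ a] bexI[of _ b])
      then have "A \<le> A - 1" unfolding A_def by (rule Least_le)
      then show False using ab by simp
    qed
    have "(\<Sum>b\<in>B. c 0 b * (\<Prod>k<card Q. G k z ^ b k)) = 0" for z
    proof -
      have "(\<Sum>a\<le>A. \<Sum>b\<in>B. c a b * (z i ^ a * (\<Prod>k<card Q. G k z ^ b k))) =
        (\<Sum>b\<in>B. c 0 b * (\<Prod>k<card Q. G k z ^ b k)) +
        (\<Sum>a<A. \<Sum>b\<in>B. c (Suc a) b * (z i ^ Suc a * (\<Prod>k<card Q. G k z ^ b k)))"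
        by (simp add: sum.atMost_shift)
      also have "(\<Sum>a<A. \<Sum>b\<in>B. c (Suc a) b * (z i ^ Suc a * (\<Prod>k<card Q. G k z ^ b k))) = 0"
        by (simp add: c0)
      finally show ?thesis using eq[of z] by simp
    qed
    then have "\<forall>b\<in>B. c 0 b = 0" by (rule indep[OF B])
    then have "c a b = 0" if "a \<le> A" "b \<in> B" for a b
      using c0 that by (cases a) auto
    then show False using nz by blast
  qed
  then show ?thesis using B(1) eq by (intro exI[of _ A] exI[of _ B] exI[of _ c] conjI) auto
qed

text \<open>The functions are as many as the parameters, so every coordinate satisfies a relation
  over them. The point \<open>z\<close> is one where none of the finitely many derivatives of these
  relations vanishes.\<close>

lemma immersive_point:
  assumes Q: "finite Q"
    and \<Phi>: "\<And>m. m \<in> M \<Longrightarrow> polyfun Q (\<lambda>z. \<Phi> z m)"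
    and F: "\<And>k. k < card Q \<Longrightarrow> polyfun M (F k)"
    and indep: "\<And>B c. finite B \<Longrightarrow> B \<subseteq> extensional {..<card Q} \<Longrightarrow>
      (\<And>z. (\<Sum>b\<in>B. c b * (\<Prod>k<card Q. F k (\<Phi> z) ^ b k)) = 0) \<Longrightarrow> \<forall>b\<in>B. c b = (0::complex)"
  shows "\<exists>z. \<forall>v. (\<forall>m\<in>M. ((\<lambda>t. \<Phi> (\<lambda>q. z q + t * v q) m) has_field_derivative 0) (at 0)) \<longrightarrow> (\<forall>q\<in>Q. v q = 0)"
proof -
  let ?G = "\<lambda>k z. F k (\<Phi> z)"
  have G: "polyfun Q (?G k)" if "k < card Q" for k
    using polyfun_compose[OF F[OF that] fun_alg_polyfun, of \<Phi> Q] \<Phi> by auto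
  define P where "P i A B c \<longleftrightarrow> finite B \<and>
    (\<forall>z. (\<Sum>a\<le>A. \<Sum>b\<in>B. c a b * (z i ^ a * (\<Prod>k<card Q. ?G k z ^ b k))) = 0) \<and>
    (\<exists>z. (\<Sum>a<A. \<Sum>b\<in>B. of_nat (Suc a) * c (Suc a) b * (z i ^ a * (\<Prod>k<card Q. ?G k z ^ b k))) \<noteq> (0::complex))"
    for i A B c
  have "\<exists>A B c. P i A B c" if "i \<in> Q" for i
    unfolding P_def by (rule algebraic_relation_separable[OF Q that G indep])
  then obtain A B c where P: "\<And>i. i \<in> Q \<Longrightarrow> P i (A i) (B i) (c i)" by metis
  have
    rel: "i \<in> Q \<Longrightarrow> (\<Sum>a\<le>A i. \<Sum>b\<in>B i. c i a b * (z i ^ a * (\<Prod>k<card Q. ?G k z ^ b k))) = 0"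
    and sep: "i \<in> Q \<Longrightarrow> \<exists>z. (\<Sum>a<A i. \<Sum>b\<in>B i. of_nat (Suc a) * c i (Suc a) b * (z i ^ a * (\<Prod>k<card Q. ?G k
        z ^ b k))) \<noteq> (0::complex)" for i z
    using P[unfolded P_def] by blast+
  have "\<exists>z. \<forall>i\<in>Q. (\<Sum>a<A i. \<Sum>b\<in>B i. of_nat (Suc a) * c i (Suc a) b * (z i ^ a * (\<Prod>k<card Q. ?G k z ^ b k))) \<noteq> 0"
    by (rule polyfun_nonzero_common[OF Q _ sep])
      (auto intro!: polyfun_sum polyfun.mult polyfun.const polyfun_power polyfun.coord polyfun_prod G)
  then obtain z where z: "\<And>i. i \<in> Q \<Longrightarrow>
    (\<Sum>a<A i. \<Sum>b\<in>B i. of_nat (Suc a) * c i (Suc a) b * (z i ^ a * (\<Prod>k<card Q. ?G k z ^ b k))) \<noteq> 0"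
    by blast
  show ?thesis
  proof (intro exI[of _ z] allI impI ballI)
    fix v i
    assume v: "\<forall>m\<in>M. ((\<lambda>t. \<Phi> (\<lambda>q. z q + t * v q) m) has_field_derivative 0) (at 0)" and i: "i \<in> Q"
    define E where "E b t = (\<Prod>k<card Q. ?G k (\<lambda>q. z q + t * v q) ^ b k)" for b :: "nat \<Rightarrow> nat" and t :: complex
    \<comment> \<open>Along \<open>v\<close> the map is stationary to first order, hence so is every
      monomial in the \<open>F k\<close>; only the explicit power of the coordinate contributes when
      the relation is differentiated.\<close>
    have E: "(E b has_field_derivative 0) (at 0)" for b
      unfolding E_def
    proof (rule polyfun_deriv_zero[where f = "\<lambda>y. \<Prod>k<card Q. F k y ^ b k" and M = M and g =
        "\<lambda>t. \<Phi> (\<lambda>q. z q + t * v q)"])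
      show "polyfun M (\<lambda>y. \<Prod>k<card Q. F k y ^ b k)"
        by (intro polyfun_prod polyfun_power F) auto
    qed (use v in auto)
    have "((\<lambda>t. \<Sum>a\<le>A i. \<Sum>b\<in>B i. c i a b * ((z i + t * v i) ^ a * E b t)) has_field_derivative
      (\<Sum>a\<le>A i. \<Sum>b\<in>B i. c i a b * (of_nat a * z i ^ (a - 1) * v i * E b 0))) (at 0)"
      by (auto intro!: derivative_eq_intros E sum.cong)
    moreover have "(\<lambda>t. \<Sum>a\<le>A i. \<Sum>b\<in>B i. c i a b * ((z i + t * v i) ^ a * E b t)) = (\<lambda>_. 0)"
      using rel[OF i, of "\<lambda>q. z q + t * v q" for t] unfolding E_def by auto
    ultimately have "(\<Sum>a\<le>A i. \<Sum>b\<in>B i. c i a b * (of_nat a * z i ^ (a - 1) * v i * E b 0)) = 0"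
      using DERIV_unique[of "\<lambda>_. 0" _ "0::complex" 0] DERIV_const[of "0::complex"] by simp
    also have "(\<Sum>a\<le>A i. \<Sum>b\<in>B i. c i a b * (of_nat a * z i ^ (a - 1) * v i * E b 0)) =
      (\<Sum>a<A i. \<Sum>b\<in>B i. of_nat (Suc a) * c i (Suc a) b * (z i ^ a * E b 0)) * v i"
      unfolding sum.atMost_shift sum_distrib_right
      by (simp add: ac_simps del: of_nat_Suc)
    finally show "v i = 0" using z[OF i] by (simp add: E_def)
  qed
qed

section \<open>Forms, irreducible chains and Terracini's lemma\<close>

text \<open>\<open>form_on\<close> with its degree made explicit, so that it can be tracked through
  sums and products. The zero polynomial has every degree.\<close>

definition homform :: "'m set \<Rightarrow> nat \<Rightarrow> (('m \<Rightarrow>\<^sub>0 nat) \<Rightarrow>\<^sub>0 complex) \<Rightarrow> bool" where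
  "homform M D f \<longleftrightarrow> (\<forall>t\<in>keys f. keys t \<subseteq> M \<and>
     (\<Sum>m\<in>keys t. lookup t m) = D)"

lemma form_on_iff: "form_on M f \<longleftrightarrow> (\<exists>D. homform M D f)"
  by (simp add: form_on_def homform_def)

lemma tdeg_superset:
  fixes t :: "'m \<Rightarrow>\<^sub>0 nat"
  assumes "finite A" "keys t \<subseteq> A"
  shows "(\<Sum>m\<in>keys t. lookup t m) = (\<Sum>m\<in>A. lookup t m)"
  by (rule sum.mono_neutral_left) (use assms in \<open>auto simp: in_keys_iff\<close>)

lemma tdeg_add:
  fixes t t' :: "'m \<Rightarrow>\<^sub>0 nat"
  shows "(\<Sum>m\<in>keys (t + t'). lookup (t + t') m) =
    (\<Sum>m\<in>keys t. lookup t m) + (\<Sum>m\<in>keys t'. lookup t' m)"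
proof -
  define A where "A = keys t \<union> keys t'"
  have A: "finite A" "keys t \<subseteq> A" "keys t' \<subseteq> A" "keys (t + t') \<subseteq> A"
    using Poly_Mapping.keys_add[of t t'] by (auto simp: A_def)
  show ?thesis
    unfolding tdeg_superset[OF A(1,2)] tdeg_superset[OF A(1,3)] tdeg_superset[OF A(1,4)]
    by (simp add: lookup_add sum.distrib)
qed

lemma homform_0 [simp]: "homform M D 0"
  by (simp add: homform_def)

lemma homform_const: "homform M 0 (single 0 c)"
  by (simp add: homform_def)

lemma homform_var: "m \<in> M \<Longrightarrow> homform M 1 (single (single m 1) 1)"
  by (simp add: homform_def)

lemma homform_add: "homform M D f \<Longrightarrow> homform M D g \<Longrightarrow> homform M D (f + g)"
  using Poly_Mapping.keys_add[of f g] by (auto simp: homform_def)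

lemma homform_mult:
  assumes "homform M D f" "homform M D' g"
  shows "homform M (D + D') (f * g)"
  unfolding homform_def
proof
  fix t assume "t \<in> keys (f * g)"
  then obtain a b where ab: "a \<in> keys f" "b \<in> keys g" "t = a + b"
    using keys_mult[of f g] by blast
  have "keys a \<subseteq> M" "keys b \<subseteq> M" using assms ab by (auto simp: homform_def)
  then have "keys t \<subseteq> M" using Poly_Mapping.keys_add[of a b] ab by blast
  then show "keys t \<subseteq> M \<and> (\<Sum>m\<in>keys t. lookup t m) = D + D'"
    using assms ab unfolding homform_def by (simp add: tdeg_add)
qed

lemma homform_sum: "(\<And>i. i \<in> I \<Longrightarrow> homform M D (f i)) \<Longrightarrow> homform M D (\<Sum>i\<in>I. f i)"
  by (induction I rule: infinite_finite_induct) (auto intro: homform_add)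

lemma homform_power: "homform M D f \<Longrightarrow> homform M (D * n) (f ^ n)"
proof (induction n)
  case 0
  then show ?case using homform_const[of M 1] by simp
next
  case (Suc n)
  then show ?case using homform_mult[OF Suc.prems Suc.IH] by simp
qed

lemma homform_prod:
  "(\<And>i. i \<in> I \<Longrightarrow> homform M (D i) (f i)) \<Longrightarrow> homform M (\<Sum>i\<in>I. D i) (\<Prod>i\<in>I. f i)"
  using homform_const[of M 1]
  by (induction I rule: infinite_finite_induct) (auto intro: homform_mult)

lemma poly_eval_scale:
  assumes "homform M D f"
  shows "poly_eval f (\<lambda>m. c * v m) = c ^ D * poly_eval f v"
  unfolding poly_eval_eq sum_distrib_left
proof (intro sum.cong refl)
  fix t assume "t \<in> keys f"
  then have "(\<Sum>m\<in>keys t. lookup t m) = D" using assms by (auto simp: homform_def)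
  then have "mon t (\<lambda>m. c * v m) = c ^ D * mon t v"
    by (simp add: mon_def power_mult_distrib prod.distrib flip: power_sum)
  then show "lookup f t * mon t (\<lambda>m. c * v m) = c ^ D * (lookup f t * mon t v)"
    by simp
qed

lemma poly_eval_cong:
  assumes "homform M D f" "\<And>m. m \<in> M \<Longrightarrow> v m = w m"
  shows "poly_eval f v = poly_eval f w"
  unfolding poly_eval_eq mon_def
  using assms by (intro sum.cong prod.cong arg_cong2[of _ _ _ _ "(*)"] refl) (auto simp: homform_def subset_iff)

lemma polyfun_homform: "homform M D f \<Longrightarrow> polyfun M (poly_eval f)"
  by (rule polyfun_poly_eval) (auto simp: homform_def)

text \<open>Induction along the chain. From a relation on \<open>V (Suc i)\<close> the largest
  common power of \<open>F (Suc i)\<close> is divided out, which primeness permits; restricted to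
  \<open>V i\<close>, where \<open>F (Suc i)\<close> vanishes, the quotient becomes a nontrivial
  relation among the earlier forms. Primeness is assumed for homogeneous forms, hence only relations
  of a single weight \<open>D\<close> are considered.\<close>

lemma chain_forms_independent:
  fixes F :: "nat \<Rightarrow> ('m \<Rightarrow>\<^sub>0 nat) \<Rightarrow>\<^sub>0 complex"
  assumes hom: "\<And>i. i \<le> N \<Longrightarrow> homform M (\<delta> i) (F i)" and \<delta>: "\<delta> 0 > 0"
    and sub: "\<And>i. i < N \<Longrightarrow> V i \<subseteq> V (Suc i)"
    and prime: "\<And>i f g D D'. i \<le> N \<Longrightarrow> homform M D f \<Longrightarrow> homform M D' g \<Longrightarrow>
      (\<And>v. v \<in> V i \<Longrightarrow> poly_eval (f * g) v = 0) \<Longrightarrow>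
      (\<forall>v\<in>V i. poly_eval f v = 0) \<or> (\<forall>v\<in>V i. poly_eval g v = 0)"
    and nz: "\<And>i. i \<le> N \<Longrightarrow> \<exists>v\<in>V i. poly_eval (F i) v \<noteq> 0"
    and z: "\<And>i v. i < N \<Longrightarrow> v \<in> V i \<Longrightarrow> poly_eval (F (Suc i)) v = 0"
  shows "i \<le> N \<Longrightarrow> finite B \<Longrightarrow> B \<subseteq> extensional {..i} \<Longrightarrow> (\<And>b. b \<in> B \<Longrightarrow> (\<Sum>k\<le>i. \<delta> k * b k) = D) \<Longrightarrow>
    (\<And>v. v \<in> V i \<Longrightarrow> (\<Sum>b\<in>B. c b * (\<Prod>k\<le>i. poly_eval (F k) v ^ b k)) = 0) \<Longrightarrow> \<forall>b\<in>B. c b = 0"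
proof (induction i arbitrary: B D c)
  case 0
  show ?case
  proof
    fix b assume b: "b \<in> B"
    \<comment> \<open>Since \<open>\<delta> 0 > 0\<close>, the weight determines the exponent of
      \<open>F 0\<close>: the relation has a single term.\<close>
    have "b' = b" if "b' \<in> B" for b'
    proof (rule extensionalityI[of _ "{..0}"])
      have "\<delta> 0 * b 0 = \<delta> 0 * b' 0" using "0.prems"(4)[OF b] "0.prems"(4)[OF that] by simp
      then show "b' x = b x" if "x \<in> {..0}" for x using that \<delta> by simp
    qed (use b that "0.prems"(3) in blast)+
    then have B: "B = {b}" using b by blast
    obtain v where v: "v \<in> V 0" "poly_eval (F 0) v \<noteq> 0" using nz[of 0] by auto
    have "c b * poly_eval (F 0) v ^ b 0 = 0" using "0.prems"(5)[OF v(1)] by (simp add: B)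
    then show "c b = 0" using v by simp
  qed
next
  case (Suc i)
  show ?case
  proof (rule ccontr)
    assume nzc: "\<not> (\<forall>b\<in>B. c b = 0)"
    define B' where "B' = {b\<in>B. c b \<noteq> 0}"
    have B': "finite B'" "B' \<noteq> {}" "B' \<subseteq> B" using nzc Suc.prems(2) by (auto simp: B'_def)
    define e where "e = Min ((\<lambda>b. b (Suc i)) ` B')"
    have e: "e \<le> b (Suc i)" if "b \<in> B'" for b using that B' by (auto simp: e_def intro: Min_le)
    have "e \<in> (\<lambda>b. b (Suc i)) ` B'" unfolding e_def using B' by (intro Min_in) auto
    then obtain b0 where b0: "b0 \<in> B'" "b0 (Suc i) = e" by auto
    define H where "H = (\<Sum>b\<in>B'. single 0 (c b) * ((\<Prod>k\<le>i. F k ^ b k) * F (Suc i) ^ (b (Suc i) - e)))"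
    have evH: "poly_eval H v = (\<Sum>b\<in>B'. c b * ((\<Prod>k\<le>i. poly_eval (F k) v ^ b k) * poly_eval (F (Suc i)) v
        ^ (b (Suc i) - e)))" for v
      by (simp add: H_def poly_eval_sum poly_eval_mult poly_eval_prod poly_eval_power)
    have homH: "homform M (D - \<delta> (Suc i) * e) H"
      unfolding H_def
    proof (rule homform_sum)
      fix b assume b: "b \<in> B'"
      have "homform M (0 + ((\<Sum>k\<le>i. \<delta> k * b k) + \<delta> (Suc i) * (b (Suc i) - e)))
        (single 0 (c b) * ((\<Prod>k\<le>i. F k ^ b k) * F (Suc i) ^ (b (Suc i) - e)))"
        using Suc.prems(1) by (intro homform_mult homform_const homform_prod homform_power hom) auto
      moreover have "(\<Sum>k\<le>i. \<delta> k * b k) + \<delta> (Suc i) * b (Suc i) = D"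
        using Suc.prems(4)[of b] b B' by auto
      ultimately show "homform M (D - \<delta> (Suc i) * e)
        (single 0 (c b) * ((\<Prod>k\<le>i. F k ^ b k) * F (Suc i) ^ (b (Suc i) - e)))"
        using e[OF b] by (auto simp: diff_mult_distrib2)
    qed
    have "poly_eval (F (Suc i) ^ e * H) v = 0" if "v \<in> V (Suc i)" for v
    proof -
      have "poly_eval (F (Suc i) ^ e * H) v =
          (\<Sum>b\<in>B'. c b * ((\<Prod>k\<le>i. poly_eval (F k) v ^ b k) * (poly_eval (F (Suc i)) v ^ e * poly_eval (F
              (Suc i)) v ^ (b (Suc i) - e))))"
        unfolding poly_eval_mult evH poly_eval_power sum_distrib_left
        by (intro sum.cong refl) (simp add: ac_simps)
      also have "\<dots> = (\<Sum>b\<in>B'. c b * (\<Prod>k\<le>Suc i. poly_eval (F k) v ^ b k))"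
        by (intro sum.cong refl) (simp add: e flip: power_add)
      also have "\<dots> = (\<Sum>b\<in>B. c b * (\<Prod>k\<le>Suc i. poly_eval (F k) v ^ b k))"
        by (rule sum.mono_neutral_left) (use Suc.prems(2) in \<open>auto simp: B'_def\<close>)
      finally show ?thesis using Suc.prems(5)[OF that] by simp
    qed
    from prime[OF Suc.prems(1) homform_power[OF hom[OF Suc.prems(1)]] homH this]
    have "\<forall>v\<in>V (Suc i). poly_eval H v = 0"
      using nz[OF Suc.prems(1)] by (auto simp: poly_eval_power)
    then have H0: "poly_eval H v = 0" if "v \<in> V i" for v
      using that sub[of i] Suc.prems(1) by auto
    \<comment> \<open>The terms of \<open>H\<close> that are free of \<open>F (Suc i)\<close> after
      the division; these survive on \<open>V i\<close>.\<close>
    define B0 where "B0 = {b\<in>B'. b (Suc i) = e}"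
    have B0: "finite B0" "B0 \<subseteq> B'" "b0 \<in> B0" using B' b0 by (auto simp: B0_def)
    \<comment> \<open>The last exponent of \<open>b\<close> is known to be \<open>e\<close>, so
      \<open>b\<close> is recovered from its restriction and distinct terms of \<open>B0\<close>
      stay distinct.\<close>
    have ext: "(restrict b {..i})(Suc i := e) = b" if "b \<in> B0" for b
    proof -
      have "b \<in> extensional {..Suc i}" "b (Suc i) = e"
        using that B' Suc.prems(3) by (auto simp: B0_def)
      then show ?thesis by (auto simp: fun_eq_iff extensional_def restrict_def atMost_Suc)
    qed
    have inj: "inj_on (\<lambda>b. restrict b {..i}) B0"
      by (rule inj_on_inverseI[of _ "\<lambda>b. b(Suc i := e)"]) (use ext in simp)
    have "\<forall>b\<in>(\<lambda>b. restrict b {..i}) ` B0. c (b(Suc i := e)) = 0"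
    proof (rule Suc.IH[where D = "D - \<delta> (Suc i) * e"])
      show "i \<le> N" using Suc.prems(1) by simp
      show "finite ((\<lambda>b. restrict b {..i}) ` B0)" using B0 by simp
      show "(\<lambda>b. restrict b {..i}) ` B0 \<subseteq> extensional {..i}" by auto
      show "(\<Sum>k\<le>i. \<delta> k * b k) = D - \<delta> (Suc i) * e" if hb: "b \<in> (\<lambda>b. restrict b {..i}) ` B0" for b
      proof -
        obtain b' where b': "b' \<in> B0" "b = restrict b' {..i}" using hb by auto
        have "(\<Sum>k\<le>i. \<delta> k * b' k) + \<delta> (Suc i) * e = D"
          using Suc.prems(4)[of b'] b' B0 B' by (auto simp: B0_def)
        then show ?thesis by (simp add: b')
      qed
      show "(\<Sum>b\<in>(\<lambda>b. restrict b {..i}) ` B0. c (b(Suc i := e)) * (\<Prod>k\<le>i. poly_eval (F k) v ^ b k)) = 0"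
        if v: "v \<in> V i" for v
      proof -
        have F0: "poly_eval (F (Suc i)) v = 0" using z[of i v] v Suc.prems(1) by simp
        have "(\<Sum>b\<in>(\<lambda>b. restrict b {..i}) ` B0. c (b(Suc i := e)) * (\<Prod>k\<le>i. poly_eval (F k) v ^ b k)) =
          (\<Sum>b\<in>B0. c b * (\<Prod>k\<le>i. poly_eval (F k) v ^ b k))"
          unfolding sum.reindex[OF inj] o_def
          by (intro sum.cong refl arg_cong2[of _ _ _ _ "(*)"]) (simp_all only: ext, simp)
        also have "\<dots> = (\<Sum>b\<in>B0. c b * ((\<Prod>k\<le>i. poly_eval (F k) v ^ b k) * poly_eval (F (Suc i)) v ^ (b
            (Suc i) - e)))"
          by (intro sum.cong refl) (simp add: B0_def)
        also have "\<dots> = poly_eval H v"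
          unfolding evH
        proof (rule sum.mono_neutral_left)
          show "\<forall>b\<in>B' - B0. c b * ((\<Prod>k\<le>i. poly_eval (F k) v ^ b k) * poly_eval (F (Suc i)) v ^ (b (Suc
              i) - e)) = 0"
          proof
            fix b assume "b \<in> B' - B0"
            then have "b (Suc i) - e > 0" using e[of b] by (auto simp: B0_def)
            then show "c b * ((\<Prod>k\<le>i. poly_eval (F k) v ^ b k) * poly_eval (F (Suc i)) v ^ (b (Suc i) - e)) = 0"
              by (simp add: F0)
          qed
        qed (use B' B0 in auto)
        also have "\<dots> = 0" by (rule H0[OF v])
        finally show ?thesis .
      qed
    qed
    then have "c b0 = 0" using B0(3) ext[OF B0(3)] by (metis image_eqI)
    then show False using b0 by (simp add: B'_def)
  qed
qed

section \<open>Zariski closed sets and the forms on their cones\<close>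

lemma line_of_self: "v \<in> line_of v"
  unfolding line_of_def by (auto intro!: exI[of _ 1])

lemma homform_vanish_line:
  assumes "homform M D f"
  shows "(\<forall>w\<in>line_of v. poly_eval f w = 0) \<longleftrightarrow> poly_eval f v = 0"
  using line_of_self[of v] by (auto simp: line_of_def poly_eval_scale[OF assms])

lemma topspace_zariski [simp]: "topspace (zariski_proj M) = proj_space M"
proof -
  have "L \<in> \<Union> {{L \<in> proj_space M. \<exists>v\<in>L. poly_eval f v \<noteq> 0} | f. form_on M f}" if L: "L \<in> proj_space M" for L
  proof -
    obtain v where "L = line_of v" using L by (auto simp: proj_space_def)
    moreover have "form_on M 1" using homform_const[of M 1] by (auto simp: form_on_iff)
    ultimately show ?thesis using L line_of_self[of v] by (auto intro!: exI[of _ "{L \<in> proj_space M.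
        \<exists>v\<in>L. poly_eval 1 v \<noteq> 0}"])
  qed
  then show ?thesis unfolding zariski_proj_def topology_generated_by_topspace by blast
qed

lemma closedin_zariski_form:
  assumes "form_on M f"
  shows "closedin (zariski_proj M) {L \<in> proj_space M. \<forall>v\<in>L. poly_eval f v = 0}"
proof -
  have "openin (zariski_proj M) {L \<in> proj_space M. \<exists>v\<in>L. poly_eval f v \<noteq> 0}"
    unfolding zariski_proj_def using assms by (intro topology_generated_by_Basis) auto
  moreover have "proj_space M - {L \<in> proj_space M. \<forall>v\<in>L. poly_eval f v = 0} =
      {L \<in> proj_space M. \<exists>v\<in>L. poly_eval f v \<noteq> 0}"
    by auto
  ultimately show ?thesis by (simp add: closedin_def)
qed

text \<open>The nonvanishing loci of forms, given as a subbasis, are already a basis: an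
  intersection of two of them corresponds to the product of the forms, and a form can be tested at
  one spanning vector of a line.\<close>

lemma zariski_open_basic:
  assumes "generate_topology_on {{L \<in> proj_space M. \<exists>v\<in>L. poly_eval f v \<noteq> 0} | f. form_on M f} U" "L \<in> U"
      "L \<in> proj_space M"
  shows "\<exists>f. form_on M f \<and> (\<exists>v\<in>L. poly_eval f v \<noteq> 0) \<and>
    (\<forall>L'\<in>proj_space M. (\<exists>v\<in>L'. poly_eval f v \<noteq> 0) \<longrightarrow> L' \<in> U)"
  using assms
proof (induction rule: generate_topology_on.induct)
  case (Int a b)
  obtain f where f: "form_on M f" "\<exists>v\<in>L. poly_eval f v \<noteq> 0"
      "\<And>L'. L'\<in>proj_space M \<Longrightarrow> (\<exists>v\<in>L'. poly_eval f v \<noteq> 0) \<Longrightarrow> L' \<in> a"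
    using Int by auto
  obtain g where g: "form_on M g" "\<exists>v\<in>L. poly_eval g v \<noteq> 0"
      "\<And>L'. L'\<in>proj_space M \<Longrightarrow> (\<exists>v\<in>L'. poly_eval g v \<noteq> 0) \<Longrightarrow> L' \<in> b"
    using Int by auto
  obtain D D' where D: "homform M D f" "homform M D' g" using f g by (auto simp: form_on_iff)
  obtain x where x: "L = line_of x" using Int.prems by (auto simp: proj_space_def)
  have "poly_eval f x \<noteq> 0" "poly_eval g x \<noteq> 0"
    using homform_vanish_line[OF D(1), of x] homform_vanish_line[OF D(2), of x] f(2) g(2) x by auto
  then have "poly_eval (f * g) x \<noteq> 0" by (simp add: poly_eval_mult)
  moreover have "form_on M (f * g)" using homform_mult[OF D] by (auto simp: form_on_iff)
  moreover have "L' \<in> a \<inter> b" if "L' \<in> proj_space M" "\<exists>v\<in>L'. poly_eval (f * g) v \<noteq> 0" for L'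
    using f(3)[of L'] g(3)[of L'] that by (auto simp: poly_eval_mult)
  ultimately show ?case using line_of_self[of x] x by (intro exI[of _ "f * g"]) auto
next
  case (UN K)
  then obtain k where "k \<in> K" "L \<in> k" by auto
  then show ?case using UN.IH[of k] UN.prems by blast
qed auto

lemma zariski_separating_form:
  assumes "closedin (zariski_proj M) Z" "L \<in> proj_space M" "L \<notin> Z"
  shows "\<exists>D f. homform M D f \<and> (\<exists>v\<in>L. poly_eval f v \<noteq> 0) \<and> (\<forall>L'\<in>Z. \<forall>v\<in>L'. poly_eval f v = 0)"
proof -
  have "generate_topology_on {{L \<in> proj_space M. \<exists>v\<in>L. poly_eval f v \<noteq> 0} | f. form_on M f} (proj_space M - Z)"
    using assms(1) unfolding closedin_def topspace_zariski
    by (simp add: zariski_proj_def openin_topology_generated_by)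
  from zariski_open_basic[OF this, of L] assms
  obtain f where "form_on M f" "\<exists>v\<in>L. poly_eval f v \<noteq> 0"
    "\<And>L'. L'\<in>proj_space M \<Longrightarrow> (\<exists>v\<in>L'. poly_eval f v \<noteq> 0) \<Longrightarrow> L' \<in> proj_space M - Z" by auto
  moreover have "Z \<subseteq> proj_space M" using closedin_subset[OF assms(1)] by simp
  ultimately show ?thesis unfolding form_on_iff by blast
qed

text \<open>\<open>\<Union>Z\<close> is the affine cone over \<open>Z\<close>. At a spanning vector
  of each line one of the two factors vanishes, so the two closed zero loci cover
  \<open>Z\<close>.\<close>

lemma irreducible_in_prime:
  assumes irr: "irreducible_in (subtopology (zariski_proj M) S) Z"
    and f: "homform M D f" and g: "homform M D' g"
    and fg: "\<And>v. v \<in> \<Union>Z \<Longrightarrow> poly_eval (f * g) v = 0"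
  shows "(\<forall>v\<in>\<Union>Z. poly_eval f v = 0) \<or> (\<forall>v\<in>\<Union>Z. poly_eval g v = 0)"
proof -
  let ?V = "\<lambda>f. {L \<in> proj_space M. \<forall>v\<in>L. poly_eval f v = 0}"
  have Z: "Z \<subseteq> proj_space M \<inter> S" using irr by (simp add: irreducible_in_def)
  have cl: "closedin (subtopology (zariski_proj M) S) (?V h \<inter> S)" if "form_on M h" for h
    using closedin_zariski_form[OF that] by (auto simp: closedin_subtopology)
  have "Z \<subseteq> (?V f \<inter> S) \<union> (?V g \<inter> S)"
  proof
    fix L assume L: "L \<in> Z"
    then obtain x where x: "L = line_of x" using Z by (auto simp: proj_space_def)
    then have "poly_eval f x * poly_eval g x = 0"
      using fg[of x] L line_of_self[of x] by (auto simp: poly_eval_mult)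
    then show "L \<in> (?V f \<inter> S) \<union> (?V g \<inter> S)"
      using homform_vanish_line[OF f, of x] homform_vanish_line[OF g, of x] x L Z by auto
  qed
  moreover have "closedin (subtopology (zariski_proj M) S) (?V f \<inter> S)"
      "closedin (subtopology (zariski_proj M) S) (?V g \<inter> S)"
    using f g cl[of f] cl[of g] unfolding form_on_iff by blast+
  ultimately have "Z \<subseteq> ?V f \<inter> S \<or> Z \<subseteq> ?V g \<inter> S"
    using irr unfolding irreducible_in_def by blast
  then show ?thesis by blast
qed

text \<open>The formal partial derivative. The truncated exponent is harmless, because the factor
  \<open>of_nat\<close> is zero when \<open>v\<close> does not occur in \<open>m\<close>.\<close>

definition mon_deriv :: "'v \<Rightarrow> ('v \<Rightarrow>\<^sub>0 nat) \<Rightarrow> ('v \<Rightarrow> complex) \<Rightarrow> complex" where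
  "mon_deriv v m y = of_nat (lookup m v) * y v ^ (lookup m v - 1) *
     (\<Prod>w\<in>keys m - {v}. y w ^ lookup m w)"

lemma mon_deriv_eq_0: "v \<notin> keys m \<Longrightarrow> mon_deriv v m y = 0"
  by (simp add: mon_deriv_def in_keys_iff)

lemma mon_has_derivative:
  "((\<lambda>t. mon m (\<lambda>w. y w + t * u w)) has_field_derivative
     (\<Sum>w\<in>keys m. u w * mon_deriv w m y)) (at 0)"
proof -
  have "((\<lambda>t. \<Prod>w\<in>keys m. (y w + t * u w) ^ lookup m w) has_field_derivative
    (\<Sum>w\<in>keys m. (of_nat (lookup m w) * u w * (y w + 0 * u w) ^ (lookup m w - 1)) *
       (\<Prod>w\<in>keys m - {w}. (y w + 0 * u w) ^ lookup m w))) (at 0)"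
    by (rule has_field_derivative_prod) (auto intro!: derivative_eq_intros)
  then show ?thesis unfolding mon_def mon_deriv_def by (simp add: ac_simps)
qed

lemma polyfun_mon_deriv:
  assumes "keys m \<subseteq> Q"
  shows "polyfun Q (mon_deriv v m)"
proof (cases "v \<in> keys m")
  case True
  then show ?thesis unfolding mon_deriv_def
    using assms by (intro polyfun.mult polyfun.const polyfun_prod polyfun_power polyfun.coord) auto
next
  case False
  then have "mon_deriv v m = (\<lambda>_. 0)" by (auto simp: mon_deriv_eq_0)
  then show ?thesis by (simp add: polyfun.const)
qed

lemma finite_cox_vars: "finite (cox_vars k n)"
  by (simp add: cox_vars_def)

lemma cox_monos_deg_keys: "m \<in> cox_monos_deg k n u \<Longrightarrow> keys m \<subseteq> cox_vars k n"
  by (simp add: cox_monos_deg_def cox_monos_def)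

lemma cox_monos_deg_sum:
  assumes "m \<in> cox_monos_deg k n u" "i \<in> {1..k}"
  shows "(\<Sum>l\<le>n i. lookup m (i, l)) = nat (u i)"
proof -
  have "int (\<Sum>l\<le>n i. lookup m (i, l)) = u i"
    using assms unfolding cox_monos_deg_def has_mdeg_def by blast
  then show ?thesis by (metis nat_int)
qed

text \<open>Used to normalise the coordinates \<open>(i, 0)\<close> to one, factor by factor, at the
  cost of a scalar that depends on the degree alone.\<close>

lemma mon_multiscale:
  assumes "m \<in> cox_monos_deg k n u"
  shows "mon m (\<lambda>v. \<kappa> (fst v) * x v) = (\<Prod>i=1..k. \<kappa> i ^ nat (u i)) * mon m x"
proof -
  have "mon m (\<lambda>v. \<kappa> (fst v) * x v) =
      (\<Prod>v\<in>cox_vars k n. \<kappa> (fst v) ^ lookup m v) * mon m x"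
    unfolding mon_superset[OF finite_cox_vars cox_monos_deg_keys[OF assms]]
    by (simp add: power_mult_distrib prod.distrib)
  also have "(\<Prod>v\<in>cox_vars k n. \<kappa> (fst v) ^ lookup m v) =
      (\<Prod>i=1..k. \<Prod>l\<le>n i. \<kappa> i ^ lookup m (i, l))"
    unfolding cox_vars_def by (subst prod.Sigma) (auto simp: case_prod_unfold)
  also have "\<dots> = (\<Prod>i=1..k. \<kappa> i ^ nat (u i))"
    by (intro prod.cong refl) (simp add: cox_monos_deg_sum[OF assms] flip: power_sum)
  finally show ?thesis .
qed

section \<open>Parametrisation of the secant variety and tangent functionals\<close>

definition tan_dirs :: "nat \<Rightarrow> (nat \<Rightarrow> nat) \<Rightarrow> (nat \<times> nat) set" where
  "tan_dirs j n = (SIGMA i:{1..j}. {1..n i})"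

text \<open>One index for each parameter of the cone over the secant variety: every point has a
  scalar and its affine coordinates. The label \<open>(0, 0)\<close> of the scalar is free, since
  factors are numbered from 1.\<close>

definition tan_index :: "nat \<Rightarrow> nat \<Rightarrow> (nat \<Rightarrow> nat) \<Rightarrow> (nat \<times> (nat \<times> nat)) set" where
  "tan_index r j n = {..<r} \<times> insert (0, 0) (tan_dirs j n)"

text \<open>
  The value (for the dummy direction \<open>(0, 0)\<close>) and the partial derivatives of a monomial at the
  \<open>s\<close>-th point; only the directions \<open>(i, l)\<close> with \<open>l \<ge> 1\<close> are tangent to the chart
  \<open>\<alpha>\<^sub>i\<^sub>,\<^sub>0 = 1\<close>.
\<close>

definition tan_fun :: "(nat \<Rightarrow> nat \<times> nat \<Rightarrow> complex) \<Rightarrow> nat \<times> (nat \<times> nat) \<Rightarrow> mono \<Rightarrow> complex" where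
  "tan_fun y q m = (if snd q = (0, 0) then mon m (y (fst q)) else mon_deriv (snd q) m (y (fst q)))"

lemma finite_tan_dirs: "finite (tan_dirs j n)" and zero_notin_tan_dirs: "(0, 0) \<notin> tan_dirs j n"
  by (auto simp: tan_dirs_def)

lemma finite_tan_index: "finite (tan_index r j n)"
  by (simp add: tan_index_def finite_tan_dirs)

lemma card_tan_index: "card (tan_index r j n) = r * (dim_product j n + 1)"
proof -
  have "card (tan_dirs j n) = dim_product j n" by (simp add: tan_dirs_def dim_product_def)
  then show ?thesis by (simp add: tan_index_def card_cartesian_product finite_tan_dirs zero_notin_tan_dirs)
qed

definition chart :: "(nat \<times> (nat \<times> nat) \<Rightarrow> complex) \<Rightarrow> nat \<Rightarrow> nat \<times> nat \<Rightarrow> complex" where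
  "chart z s v = (if snd v = 0 then 1 else z (s, v))"

text \<open>Parametrises the part of the affine cone over the secant variety that is spanned by
  points of the chart; \<open>z (s, (0, 0))\<close> is the coefficient of the \<open>s\<close>-th
  point.\<close>

definition sec_map :: "nat \<Rightarrow> (nat \<times> (nat \<times> nat) \<Rightarrow> complex) \<Rightarrow> mono \<Rightarrow> complex" where
  "sec_map r z m = (\<Sum>s<r. z (s, (0, 0)) * mon m (chart z s))"

lemma sec_map_polyfun:
  assumes "m \<in> cox_monos_deg j n d"
  shows "polyfun (tan_index r j n) (\<lambda>z. sec_map r z m)"
proof -
  have "polyfun (tan_index r j n) (\<lambda>z. mon m (chart z s))" if s: "s < r" for s
  proof -
    have "(\<lambda>z. mon m (chart z s)) \<in> Collect (polyfun (tan_index r j n))"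
    proof (rule polyfun_compose[OF polyfun_mon[OF cox_monos_deg_keys[OF assms]] fun_alg_polyfun])
      fix v assume v: "v \<in> cox_vars j n"
      show "(\<lambda>z. chart z s v) \<in> Collect (polyfun (tan_index r j n))"
      proof (cases "snd v = 0")
        case True then show ?thesis by (simp add: chart_def polyfun.const)
      next
        case False
        then have "(s, v) \<in> tan_index r j n" using v s by (auto simp: tan_index_def tan_dirs_def cox_vars_def)
        then show ?thesis using False by (simp add: chart_def polyfun.coord)
      qed
    qed
    then show ?thesis by simp
  qed
  then show ?thesis unfolding sec_map_def
    by (intro polyfun_sum polyfun.mult polyfun.coord) (auto simp: tan_index_def)
qed

lemma sec_map_derivative:
  assumes m: "m \<in> cox_monos_deg j n d"
  shows "((\<lambda>t. sec_map r (\<lambda>q. z q + t * v q) m) has_field_derivative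
    (\<Sum>s<r. v (s, (0, 0)) * mon m (chart z s) + z (s, (0, 0)) *
        (\<Sum>w\<in>tan_dirs j n. v (s, w) * mon_deriv w m (chart z s)))) (at 0)"
proof -
  define u where "u s w = (if snd w = 0 then 0 else v (s, w))" for s and w :: "nat \<times> nat"
  have ch: "chart (\<lambda>q. z q + t * v q) s = (\<lambda>w. chart z s w + t * u s w)" for t s
    by (auto simp: chart_def u_def fun_eq_iff)
  have sum: "(\<Sum>w\<in>keys m. u s w * mon_deriv w m (chart z s)) =
      (\<Sum>w\<in>tan_dirs j n. v (s, w) * mon_deriv w m (chart z s))" for s
  proof -
    have "(\<Sum>w\<in>keys m. u s w * mon_deriv w m (chart z s)) = (\<Sum>w\<in>cox_vars j n. u s w * mon_deriv w m (chart z s))"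
      by (rule sum.mono_neutral_left) (use finite_cox_vars cox_monos_deg_keys[OF m] in \<open>auto simp:
          mon_deriv_eq_0\<close>)
    also have "\<dots> = (\<Sum>w\<in>tan_dirs j n. u s w * mon_deriv w m (chart z s))"
      by (rule sum.mono_neutral_right) (use finite_cox_vars in \<open>auto simp: cox_vars_def tan_dirs_def u_def\<close>)
    also have "\<dots> = (\<Sum>w\<in>tan_dirs j n. v (s, w) * mon_deriv w m (chart z s))"
      by (intro sum.cong refl) (auto simp: u_def tan_dirs_def)
    finally show ?thesis .
  qed
  show ?thesis unfolding sec_map_def ch
  proof (rule DERIV_sum)
    fix s
    have "((\<lambda>t. mon m (\<lambda>w. chart z s w + t * u s w)) has_field_derivative
        (\<Sum>w\<in>tan_dirs j n. v (s, w) * mon_deriv w m (chart z s))) (at 0)"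
      using mon_has_derivative[of m "chart z s" "u s"] unfolding sum .
    then show "((\<lambda>t. (z (s, 0, 0) + t * v (s, 0, 0)) * mon m (\<lambda>w. chart z s w + t * u s w)) has_field_derivative
        v (s, 0, 0) * mon m (chart z s) + z (s, 0, 0) * (\<Sum>w\<in>tan_dirs j n. v (s, w) * mon_deriv w m
            (chart z s))) (at 0)"
      by (auto intro!: derivative_eq_intros simp: algebra_simps)
  qed
qed

lemma tan_index_sum:
  "(\<Sum>q\<in>tan_index r j n. x q * tan_fun y q m) =
    (\<Sum>s<r. x (s, (0, 0)) * mon m (y s) + (\<Sum>w\<in>tan_dirs j n. x (s, w) * mon_deriv w m (y s)))"
proof -
  have "(\<Sum>q\<in>tan_index r j n. x q * tan_fun y q m) = (\<Sum>s<r. \<Sum>w\<in>insert (0, 0) (tan_dirs j n). x (s, w) *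
      tan_fun y (s, w) m)"
    unfolding tan_index_def by (simp add: sum.cartesian_product case_prod_unfold)
  also have "\<dots> = (\<Sum>s<r. x (s, (0, 0)) * mon m (y s) + (\<Sum>w\<in>tan_dirs j n. x (s, w) * mon_deriv w m (y s)))"
  proof (rule sum.cong[OF refl])
    fix s
    have "(\<Sum>w\<in>tan_dirs j n. x (s, w) * tan_fun y (s, w) m) = (\<Sum>w\<in>tan_dirs j n. x (s, w) * mon_deriv w m (y s))"
      using zero_notin_tan_dirs by (intro sum.cong refl) (auto simp: tan_fun_def)
    then show "(\<Sum>w\<in>insert (0, 0) (tan_dirs j n). x (s, w) * tan_fun y (s, w) m) =
      x (s, (0, 0)) * mon m (y s) + (\<Sum>w\<in>tan_dirs j n. x (s, w) * mon_deriv w m (y s))"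
      by (simp add: finite_tan_dirs zero_notin_tan_dirs tan_fun_def)
  qed
  finally show ?thesis .
qed

text \<open>The differential of \<open>sec_map\<close> is the matrix \<open>tan_fun\<close> with its
  derivative rows scaled by the numbers \<open>z (s, (0, 0))\<close>. Injectivity forces these to be
  nonzero as soon as there are tangent directions, so the scaling can be undone.\<close>

lemma immersive_point_indep:
  assumes z: "\<And>v. (\<And>m. m \<in> cox_monos_deg j n d \<Longrightarrow> ((\<lambda>t. sec_map r (\<lambda>q. z q +
      t * v q) m) has_field_derivative 0) (at 0))
    \<Longrightarrow> \<forall>q\<in>tan_index r j n. v q = 0"
  shows "indep_on (tan_index r j n) (cox_monos_deg j n d) (tan_fun (chart z))"
proof (rule indep_onI)
  fix x q
  assume q: "q \<in> tan_index r j n"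
    and eq: "\<And>m. m \<in> cox_monos_deg j n d \<Longrightarrow> (\<Sum>q\<in>tan_index r j n. x q * tan_fun (chart z) q m) = 0"
  \<comment> \<open>If the scalar were zero, moving the \<open>s\<close>-th point in direction
    \<open>w\<close> would leave \<open>sec_map\<close> stationary.\<close>
  have c: "z (s, (0, 0)) \<noteq> 0" if s: "s < r" and w: "w \<in> tan_dirs j n" for s w
  proof
    assume c0: "z (s, (0, 0)) = 0"
    define v :: "nat \<times> nat \<times> nat \<Rightarrow> complex" where "v q = (if q = (s, w) then 1 else 0)" for q
    have "\<forall>q\<in>tan_index r j n. v q = 0"
    proof (rule z)
      fix m assume m: "m \<in> cox_monos_deg j n d"
      have "(\<Sum>s<r. v (s, (0, 0)) * mon m (chart z s) + z (s, (0, 0)) *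
          (\<Sum>w\<in>tan_dirs j n. v (s, w) * mon_deriv w m (chart z s))) = 0"
      proof (intro sum.neutral ballI)
        fix s'
        have "w \<noteq> (0, 0)" using w zero_notin_tan_dirs by blast
        then show "v (s', (0, 0)) * mon m (chart z s') + z (s', (0, 0)) *
            (\<Sum>w\<in>tan_dirs j n. v (s', w) * mon_deriv w m (chart z s')) = 0"
          by (cases "s' = s") (simp_all add: v_def c0)
      qed
      then show "((\<lambda>t. sec_map r (\<lambda>q. z q + t * v q) m) has_field_derivative 0) (at 0)"
        using sec_map_derivative[OF m, of r z v] by simp
    qed
    moreover have "(s, w) \<in> tan_index r j n" using s w by (simp add: tan_index_def)
    ultimately have "v (s, w) = 0" by blast
    then show False by (simp add: v_def)
  qed
  define v where "v q = (if snd q = (0, 0) then x q else x q / z (fst q, (0, 0)))" for q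
  have "\<forall>q\<in>tan_index r j n. v q = 0"
  proof (rule z)
    fix m assume m: "m \<in> cox_monos_deg j n d"
    have "(\<Sum>s<r. v (s, (0, 0)) * mon m (chart z s) + z (s, (0, 0)) *
        (\<Sum>w\<in>tan_dirs j n. v (s, w) * mon_deriv w m (chart z s))) =
      (\<Sum>s<r. x (s, (0, 0)) * mon m (chart z s) + (\<Sum>w\<in>tan_dirs j n. x (s, w) * mon_deriv w m (chart z s)))"
    proof (rule sum.cong[OF refl])
      fix s assume s: "s \<in> {..<r}"
      have "z (s, (0, 0)) * (\<Sum>w\<in>tan_dirs j n. v (s, w) * mon_deriv w m (chart z s)) =
          (\<Sum>w\<in>tan_dirs j n. x (s, w) * mon_deriv w m (chart z s))"
        unfolding sum_distrib_left
      proof (rule sum.cong[OF refl])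
        fix w assume w: "w \<in> tan_dirs j n"
        then have "w \<noteq> (0, 0)" using zero_notin_tan_dirs by blast
        then show "z (s, 0, 0) * (v (s, w) * mon_deriv w m (chart z s)) = x (s, w) * mon_deriv w m (chart z s)"
          using c[of s w] s w by (simp add: v_def)
      qed
      then show "v (s, (0, 0)) * mon m (chart z s) + z (s, (0, 0)) *
          (\<Sum>w\<in>tan_dirs j n. v (s, w) * mon_deriv w m (chart z s)) =
        x (s, (0, 0)) * mon m (chart z s) + (\<Sum>w\<in>tan_dirs j n. x (s, w) * mon_deriv w m (chart z s))"
        by (simp add: v_def)
    qed
    also have "\<dots> = 0" using eq[OF m] unfolding tan_index_sum .
    finally show "((\<lambda>t. sec_map r (\<lambda>q. z q + t * v q) m) has_field_derivative 0) (at 0)"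
      using sec_map_derivative[OF m, of r z v] by simp
  qed
  then have "v q = 0" using q by blast
  then show "x q = 0" using c[of "fst q" "snd q"] q by (auto simp: v_def tan_index_def split: if_splits)
qed

text \<open>Points with a zero coordinate \<open>(i, 0)\<close> lie outside the chart. Adding
  \<open>t\<close> to all coordinates with second index 0 brings the points into the chart for all
  but finitely many \<open>t\<close>; the value of \<open>H\<close> is a polynomial in
  \<open>t\<close>, so it vanishes at \<open>t = 0\<close> too.\<close>

lemma sec_map_vanish_span:
  assumes H: "homform (cox_monos_deg j n d) D H" and z: "\<And>z. poly_eval H (sec_map r z) = 0"
    and y: "\<And>s. s < r \<Longrightarrow> y s \<in> hom_coords j n"
  shows "poly_eval H (\<lambda>m. \<Sum>s<r. c s * eval_vector j n d (y s) m) = 0"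
proof -
  let ?M = "cox_monos_deg j n d"
  define ys where "ys t s v = y s v + t * (if snd v = 0 then 1 else 0)" for t s and v :: "nat \<times> nat"
  define g where "g t = poly_eval H (\<lambda>m. \<Sum>s<r. c s * mon m (ys t s))" for t
  have "g \<in> {f. \<exists>p. \<forall>t. f t = poly p t}"
    unfolding g_def
  proof (rule polyfun_compose[OF polyfun_homform[OF H] fun_alg_poly])
    fix m assume m: "m \<in> ?M"
    have "\<exists>p. \<forall>t. mon m (ys t s) = poly p t" for s
      unfolding ys_def by (rule polyfun_line[OF polyfun_mon[OF order_refl]])
    then show "(\<lambda>t. \<Sum>s<r. c s * mon m (ys t s)) \<in> {f. \<exists>p. \<forall>t. f t = poly p t}"
      by (intro fun_alg_sum[OF fun_alg_poly] fun_alg_mult[OF fun_alg_poly] fun_alg_const[OF fun_alg_poly]) auto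
  qed
  then obtain p where p: "\<And>t. g t = poly p t" by auto
  have g0: "g t = 0" if t: "\<And>s i. s < r \<Longrightarrow> i \<in> {1..j} \<Longrightarrow> ys t s (i, 0) \<noteq> 0" for t
  proof -
    \<comment> \<open>Dividing by the coordinates \<open>(i, 0)\<close> rescales each evaluation
      vector; the entry at \<open>(0, 0)\<close> compensates for this.\<close>
    define w where "w q = (if snd q = (0, 0) then c (fst q) * (\<Prod>i=1..j. ys t (fst q) (i, 0) ^ nat (d i))
       else ys t (fst q) (snd q) / ys t (fst q) (fst (snd q), 0))" for q
    have "g t = poly_eval H (sec_map r w)"
      unfolding g_def
    proof (rule poly_eval_cong[OF H])
      fix m assume m: "m \<in> ?M"
      have "c s * mon m (ys t s) = w (s, (0, 0)) * mon m (chart w s)" if s: "s < r" for s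
      proof -
        have "mon m (\<lambda>v. ys t s (fst v, 0) * chart w s v) = (\<Prod>i=1..j. ys t s (i, 0) ^ nat (d i)) * mon m
            (chart w s)"
          by (rule mon_multiscale[OF m])
        moreover have "mon m (\<lambda>v. ys t s (fst v, 0) * chart w s v) = mon m (ys t s)"
          unfolding mon_def
        proof (intro prod.cong refl arg_cong2[of _ _ _ _ "(^)"])
          fix v assume "v \<in> keys m"
          then have "fst v \<in> {1..j}" using cox_monos_deg_keys[OF m] by (auto simp: cox_vars_def)
          then show "ys t s (fst v, 0) * chart w s v = ys t s v"
            using t[OF s] by (cases v) (auto simp: chart_def w_def)
        qed
        ultimately show ?thesis by (simp add: w_def)
      qed
      then show "(\<Sum>s<r. c s * mon m (ys t s)) = sec_map r w m"
        unfolding sec_map_def by (intro sum.cong) auto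
    qed
    then show ?thesis by (simp add: z)
  qed
  have "p = 0"
  proof (rule ccontr)
    assume "p \<noteq> 0"
    then have "finite ({t. poly p t = 0} \<union> (\<lambda>(s, i). - y s (i, 0)) ` ({..<r} \<times> {1..j}))"
      by (simp add: poly_roots_finite)
    then obtain t where t: "t \<notin> {t. poly p t = 0} \<union> (\<lambda>(s, i). - y s (i, 0)) ` ({..<r} \<times> {1..j})"
      using ex_new_if_finite[OF infinite_UNIV_char_0] by blast
    have "ys t s (i, 0) \<noteq> 0" if "s < r" "i \<in> {1..j}" for s i
    proof
      assume "ys t s (i, 0) = 0"
      then have "t = - y s (i, 0)" by (simp add: ys_def add_eq_0_iff)
      then show False using t that by force
    qed
    from g0[OF this] have "g t = 0" .
    then show False using p t by simp
  qed
  then have "g 0 = 0" using p by simp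
  moreover have "g 0 = poly_eval H (\<lambda>m. \<Sum>s<r. c s * eval_vector j n d (y s) m)"
    unfolding g_def
    by (rule poly_eval_cong[OF H]) (simp add: ys_def eval_vector_def mon_def)
  ultimately show ?thesis by simp
qed

lemma sec_map_vanish_secant:
  assumes H: "homform (cox_monos_deg j n d) D H" and z: "\<And>z. poly_eval H (sec_map r z) = 0"
    and L: "L \<in> secant_variety (cox_monos_deg j n d) (embedded_product j n d) r" and v: "v \<in> L"
  shows "poly_eval H v = 0"
proof -
  let ?M = "cox_monos_deg j n d"
  let ?V = "{L \<in> proj_space ?M. \<forall>v\<in>L. poly_eval H v = 0}"
  have "(\<Union>x\<in>{x. \<forall>s<r. x s \<in> embedded_product j n d}. proj_span ?M r x) \<subseteq> ?V"
  proof
    fix L' assume "L' \<in> (\<Union>x\<in>{x. \<forall>s<r. x s \<in> embedded_product j n d}. proj_span ?M r x)"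
    then obtain x where x: "\<And>s. s < r \<Longrightarrow> x s \<in> embedded_product j n d" and L': "L' \<in> proj_span ?M r x"
      by auto
    have "\<forall>s. \<exists>y. s < r \<longrightarrow> x s = line_of (eval_vector j n d y) \<and> y \<in> hom_coords j n"
      using x unfolding embedded_product_def by blast
    then obtain y where y: "\<And>s. s < r \<Longrightarrow> x s = line_of (eval_vector j n d (y s))" "\<And>s. s < r \<Longrightarrow>
        y s \<in> hom_coords j n"
      by metis
    have "poly_eval H v' = 0" if v': "v' \<in> L'" for v'
    proof -
      obtain w where w: "v' = (\<lambda>m. \<Sum>s<r. w s m)" "\<And>s. s < r \<Longrightarrow> w s \<in> x s"
        using L' v' unfolding proj_span_def by blast
      have "\<forall>s. \<exists>c. s < r \<longrightarrow> w s = (\<lambda>m. c * eval_vector j n d (y s) m)"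
        using w(2) y(1) unfolding line_of_def by blast
      then obtain c where c: "\<And>s. s < r \<Longrightarrow> w s = (\<lambda>m. c s * eval_vector j n d (y s) m)" by metis
      have "v' = (\<lambda>m. \<Sum>s<r. c s * eval_vector j n d (y s) m)"
        unfolding w(1) by (intro ext sum.cong refl) (simp add: c)
      then show ?thesis using sec_map_vanish_span[OF H z y(2)] by simp
    qed
    then show "L' \<in> ?V" using L' unfolding proj_span_def by auto
  qed
  moreover have "closedin (zariski_proj ?M) ?V"
    using H by (intro closedin_zariski_form) (auto simp: form_on_iff)
  ultimately have "secant_variety ?M (embedded_product j n d) r \<subseteq> ?V"
    unfolding secant_variety_def by (rule closure_of_minimal)
  then show ?thesis using L v by auto
qed

text \<open>A finite positive supremum of natural numbers is attained. The value 0 is excluded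
  because it is also the supremum of the empty set.\<close>

lemma krull_dim_chain:
  assumes "krull_dim T = enat N" "N > 0"
  shows "\<exists>Z. (\<forall>i\<le>N. closedin T (Z i) \<and> irreducible_in T (Z i)) \<and> (\<forall>i<N. Z i \<subset> Z (Suc i))"
proof -
  define S where "S = {N. \<exists>Z. (\<forall>i\<le>N. closedin T (Z i) \<and> irreducible_in T (Z i)) \<and> (\<forall>i<N. Z i \<subset> Z (Suc i))}"
  have S: "Sup (enat ` S) = enat N"
    using assms(1) unfolding krull_dim_def S_def by (simp add: image_Collect)
  have "N \<in> S"
  proof (rule ccontr)
    assume "N \<notin> S"
    have "x \<le> enat (N - 1)" if x: "x \<in> enat ` S" for x
    proof -
      obtain N' where N': "x = enat N'" "N' \<in> S" using x by auto
      have "enat N' \<le> enat N" using S N' by (metis Sup_upper image_eqI)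
      then have "N' \<le> N - 1" using \<open>N \<notin> S\<close> N' by (cases "N' = N") auto
      then show ?thesis using N' by simp
    qed
    then have "enat N \<le> enat (N - 1)" using S by (metis Sup_least)
    then show False using assms(2) by simp
  qed
  then show ?thesis by (simp add: S_def)
qed

text \<open>The image is a cone. Scaling within it later splits a polynomial relation into its parts
  of constant weight.\<close>

lemma sec_map_cone: "sec_map r (\<lambda>q. if snd q = (0, 0) then a * z q else z q) = (\<lambda>m. a * sec_map r z m)"
proof -
  have "chart (\<lambda>q. if snd q = (0, 0) then a * z q else z q) s = chart z s" for s
    by (auto simp: chart_def fun_eq_iff)
  note ch = this
  show ?thesis
  proof (rule ext)
    fix m
    show "sec_map r (\<lambda>q. if snd q = (0, 0) then a * z q else z q) m = a * sec_map r z m"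
      unfolding sec_map_def ch by (simp add: sum_distrib_left mult.assoc)
  qed
qed

text \<open>The length \<open>N\<close> of the chain is one less than the number of parameters of
  \<open>sec_map\<close>. The \<open>N + 1\<close> forms taken from the chain are independent on the
  cone, so \<open>immersive_point\<close> applies and yields a configuration in the chart.\<close>

lemma terracini:
  assumes dim: "krull_dim (subtopology (zariski_proj (cox_monos_deg j n d))
      (secant_variety (cox_monos_deg j n d) (embedded_product j n d) r)) = enat (r * (dim_product j n + 1) - 1)"
    and r: "r > 0" and ne: "cox_monos_deg j n d \<noteq> {}"
  shows "\<exists>z. indep_on (tan_index r j n) (cox_monos_deg j n d) (tan_fun (chart z))"
proof (cases "r * (dim_product j n + 1) = 1")
  \<comment> \<open>One point on a zero-dimensional variety: the chain would have length 0, but the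
    only functional is evaluation at a point all of whose coordinates are one.\<close>
  case True
  then have "r = 1" "dim_product j n = 0" unfolding nat_mult_eq_1_iff by auto
  then have "card (tan_index r j n) = 1" by (simp add: card_tan_index)
  moreover have "(0, (0, 0)) \<in> tan_index r j n" using r by (simp add: tan_index_def)
  ultimately have Q: "tan_index r j n = {(0, (0, 0))}" by (metis card_1_singletonE singletonD)
  obtain m where m: "m \<in> cox_monos_deg j n d" using ne by auto
  have "mon m (chart (\<lambda>_. 1) 0) = 1" by (simp add: mon_def chart_def)
  then have "indep_on (tan_index r j n) (cox_monos_deg j n d) (tan_fun (chart (\<lambda>_. 1)))"
    using m by (auto simp: indep_on_def Q tan_fun_def)
  then show ?thesis by blast
next
  case False
  let ?M = "cox_monos_deg j n d"
  let ?\<sigma> = "secant_variety ?M (embedded_product j n d) r"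
  define N where "N = r * (dim_product j n + 1) - 1"
  have N: "N > 0" using False r by (cases "r * (dim_product j n + 1)") (auto simp: N_def)
  have cardQ: "card (tan_index r j n) = Suc N" using r by (simp add: card_tan_index N_def)
  from krull_dim_chain[OF dim[folded N_def] N] obtain Z where
    Z: "\<And>i. i \<le> N \<Longrightarrow> closedin (subtopology (zariski_proj ?M) ?\<sigma>) (Z i)"
       "\<And>i. i \<le> N \<Longrightarrow> irreducible_in (subtopology (zariski_proj ?M) ?\<sigma>) (Z i)"
       "\<And>i. i < N \<Longrightarrow> Z i \<subset> Z (Suc i)" by blast
  have Zsub: "Z i \<subseteq> proj_space ?M \<inter> ?\<sigma>" if "i \<le> N" for i
    using closedin_subset[OF Z(1)[OF that]] by simp
  have Zcl: "closedin (zariski_proj ?M) (Z i)" if "i \<le> N" for i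
    using Z(1)[OF that] by (rule closedin_trans_full) (simp add: secant_variety_def)
  \<comment> \<open>At the bottom a coordinate that is nonzero somewhere on \<open>Z 0\<close>, of
    positive degree; above it a form that vanishes on the smaller set and separates from it a point
    of the larger one.\<close>
  have "\<exists>D f. homform ?M D f \<and> (i = 0 \<longrightarrow> D > 0) \<and> (\<exists>v\<in>\<Union>(Z i). poly_eval f v \<noteq> 0) \<and>
      (\<forall>i'. i = Suc i' \<longrightarrow> (\<forall>v\<in>\<Union>(Z i'). poly_eval f v = 0))" if i: "i \<le> N" for i
  proof (cases i)
    case 0
    have "Z 0 \<noteq> {}" using Z(2)[of 0] by (simp add: irreducible_in_def)
    then obtain L where L: "L \<in> Z 0" by auto
    then obtain v where v: "L = line_of v" "v \<noteq> (\<lambda>_. 0)" "\<And>m. m \<notin> ?M \<Longrightarrow> v m = 0"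
      using Zsub[of 0] by (auto simp: proj_space_def)
    then obtain m where m: "v m \<noteq> 0" by auto
    then have "m \<in> ?M" using v(3) by auto
    from homform_var[OF this] m L line_of_self[of v] v(1) 0 show ?thesis
      by (intro exI[of _ 1] exI[of _ "single (single m 1) 1"]) auto
  next
    case (Suc i')
    then obtain L where L: "L \<in> Z i" "L \<notin> Z i'" using Z(3)[of i'] i by auto
    have "L \<in> proj_space ?M" using L Zsub[OF i] by auto
    from zariski_separating_form[OF Zcl[of i'] this L(2)] Suc i obtain D f where
      "homform ?M D f" "\<exists>v\<in>L. poly_eval f v \<noteq> 0" "\<forall>L'\<in>Z i'. \<forall>v\<in>L'. poly_eval f v = 0" by auto
    then show ?thesis using L(1) Suc by (intro exI[of _ D] exI[of _ f]) auto
  qed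
  then obtain \<delta> F where F: "\<And>i. i \<le> N \<Longrightarrow> homform ?M (\<delta> i) (F i)" "\<delta> 0 > 0"
     "\<And>i. i \<le> N \<Longrightarrow> \<exists>v\<in>\<Union>(Z i). poly_eval (F i) v \<noteq> 0"
     "\<And>i v. i < N \<Longrightarrow> v \<in> \<Union>(Z i) \<Longrightarrow> poly_eval (F (Suc i)) v = 0"
    by (metis Suc_leI le0)
  have "\<exists>z. \<forall>v. (\<forall>m\<in>?M. ((\<lambda>t. sec_map r (\<lambda>q. z q + t * v q) m) has_field_derivative 0) (at 0)) \<longrightarrow>
     (\<forall>q\<in>tan_index r j n. v q = 0)"
  proof (rule immersive_point[where F = "\<lambda>k. poly_eval (F k)"])
    show "finite (tan_index r j n)" by (rule finite_tan_index)
    show "polyfun (tan_index r j n) (\<lambda>z. sec_map r z m)" if "m \<in> ?M" for m by (rule sec_map_polyfun[OF that])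
    show "polyfun ?M (poly_eval (F k))" if "k < card (tan_index r j n)" for k
      using that F(1)[of k] cardQ by (auto intro: polyfun_homform)
    fix B :: "(nat \<Rightarrow> nat) set" and c
    assume B: "finite B" "B \<subseteq> extensional {..<card (tan_index r j n)}"
      and eq0: "\<And>z. (\<Sum>b\<in>B. c b * (\<Prod>k<card (tan_index r j n). poly_eval (F k) (sec_map r z) ^ b k)) = 0"
    have eq: "(\<Sum>b\<in>B. c b * (\<Prod>k\<le>N. poly_eval (F k) (sec_map r z) ^ b k)) = 0" for z
      using eq0[of z] unfolding cardQ lessThan_Suc_atMost .
    define wt where "wt b = (\<Sum>k\<le>N. \<delta> k * b k)" for b
    show "\<forall>b\<in>B. c b = 0"
    proof
      fix b0 assume b0: "b0 \<in> B"
      define BD where "BD = {b\<in>B. wt b = wt b0}"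
      define H where "H = (\<Sum>b\<in>BD. single 0 (c b) * (\<Prod>k\<le>N. F k ^ b k))"
      have evH: "poly_eval H v = (\<Sum>b\<in>BD. c b * (\<Prod>k\<le>N. poly_eval (F k) v ^ b k))" for v
        by (simp add: H_def poly_eval_sum poly_eval_mult poly_eval_prod poly_eval_power)
      have homH: "homform ?M (wt b0) H"
        unfolding H_def
      proof (rule homform_sum)
        fix b assume "b \<in> BD"
        then have wt: "wt b = wt b0" by (simp add: BD_def)
        have "homform ?M (0 + (\<Sum>k\<le>N. \<delta> k * b k)) (single 0 (c b) * (\<Prod>k\<le>N. F k ^ b k))"
          by (intro homform_mult homform_const homform_prod homform_power F(1)) auto
        then show "homform ?M (wt b0) (single 0 (c b) * (\<Prod>k\<le>N. F k ^ b k))"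
          using wt by (simp add: wt_def)
      qed
      have Hz: "poly_eval H (sec_map r z) = 0" for z
      proof -
        define T where "T b = c b * (\<Prod>k\<le>N. poly_eval (F k) (sec_map r z) ^ b k)" for b
        \<comment> \<open>The relation evaluated at \<open>a\<close> times
          \<open>sec_map r z\<close>, as a polynomial in \<open>a\<close>: its coefficients are the
          parts of constant weight. It vanishes for every \<open>a\<close>, so each part
          vanishes.\<close>
        define p where "p = (\<Sum>b\<in>B. monom (T b) (wt b))"
        have "poly p a = 0" for a
        proof -
          have "poly p a = (\<Sum>b\<in>B. c b * (\<Prod>k\<le>N. poly_eval (F k) (\<lambda>m. a * sec_map r z m) ^ b k))"
            unfolding p_def poly_sum
          proof (intro sum.cong refl)
            fix b
            have "(\<Prod>k\<le>N. poly_eval (F k) (\<lambda>m. a * sec_map r z m) ^ b k) =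
               (\<Prod>k\<le>N. a ^ (\<delta> k * b k) * poly_eval (F k) (sec_map r z) ^ b k)"
              by (intro prod.cong refl) (simp add: poly_eval_scale[OF F(1)] power_mult power_mult_distrib)
            then show "poly (monom (T b) (wt b)) a = c b * (\<Prod>k\<le>N. poly_eval (F k) (\<lambda>m. a * sec_map r z
                m) ^ b k)"
              by (simp add: poly_monom T_def wt_def prod.distrib power_sum)
          qed
          also have "\<dots> = 0" using eq[of "\<lambda>q. if snd q = (0, 0) then a * z q else z q"] unfolding sec_map_cone .
          finally show ?thesis .
        qed
        then have "p = 0" using poly_all_0_iff_0 by blast
        then have "0 = coeff p (wt b0)" by simp
        also have "\<dots> = (\<Sum>b\<in>B. if wt b = wt b0 then T b else 0)"
          unfolding p_def by (simp add: coeff_sum)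
        also have "\<dots> = (\<Sum>b\<in>BD. T b)"
          unfolding BD_def using B(1) by (simp add: sum.inter_filter)
        finally show ?thesis unfolding evH T_def by simp
      qed
      have "\<forall>b\<in>BD. c b = 0"
      proof (rule chain_forms_independent[where N = N and i = N and V = "\<lambda>i. \<Union>(Z i)" and F = F and \<delta> =
          \<delta> and M = ?M and D = "wt b0"])
        show "\<Union>(Z i) \<subseteq> \<Union>(Z (Suc i))" if "i < N" for i using Z(3)[OF that] by blast
        show "(\<forall>v\<in>\<Union>(Z i). poly_eval f v = 0) \<or> (\<forall>v\<in>\<Union>(Z i). poly_eval g v = 0)"
          if "i \<le> N" "homform ?M D f" "homform ?M D' g" "\<And>v. v \<in> \<Union>(Z i) \<Longrightarrow>
              poly_eval (f * g) v = 0" for i f g D D'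
          using that(2-4) by (rule irreducible_in_prime[OF Z(2)[OF that(1)]])
        show "finite BD" using B(1) by (simp add: BD_def)
        show "BD \<subseteq> extensional {..N}" using B(2) unfolding cardQ lessThan_Suc_atMost by (auto simp: BD_def)
        show "(\<Sum>k\<le>N. \<delta> k * b k) = wt b0" if "b \<in> BD" for b using that by (simp add: BD_def wt_def)
        show "(\<Sum>b\<in>BD. c b * (\<Prod>k\<le>N. poly_eval (F k) v ^ b k)) = 0" if v: "v \<in> \<Union>(Z N)" for v
        proof -
          obtain L where "L \<in> ?\<sigma>" "v \<in> L" using v Zsub[of N] by auto
          from sec_map_vanish_secant[OF homH Hz this] show ?thesis unfolding evH .
        qed
      qed (use F in auto)
      then show "c b0 = 0" using b0 by (simp add: BD_def)
    qed
  qed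
  then obtain z where z: "\<And>v. (\<forall>m\<in>?M. ((\<lambda>t. sec_map r (\<lambda>q. z q + t * v q) m) has_field_derivative 0) (at 0)) \<Longrightarrow>
     (\<forall>q\<in>tan_index r j n. v q = 0)" by blast
  have "indep_on (tan_index r j n) ?M (tan_fun (chart z))"
    by (rule immersive_point_indep) (use z in blast)
  then show ?thesis by blast
qed

section \<open>The Cox ring and its graded pieces\<close>

lemma cox_monos_add: "a \<in> cox_monos k n \<Longrightarrow> b \<in> cox_monos k n \<Longrightarrow> a + b \<in> cox_monos k n"
  using Poly_Mapping.keys_add[of a b] unfolding cox_monos_def by blast

lemma cox_monos_0 [simp]: "0 \<in> cox_monos k n"
  by (simp add: cox_monos_def)

lemma cox_carrier_iff: "p \<in> carrier (cox_ring k n) \<longleftrightarrow> keys p \<subseteq> cox_monos k n"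
  by (simp add: cox_ring_def)

lemma cox_ring_simps [simp]:
  "(\<otimes>\<^bsub>cox_ring k n\<^esub>) = (*)" "\<one>\<^bsub>cox_ring k n\<^esub> = 1" "\<zero>\<^bsub>cox_ring k n\<^esub> = 0" "(\<oplus>\<^bsub>cox_ring k n\<^esub>) = (+)"
  by (simp_all add: cox_ring_def)

lemma cox_carrier_0 [simp]: "0 \<in> carrier (cox_ring k n)"
  and cox_carrier_single: "m \<in> cox_monos k n \<Longrightarrow> single m c \<in> carrier (cox_ring k n)"
  by (auto simp: cox_carrier_iff)

lemma cox_carrier_const [simp]: "single 0 c \<in> carrier (cox_ring k n)"
  by (simp add: cox_carrier_single)

lemma cox_carrier_1 [simp]: "1 \<in> carrier (cox_ring k n)"
  using cox_carrier_const[of 1] by simp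

lemma cox_carrier_add: "p \<in> carrier (cox_ring k n) \<Longrightarrow> q \<in> carrier (cox_ring k n) \<Longrightarrow>
    p + q \<in> carrier (cox_ring k n)"
  using Poly_Mapping.keys_add[of p q] by (auto simp: cox_carrier_iff)

lemma cox_carrier_uminus: "p \<in> carrier (cox_ring k n) \<Longrightarrow> - p \<in> carrier (cox_ring k n)"
  by (simp add: cox_carrier_iff)

lemma cox_carrier_mult:
  assumes "p \<in> carrier (cox_ring k n)" "q \<in> carrier (cox_ring k n)"
  shows "p * q \<in> carrier (cox_ring k n)"
  unfolding cox_carrier_iff
proof
  fix t assume "t \<in> keys (p * q)"
  then obtain a b where "a \<in> keys p" "b \<in> keys q" "t = a + b"
    using keys_mult[of p q] by blast
  then show "t \<in> cox_monos k n" using assms by (auto simp: cox_carrier_iff intro!: cox_monos_add)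
qed

lemma cring_cox_ring: "cring (cox_ring k n)"
proof (rule cringI)
  show "abelian_group (cox_ring k n)"
  proof (rule abelian_groupI)
    show "\<exists>y\<in>carrier (cox_ring k n). y \<oplus>\<^bsub>cox_ring k n\<^esub> x = \<zero>\<^bsub>cox_ring k n\<^esub>"
        if "x \<in> carrier (cox_ring k n)" for x
      using cox_carrier_uminus[OF that] by (intro bexI[of _ "- x"]) auto
  qed (auto intro: cox_carrier_add simp: add.assoc add.commute)
  show "Group.comm_monoid (cox_ring k n)"
    by (rule comm_monoidI) (auto intro: cox_carrier_mult simp: mult.assoc mult.commute)
qed (auto simp: ring_distribs)

lemma ring_cox_ring: "ring (cox_ring k n)"
  using cring_cox_ring by (rule cring.axioms(1))

lemma cox_idealI:
  assumes "J \<subseteq> carrier (cox_ring k n)" "0 \<in> J" "\<And>a b. a \<in> J \<Longrightarrow> b \<in> J \<Longrightarrow> a + b \<in> J"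
    and mult: "\<And>c a. c \<in> carrier (cox_ring k n) \<Longrightarrow> a \<in> J \<Longrightarrow> c * a \<in> J"
  shows "ideal J (cox_ring k n)"
proof (rule idealI[OF ring_cox_ring])
  interpret cring "cox_ring k n" by (rule cring_cox_ring)
  show "subgroup J (add_monoid (cox_ring k n))"
  proof (rule add.subgroupI)
    show "\<ominus>\<^bsub>cox_ring k n\<^esub> a \<in> J" if "a \<in> J" for a
    proof -
      have "- a \<in> J" using mult[of "- 1" a] that cox_carrier_uminus[OF cox_carrier_1] by simp
      moreover have "\<ominus>\<^bsub>cox_ring k n\<^esub> a = - a"
        by (rule minus_equality) (use that assms(1) in \<open>auto intro: cox_carrier_uminus\<close>)
      ultimately show ?thesis by simp
    qed
  qed (use assms in auto)
  show "x \<otimes>\<^bsub>cox_ring k n\<^esub> a \<in> J" "a \<otimes>\<^bsub>cox_ring k n\<^esub> x \<in> J" if "a \<in> J" "x \<in> carrier (cox_ring k n)" for a x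
    using mult[OF that(2,1)] by (simp_all add: mult.commute)
qed

lemma cox_ideal_carrier: "ideal J (cox_ring k n) \<Longrightarrow> a \<in> J \<Longrightarrow> a \<in> carrier (cox_ring k n)"
  using ideal.Icarr by fastforce

lemma cox_ideal_0: "ideal J (cox_ring k n) \<Longrightarrow> 0 \<in> J"
  using additive_subgroup.zero_closed[OF ideal.axioms(1), of J "cox_ring k n"] by simp

lemma cox_ideal_add: "ideal J (cox_ring k n) \<Longrightarrow> a \<in> J \<Longrightarrow> b \<in> J \<Longrightarrow> a + b \<in> J"
  using additive_subgroup.a_closed[OF ideal.axioms(1), of J "cox_ring k n" a b] by simp

lemma cox_ideal_mult: "ideal J (cox_ring k n) \<Longrightarrow> c \<in> carrier (cox_ring k n) \<Longrightarrow> a \<in> J \<Longrightarrow> c * a \<in> J"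
  using ideal.I_l_closed[of J "cox_ring k n" a c] by simp

lemma cox_ideal_mult': "ideal J (cox_ring k n) \<Longrightarrow> c \<in> carrier (cox_ring k n) \<Longrightarrow> a \<in> J \<Longrightarrow> a * c \<in> J"
  using cox_ideal_mult[of J k n c a] by (simp add: mult.commute)

lemma cox_ideal_uminus: "ideal J (cox_ring k n) \<Longrightarrow> a \<in> J \<Longrightarrow> - a \<in> J"
  using cox_ideal_mult[of J k n "- 1" a] cox_carrier_uminus[OF cox_carrier_1] by simp

lemma cox_ideal_diff: "ideal J (cox_ring k n) \<Longrightarrow> a \<in> J \<Longrightarrow> b \<in> J \<Longrightarrow> a - b \<in> J"
  using cox_ideal_add[of J k n a "- b"] cox_ideal_uminus[of J k n b] by simp

lemma cox_ideal_sum: "ideal J (cox_ring k n) \<Longrightarrow> (\<And>i. i \<in> A \<Longrightarrow> f i \<in> J) \<Longrightarrow> (\<Sum>i\<in>A. f i) \<in> J"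
  by (induction A rule: infinite_finite_induct) (auto intro: cox_ideal_add cox_ideal_0)

lemma lookup_cscale [simp]: "lookup (cscale c p) m = c * lookup p m"
  unfolding cscale_def mult_map_scale_conv_mult[symmetric]
  by (simp add: Poly_Mapping.map.rep_eq when_def)

lemma cox_ideal_cscale: "ideal J (cox_ring k n) \<Longrightarrow> a \<in> J \<Longrightarrow> cscale c a \<in> J"
  unfolding cscale_def by (rule cox_ideal_mult) auto

lemma subspace_cox_ideal: "ideal J (cox_ring k n) \<Longrightarrow> cpoly.subspace J"
  unfolding cpoly.subspace_def by (auto intro: cox_ideal_0 cox_ideal_add cox_ideal_cscale)

lemma keys_cscale: "keys (cscale c p) \<subseteq> keys p"
  by (auto simp: in_keys_iff)

lemma subspace_cox_piece: "cpoly.subspace (cox_piece k n u)"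
  unfolding cpoly.subspace_def cox_piece_def
proof safe
  fix x y t assume "keys x \<subseteq> cox_monos_deg k n u" "keys y \<subseteq> cox_monos_deg k n u"
    "t \<in> keys (x + y)"
  then show "t \<in> cox_monos_deg k n u" using Poly_Mapping.keys_add[of x y] by blast
next
  fix x c t assume "keys x \<subseteq> cox_monos_deg k n u" "t \<in> keys (cscale c x)"
  then show "t \<in> cox_monos_deg k n u" using keys_cscale[of c x] by blast
qed simp

lemma cox_piece_carrier: "cox_piece k n u \<subseteq> carrier (cox_ring k n)"
  by (auto simp: cox_piece_def cox_carrier_iff cox_monos_deg_def)

lemma cox_piece_single: "m \<in> cox_monos_deg k n u \<Longrightarrow> single m c \<in> cox_piece k n u"
  by (auto simp: cox_piece_def)

lemma finite_bounded_poly_mapping: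
  assumes "finite V"
  shows "finite {m :: 'v \<Rightarrow>\<^sub>0 nat. keys m \<subseteq> V \<and> (\<forall>v\<in>V. lookup m v \<le> N)}"
proof (rule finite_imageD)
  let ?A = "{m :: 'v \<Rightarrow>\<^sub>0 nat. keys m \<subseteq> V \<and> (\<forall>v\<in>V. lookup m v \<le> N)}"
  have "(\<lambda>m. restrict (lookup m) V) ` ?A \<subseteq> V \<rightarrow>\<^sub>E {..N}" by auto
  then show "finite ((\<lambda>m. restrict (lookup m) V) ` ?A)"
    using assms by (meson finite_PiE finite_atMost finite_subset)
  show "inj_on (\<lambda>m. restrict (lookup m) V) ?A"
  proof (rule inj_onI)
    fix a b :: "'v \<Rightarrow>\<^sub>0 nat"
    assume a: "a \<in> ?A" and b: "b \<in> ?A" and eq: "restrict (lookup a) V = restrict (lookup b) V"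
    show "a = b"
    proof (rule poly_mapping_eqI)
      fix v
      show "lookup a v = lookup b v"
      proof (cases "v \<in> V")
        case True then show ?thesis using fun_cong[OF eq, of v] by simp
      next
        case False
        then have "v \<notin> keys a" "v \<notin> keys b" using a b by auto
        then show ?thesis by (simp add: in_keys_iff)
      qed
    qed
  qed
qed

lemma finite_cox_monos_deg: "finite (cox_monos_deg k n u)"
proof (rule finite_subset[OF _ finite_bounded_poly_mapping[OF finite_cox_vars, of k n "\<Sum>i=1..k. nat (u i)"]])
  show "cox_monos_deg k n u \<subseteq> {m. keys m \<subseteq> cox_vars k n \<and>
      (\<forall>v\<in>cox_vars k n. lookup m v \<le> (\<Sum>i=1..k. nat (u i)))}"
  proof safe
    fix m v assume m: "m \<in> cox_monos_deg k n u"
    show "lookup m v \<le> (\<Sum>i=1..k. nat (u i))" if v: "v \<in> cox_vars k n"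
    proof -
      obtain i l where il: "v = (i, l)" "i \<in> {1..k}" "l \<le> n i" using v by (auto simp: cox_vars_def)
      have "lookup m (i, l) \<le> (\<Sum>l\<le>n i. lookup m (i, l))"
        by (rule member_le_sum) (use il in auto)
      also have "\<dots> = nat (u i)" by (rule cox_monos_deg_sum[OF m il(2)])
      also have "\<dots> \<le> (\<Sum>i=1..k. nat (u i))" by (rule member_le_sum) (use il in auto)
      finally show ?thesis using il by simp
    qed
    show "v \<in> cox_vars k n" if "v \<in> keys m" using cox_monos_deg_keys[OF m] that by blast
  qed
qed

lemma cox_piece_lookup: "p \<in> cox_piece k n u \<Longrightarrow> m \<notin> cox_monos_deg k n u \<Longrightarrow> lookup p m = 0"
  by (auto simp: cox_piece_def in_keys_iff)

lemma cox_piece_eq_0: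
  assumes "p \<in> cox_piece k n u" "\<And>m. m \<in> cox_monos_deg k n u \<Longrightarrow> lookup p m = 0"
  shows "p = 0"
  by (rule poly_mapping_eqI) (metis assms cox_piece_lookup lookup_zero)

lemma cox_piece_expand:
  assumes "p \<in> cox_piece k n u"
  shows "p = (\<Sum>m\<in>cox_monos_deg k n u. single m (lookup p m))"
proof (rule poly_mapping_eqI)
  fix m
  show "lookup p m = lookup (\<Sum>m\<in>cox_monos_deg k n u. single m (lookup p m)) m"
    using cox_piece_lookup[OF assms, of m]
    by (auto simp: lookup_sum lookup_single when_def sum.delta finite_cox_monos_deg)
qed

lemma cox_piece_poly_eval:
  assumes "p \<in> cox_piece k n u"
  shows "poly_eval p y = (\<Sum>m\<in>cox_monos_deg k n u. lookup p m * mon m y)"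
  by (rule poly_eval_superset[OF finite_cox_monos_deg]) (use assms in \<open>simp add: cox_piece_def\<close>)

section \<open>Dimensions of subspaces of a graded piece\<close>

lemma cox_piece_basis:
  assumes W: "cpoly.subspace W" "W \<subseteq> cox_piece k n u"
  shows "\<exists>B. finite B \<and> B \<subseteq> W \<and> card B = cpoly.dim W \<and> cpoly.independent B \<and> cpoly.span B = W"
proof -
  obtain B where B: "B \<subseteq> W" "cpoly.independent B" "W \<subseteq> cpoly.span B" "card B = cpoly.dim W"
    by (rule cpoly.basis_exists)
  have "cox_piece k n u \<subseteq> cpoly.span ((\<lambda>m. single m 1) ` cox_monos_deg k n u)"
  proof
    fix p assume p: "p \<in> cox_piece k n u"
    have "(\<Sum>m\<in>cox_monos_deg k n u. single m (lookup p m)) =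
        (\<Sum>m\<in>cox_monos_deg k n u. cscale (lookup p m) (single m 1))"
      by (intro sum.cong refl) (simp add: cscale_def mult_single)
    also have "\<dots> \<in> cpoly.span ((\<lambda>m. single m 1) ` cox_monos_deg k n u)"
      by (intro cpoly.span_sum cpoly.span_scale cpoly.span_base) auto
    finally show "p \<in> cpoly.span ((\<lambda>m. single m 1) ` cox_monos_deg k n u)"
      using cox_piece_expand[OF p] by simp
  qed
  then have "B \<subseteq> cpoly.span ((\<lambda>m. single m 1) ` cox_monos_deg k n u)"
    using B(1) W(2) by blast
  from cpoly.independent_span_bound[OF _ B(2) this] have "finite B" by (simp add: finite_cox_monos_deg)
  moreover have "cpoly.span B = W"
    using B(3) cpoly.span_minimal[OF B(1) W(1)] by blast
  ultimately show ?thesis using B by blast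
qed

lemma cox_piece_lookup_eq_0_iff:
  assumes "p \<in> cox_piece k n u"
  shows "p = 0 \<longleftrightarrow> (\<forall>m\<in>cox_monos_deg k n u. lookup p m = 0)"
  using cox_piece_eq_0[OF assms] by auto

lemma lookup_sum_cscale:
  "lookup (\<Sum>i\<in>A. cscale (x i) (p i)) m = (\<Sum>i\<in>A. x i * lookup (p i) m)"
  by (simp add: lookup_sum)

lemma sum_cscale_in:
  "cpoly.subspace W \<Longrightarrow> (\<And>i. i \<in> A \<Longrightarrow> p i \<in> W) \<Longrightarrow> (\<Sum>i\<in>A. cscale (x i) (p i)) \<in> W"
  by (intro cpoly.subspace_sum cpoly.subspace_scale)

lemma independent_indep_on:
  assumes B: "finite B" "B \<subseteq> cox_piece k n u" "cpoly.independent B"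
  shows "indep_on B (cox_monos_deg k n u) lookup"
proof (rule indep_onI)
  fix x b assume b: "b \<in> B"
    and eq: "\<And>m. m \<in> cox_monos_deg k n u \<Longrightarrow> (\<Sum>b\<in>B. x b * lookup b m) = 0"
  have "(\<Sum>b\<in>B. cscale (x b) b) \<in> cox_piece k n u"
    by (rule sum_cscale_in[OF subspace_cox_piece]) (use B(2) in auto)
  then have "(\<Sum>b\<in>B. cscale (x b) b) = 0"
    by (rule cox_piece_eq_0) (simp add: lookup_sum_cscale eq)
  then show "x b = 0" using B(1,3) b cpoly.dependent_finite[OF B(1)] by blast
qed

lemma span_finite_coeffs:
  assumes "finite B" "p \<in> cpoly.span B"
  shows "\<exists>x. p = (\<Sum>b\<in>B. cscale (x b) b)"
  using assms(2) unfolding cpoly.span_finite[OF assms(1)] by blast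

lemma indep_on_card_le_dim:
  assumes W: "cpoly.subspace W" "W \<subseteq> cox_piece k n u" and I: "finite I" "\<And>i. i \<in> I \<Longrightarrow> P i \<in> W"
    and ind: "indep_on I M (\<lambda>i. lookup (P i))"
  shows "card I \<le> cpoly.dim W"
proof (rule ccontr)
  assume less: "\<not> ?thesis"
  obtain B where B: "finite B" "card B = cpoly.dim W" "cpoly.span B = W"
    using cox_piece_basis[OF W] by blast
  have "\<forall>i\<in>I. \<exists>x. P i = (\<Sum>b\<in>B. cscale (x b) b)" using span_finite_coeffs[OF B(1)] I(2) B(3) by blast
  from bchoice[OF this] obtain x where x: "\<And>i. i \<in> I \<Longrightarrow> P i = (\<Sum>b\<in>B. cscale (x i b) b)" by blast
  have "card B < card I" using less B(2) by simp
  from underdetermined[OF B(1) I(1) this, of x] obtain y where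
    y: "\<exists>i\<in>I. y i \<noteq> 0" "\<And>b. b \<in> B \<Longrightarrow> (\<Sum>i\<in>I. y i * x i b) = 0" by blast
  have "y i = 0" if "i \<in> I" for i
  proof (rule indep_onD[OF ind _ that])
    fix m
    have "(\<Sum>i\<in>I. y i * lookup (P i) m) = (\<Sum>i\<in>I. \<Sum>b\<in>B. y i * x i b * lookup b m)"
      by (intro sum.cong refl) (simp add: x lookup_sum_cscale sum_distrib_left mult.assoc)
    also have "\<dots> = (\<Sum>b\<in>B. (\<Sum>i\<in>I. y i * x i b) * lookup b m)"
      by (subst sum.swap) (simp add: sum_distrib_right)
    also have "\<dots> = 0" by (simp add: y(2))
    finally show "(\<Sum>i\<in>I. y i * lookup (P i) m) = 0" .
  qed
  then show False using y(1) by blast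
qed

lemma cox_dim_eq: "cox_dim k n u = card (cox_monos_deg k n u)"
proof (rule antisym)
  obtain B where B: "finite B" "B \<subseteq> cox_piece k n u" "card B = cox_dim k n u" "cpoly.independent B"
    using cox_piece_basis[OF subspace_cox_piece order_refl, of k n u] by blast
  show "cox_dim k n u \<le> card (cox_monos_deg k n u)"
    using indep_on_card_le[OF B(1) finite_cox_monos_deg independent_indep_on[OF B(1,2,4)]] B(3) by simp
  show "card (cox_monos_deg k n u) \<le> cox_dim k n u"
  proof (rule indep_on_card_le_dim[OF subspace_cox_piece order_refl finite_cox_monos_deg])
    show "indep_on (cox_monos_deg k n u) (cox_monos_deg k n u) (\<lambda>m. lookup (single m 1))"
    proof (rule indep_onI)
      fix x :: "mono \<Rightarrow> complex" and q assume q: "q \<in> cox_monos_deg k n u"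
        and eq: "\<And>m. m \<in> cox_monos_deg k n u \<Longrightarrow> (\<Sum>q\<in>cox_monos_deg k n u. x q * lookup (single q 1) m) = 0"
      have "(\<Sum>p\<in>cox_monos_deg k n u. x p * lookup (single p 1) q) =
         (\<Sum>p\<in>cox_monos_deg k n u. if p = q then x p else 0)"
        by (intro sum.cong refl) (simp add: lookup_single when_def)
      then show "x q = 0" using eq[OF q] q by (simp add: sum.delta finite_cox_monos_deg)
    qed
  qed (auto intro: cox_piece_single)
qed

text \<open>Lower bound for a codimension: independent functionals annihilating \<open>W\<close> are
  independent on the quotient of the piece by \<open>W\<close>.\<close>

lemma dim_add_card_le:
  assumes W: "cpoly.subspace W" "W \<subseteq> cox_piece k n u" and Q: "finite Q" "indep_on Q (cox_monos_deg k n u) a"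
    and orth: "\<And>q p. q \<in> Q \<Longrightarrow> p \<in> W \<Longrightarrow> (\<Sum>m\<in>cox_monos_deg k n u. a q m * lookup p m) = 0"
  shows "cpoly.dim W + card Q \<le> card (cox_monos_deg k n u)"
proof -
  obtain B where B: "finite B" "B \<subseteq> W" "card B = cpoly.dim W" "cpoly.independent B"
    using cox_piece_basis[OF W] by blast
  have "indep_on B (cox_monos_deg k n u) lookup"
    using B W(2) by (intro independent_indep_on) auto
  moreover have "(\<Sum>m\<in>cox_monos_deg k n u. a q m * lookup p m) = 0" if "q \<in> Q" "p \<in> B" for q p
    using orth[OF that(1)] that(2) B(2) by blast
  ultimately have "card Q + card B \<le> card (cox_monos_deg k n u)"
    by (rule indep_on_orthogonal_card[OF Q(1) B(1) finite_cox_monos_deg Q(2)])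
  then show ?thesis using B(3) by simp
qed

text \<open>The conditions \<open>Q\<close>, together with Hermitian orthogonality to a basis of
  \<open>W\<close>, are still fewer than the coefficients. A nonzero solution is outside
  \<open>W\<close>, as otherwise it would be orthogonal to itself.\<close>

lemma orthogonal_outside:
  assumes W: "cpoly.subspace W" "W \<subseteq> cox_piece k n u" and Q: "finite Q"
    and card: "cpoly.dim W + card Q < card (cox_monos_deg k n u)"
  shows "\<exists>p\<in>cox_piece k n u - W. \<forall>q\<in>Q. (\<Sum>m\<in>cox_monos_deg k n u. a q m * lookup p m) = 0"
proof -
  let ?M = "cox_monos_deg k n u"
  obtain B where B: "finite B" "B \<subseteq> W" "card B = cpoly.dim W" "cpoly.span B = W"
    using cox_piece_basis[OF W] by blast
  have "card Q + card B < card ?M" using card B by simp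
  from orthogonal_exists[OF Q B(1) finite_cox_monos_deg this, of a lookup]
  obtain f where f: "\<exists>m\<in>?M. f m \<noteq> 0" "\<And>q. q \<in> Q \<Longrightarrow> (\<Sum>m\<in>?M. f m * a q m) = 0"
    "\<And>p. p \<in> B \<Longrightarrow> (\<Sum>m\<in>?M. f m * cnj (lookup p m)) = 0" by blast
  define p where "p = (\<Sum>m\<in>?M. single m (f m))"
  have lp: "lookup p m = f m" if "m \<in> ?M" for m
    using that by (simp add: p_def lookup_sum lookup_single when_def sum.delta finite_cox_monos_deg)
  have "p \<in> cox_piece k n u"
    unfolding p_def by (intro cpoly.subspace_sum[OF subspace_cox_piece] cox_piece_single)
  moreover have "p \<notin> W"
  proof
    assume "p \<in> W"
    then obtain x where x: "p = (\<Sum>b\<in>B. cscale (x b) b)" using span_finite_coeffs[OF B(1)] B(4) by blast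
    have "(\<Sum>m\<in>?M. f m * cnj (f m)) = (\<Sum>m\<in>?M. f m * cnj (lookup p m))"
      by (intro sum.cong refl) (simp add: lp)
    also have "\<dots> = (\<Sum>m\<in>?M. \<Sum>b\<in>B. cnj (x b) * (f m * cnj (lookup b m)))"
      by (intro sum.cong refl) (simp add: x lookup_sum_cscale sum_distrib_left ac_simps)
    also have "\<dots> = (\<Sum>b\<in>B. cnj (x b) * (\<Sum>m\<in>?M. f m * cnj (lookup b m)))"
      by (subst sum.swap) (simp add: sum_distrib_left)
    also have "\<dots> = 0" by (simp add: f(3))
    finally have "(\<Sum>m\<in>?M. (cmod (f m))\<^sup>2) = 0"
      by (simp add: complex_norm_square[symmetric] flip: of_real_sum of_real_power)
    then show False using f(1) by (simp add: sum_nonneg_eq_0_iff finite_cox_monos_deg)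
  qed
  moreover have "(\<Sum>m\<in>?M. a q m * lookup p m) = 0" if "q \<in> Q" for q
    using f(2)[OF that] by (simp add: lp mult.commute)
  ultimately show ?thesis by blast
qed

text \<open>The quotient of the piece by \<open>W\<close> has dimension at most \<open>r\<close>,
  and the index \<open>p\<close> runs through \<open>r + 1\<close> values.\<close>

lemma dependent_modulo:
  assumes W: "cpoly.subspace W" "W \<subseteq> cox_piece k n u"
    and card: "card (cox_monos_deg k n u) \<le> cpoly.dim W + r" and h: "\<And>p. p \<le> r \<Longrightarrow> h p \<in> cox_piece k n u"
  shows "\<exists>c. (\<exists>p\<le>r. c p \<noteq> 0) \<and> (\<Sum>p\<le>r. cscale (c p) (h p)) \<in> W"
proof -
  let ?M = "cox_monos_deg k n u"
  obtain B where B: "finite B" "B \<subseteq> W" "card B = cpoly.dim W" "cpoly.independent B" "cpoly.span B = W"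
    using cox_piece_basis[OF W] by blast
  have less: "card ?M < card (Sum_Type.Plus {..r} B)" using B card by (simp add: card_Plus)
  obtain x where xx: "(\<exists>s\<in>Sum_Type.Plus {..r} B. x s \<noteq> 0) \<and> (\<forall>m\<in>?M.
      (\<Sum>s\<in>Sum_Type.Plus {..r} B. x s * case_sum (\<lambda>p. lookup (h p)) lookup s m) = 0)"
    using underdetermined[OF finite_cox_monos_deg finite_Plus[OF finite_atMost B(1)] less,
      of "case_sum (\<lambda>p. lookup (h p)) lookup"]
    by (elim exE) (rule that)
  note x = xx[THEN conjunct1] xx[THEN conjunct2, rule_format]
  have BW: "(\<Sum>b\<in>B. cscale (x (Inr b)) b) \<in> W" by (rule sum_cscale_in[OF W(1)]) (use B in auto)
  have hp: "(\<Sum>p\<le>r. cscale (x (Inl p)) (h p)) \<in> cox_piece k n u"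
    by (rule sum_cscale_in[OF subspace_cox_piece]) (use h in auto)
  have "(\<Sum>p\<le>r. cscale (x (Inl p)) (h p)) + (\<Sum>b\<in>B. cscale (x (Inr b)) b) \<in> cox_piece k n u"
    using cpoly.subspace_add[OF subspace_cox_piece hp] BW W(2) by blast
  then have eq: "(\<Sum>p\<le>r. cscale (x (Inl p)) (h p)) + (\<Sum>b\<in>B. cscale (x (Inr b)) b) = 0"
    by (rule cox_piece_eq_0) (use x(2) B(1) in \<open>simp add: lookup_add lookup_sum_cscale sum_Plus\<close>)
  have "\<exists>p\<le>r. x (Inl p) \<noteq> 0"
  proof (rule ccontr)
    assume np: "\<not> ?thesis"
    then have "(\<Sum>p\<le>r. cscale (x (Inl p)) (h p)) = 0" by (intro sum.neutral) auto
    then have "(\<Sum>b\<in>B. cscale (x (Inr b)) b) = 0" using eq by simp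
    then have "(\<Sum>b\<in>B. x (Inr b) * lookup b m) = 0" for m
      using lookup_sum_cscale[of "\<lambda>b. x (Inr b)" "\<lambda>b. b" B m] by simp
    moreover have "indep_on B ?M lookup"
      using B W(2) by (intro independent_indep_on) auto
    ultimately have "x (Inr b) = 0" if "b \<in> B" for b
      using that by (intro indep_onD[where x = "\<lambda>b. x (Inr b)"])
    then show False using np x(1) by blast
  qed
  moreover have "(\<Sum>p\<le>r. cscale (x (Inl p)) (h p)) = - (\<Sum>b\<in>B. cscale (x (Inr b)) b)"
    using eq by (simp add: add_eq_0_iff2)
  then have "(\<Sum>p\<le>r. cscale (x (Inl p)) (h p)) \<in> W" using cpoly.subspace_neg[OF W(1) BW] by simp
  ultimately show ?thesis by (intro exI[of _ "\<lambda>p. x (Inl p)"]) auto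
qed

section \<open>The zeros of a radical saturated ideal\<close>

lemma has_mdeg_add:
  assumes "has_mdeg k n m a" "has_mdeg k n m' b"
  shows "has_mdeg k n (m + m') (\<lambda>i. a i + b i)"
  using assms by (simp add: has_mdeg_def lookup_add sum.distrib)

lemma cox_monos_deg_add:
  "m \<in> cox_monos_deg k n a \<Longrightarrow> m' \<in> cox_monos_deg k n b \<Longrightarrow> m + m' \<in> cox_monos_deg k n (\<lambda>i. a i + b i)"
  by (simp add: cox_monos_deg_def has_mdeg_add cox_monos_add)

lemma cox_piece_mult:
  assumes "f \<in> cox_piece k n a" "g \<in> cox_piece k n b"
  shows "f * g \<in> cox_piece k n (\<lambda>i. a i + b i)"
  unfolding cox_piece_def
proof safe
  fix t assume "t \<in> keys (f * g)"
  then obtain x y where "x \<in> keys f" "y \<in> keys g" "t = x + y"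
    using keys_mult[of f g] by blast
  then show "t \<in> cox_monos_deg k n (\<lambda>i. a i + b i)"
    using assms by (auto simp: cox_piece_def intro!: cox_monos_deg_add)
qed

lemma cox_piece_1: "1 \<in> cox_piece k n (\<lambda>_. 0)"
  by (simp add: cox_piece_def cox_monos_deg_def has_mdeg_def)

lemma cox_piece_power: "f \<in> cox_piece k n a \<Longrightarrow> f ^ t \<in> cox_piece k n (\<lambda>i. int t * a i)"
proof (induction t)
  case 0
  then show ?case using cox_piece_1 by simp
next
  case (Suc t)
  then show ?case using cox_piece_mult[OF Suc.prems Suc.IH] by (simp add: algebra_simps)
qed

definition cst :: "complex \<Rightarrow> cpoly" where "cst c = single 0 c"

lemma cst_mult: "cst (a * b) = cst a * cst b" and cst_add: "cst (a + b) = cst a + cst b"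
  and cst_uminus: "cst (- a) = - cst a" and cst_1 [simp]: "cst 1 = 1" and cst_0 [simp]: "cst 0 = 0"
  by (simp_all add: cst_def mult_single single_add single_uminus)

lemma cst_diff: "cst (a - b) = cst a - cst b"
  using cst_add[of a "- b"] by (simp add: cst_uminus)

lemma cst_power: "cst (a ^ t) = cst a ^ t"
  by (induction t) (simp_all add: cst_mult)

lemma cst_prod: "cst (\<Prod>i\<in>A. f i) = (\<Prod>i\<in>A. cst (f i))"
  by (induction A rule: infinite_finite_induct) (simp_all add: cst_mult)

lemma cst_sum: "cst (\<Sum>i\<in>A. f i) = (\<Sum>i\<in>A. cst (f i))"
  by (induction A rule: infinite_finite_induct) (simp_all add: cst_add)

lemma cst_carrier [simp]: "cst c \<in> carrier (cox_ring k n)"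
  by (simp add: cst_def)

lemma cscale_cst: "cscale c p = cst c * p"
  by (simp add: cscale_def cst_def)

lemma cox_piece_cst_mult: "f \<in> cox_piece k n u \<Longrightarrow> cst c * f \<in> cox_piece k n u"
  using cpoly.subspace_scale[OF subspace_cox_piece, of f k n u c] by (simp add: cscale_cst)

definition cox_var :: "nat \<times> nat \<Rightarrow> cpoly" where
  "cox_var v = single (single v 1) 1"

lemma cox_var_piece:
  assumes "(i, l) \<in> cox_vars k n"
  shows "cox_var (i, l) \<in> cox_piece k n (\<lambda>i'. if i' = i then 1 else 0)"
  unfolding cox_var_def
proof (rule cox_piece_single)
  have "(\<Sum>l'\<le>n i'. lookup (single (i, l) (1::nat)) (i', l')) = (if i' = i then 1 else 0)" for i'
    using assms by (auto simp: lookup_single when_def cox_vars_def sum.delta)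
  then have "int (\<Sum>l'\<le>n i'. lookup (single (i, l) 1) (i', l')) = (if i' = i then 1 else 0)" for i'
    by simp
  then show "single (i, l) 1 \<in> cox_monos_deg k n (\<lambda>i'. if i' = i then 1 else 0)"
    using assms by (simp add: cox_monos_deg_def cox_monos_def has_mdeg_def)
qed

lemma cox_var_carrier: "v \<in> cox_vars k n \<Longrightarrow> cox_var v \<in> carrier (cox_ring k n)"
  using cox_var_piece[of "fst v" "snd v" k n] cox_piece_carrier by auto

lemma cox_var_power: "cox_var v ^ t = single (single v t) 1"
  by (induction t) (simp_all add: cox_var_def mult_single flip: single_add)

lemma prod_single_1:
  fixes s :: "'i \<Rightarrow> mono"
  shows "(\<Prod>v\<in>A. single (s v) (1::complex)) = single (\<Sum>v\<in>A. s v) 1"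
  by (induction A rule: infinite_finite_induct) (simp_all add: mult_single)

lemma single_eq_prod_cox_var:
  "single m 1 = (\<Prod>v\<in>keys m. cox_var v ^ lookup m v)"
  unfolding cox_var_power prod_single_1 by (simp flip: poly_mapping_sum_single)

section \<open>Binary forms and eigenvalues modulo the ideal\<close>

text \<open>The homogenisation of \<open>p\<close> to degree \<open>N\<close>, evaluated at two
  elements of the Cox ring. If the degree of \<open>p\<close> is smaller than \<open>N\<close>,
  powers of \<open>y\<close> split off.\<close>

definition bform :: "nat \<Rightarrow> complex poly \<Rightarrow> cpoly \<Rightarrow> cpoly \<Rightarrow> cpoly" where
  "bform N p x y = (\<Sum>q\<le>N. cst (coeff p q) * (y ^ (N - q) * x ^ q))"

lemma bform_low_degree:
  assumes "degree p \<le> N"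
  shows "bform (Suc N) p x y = y * bform N p x y"
proof -
  have "bform (Suc N) p x y = (\<Sum>q\<le>N. cst (coeff p q) * (y ^ (Suc N - q) * x ^ q))"
    using assms by (simp add: bform_def coeff_eq_0)
  also have "\<dots> = (\<Sum>q\<le>N. y * (cst (coeff p q) * (y ^ (N - q) * x ^ q)))"
    by (intro sum.cong refl) (simp add: Suc_diff_le ac_simps)
  finally show ?thesis by (simp add: bform_def sum_distrib_left)
qed

lemma bform_linear_factor:
  assumes "degree q \<le> N"
  shows "bform (Suc N) ([:- c, 1:] * q) x y = (x - cst c * y) * bform N q x y"
proof -
  have co: "coeff ([:- c, 1:] * q) m = - c * coeff q m + (case m of 0 \<Rightarrow> 0 | Suc m' \<Rightarrow> coeff q m')" for m
    by (simp add: coeff_pCons)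
  have "bform (Suc N) ([:- c, 1:] * q) x y =
     (\<Sum>m\<le>Suc N. - cst c * (cst (coeff q m) * (y ^ (Suc N - m) * x ^ m))) +
     (\<Sum>m\<le>Suc N. cst (case m of 0 \<Rightarrow> 0 | Suc m' \<Rightarrow> coeff q m') * (y ^ (Suc N - m) * x ^ m))"
    unfolding bform_def co sum.distrib[symmetric]
    by (intro sum.cong refl) (simp only: cst_add cst_mult cst_uminus ring_distribs mult.assoc)
  also have "(\<Sum>m\<le>Suc N. - cst c * (cst (coeff q m) * (y ^ (Suc N - m) * x ^ m))) =
      - cst c * bform (Suc N) q x y"
    unfolding bform_def sum_distrib_left ..
  also have "bform (Suc N) q x y = y * bform N q x y" by (rule bform_low_degree[OF assms])
  also have "(\<Sum>m\<le>Suc N. cst (case m of 0 \<Rightarrow> 0 | Suc m' \<Rightarrow> coeff q m') * (y ^ (Suc N - m) * x ^ m)) =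
      (\<Sum>m\<le>N. x * (cst (coeff q m) * (y ^ (N - m) * x ^ m)))"
    by (simp add: sum.atMost_Suc_shift ac_simps del: sum.atMost_Suc)
  also have "\<dots> = x * bform N q x y"
    unfolding bform_def sum_distrib_left ..
  finally show ?thesis by (simp add: algebra_simps)
qed

text \<open>The codimension bound stands in for dimension theory: any \<open>r + 1\<close> elements
  of one graded piece are dependent modulo \<open>I\<close>.\<close>

locale points_ideal =
  fixes k :: nat and n :: "nat \<Rightarrow> nat" and I :: "cpoly set" and r :: nat
  assumes hom: "homogeneous_ideal k n I" and rad: "radical_ideal k n I" and sat: "saturated k n I"
    and codim: "\<And>u. card (cox_monos_deg k n u) \<le> cpoly.dim (I \<inter> cox_piece k n u) + r"
begin

lemma ideal_I: "ideal I (cox_ring k n)"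
  using hom by (simp add: homogeneous_ideal_def)

lemmas I_add = cox_ideal_add[OF ideal_I]
  and I_mult = cox_ideal_mult[OF ideal_I]
  and I_mult' = cox_ideal_mult'[OF ideal_I]
  and I_diff = cox_ideal_diff[OF ideal_I]
  and I_sum = cox_ideal_sum[OF ideal_I]

lemma subspace_I_piece: "cpoly.subspace (I \<inter> cox_piece k n u)"
  by (intro cpoly.subspace_inter subspace_cox_ideal[OF ideal_I] subspace_cox_piece)

lemma square_I: "f \<in> carrier (cox_ring k n) \<Longrightarrow> f * f \<in> I \<Longrightarrow> f \<in> I"
  using rad[unfolded radical_ideal_def, rule_format, of f 2] by (simp add: power2_eq_square)

lemma cst_mult_I: "cst c * f \<in> I \<Longrightarrow> c \<noteq> 0 \<Longrightarrow> f \<in> I"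
  using I_mult[of "cst (1 / c)" "cst c * f"] by (simp flip: mult.assoc cst_mult)

text \<open>A homogeneous multiple of \<open>F\<close> that is nonzero modulo \<open>I\<close>, in
  the role of a vector on which the variables act. As a multiple of \<open>F\<close> it is not
  killed by divisors of \<open>F\<close>, and in the end this shows that \<open>F\<close> is nonzero
  at the point found.\<close>

definition good :: "cpoly \<Rightarrow> cpoly \<Rightarrow> bool" where
  "good F w \<longleftrightarrow> w \<notin> I \<and> (\<exists>u. w \<in> cox_piece k n u) \<and> (\<exists>h\<in>carrier (cox_ring k n). w = F * h)"

lemma good_carrier: "good F w \<Longrightarrow> w \<in> carrier (cox_ring k n)"
  using cox_piece_carrier unfolding good_def by blast

lemma good_mult:
  assumes "good F w" "h \<in> cox_piece k n d" "w * h \<notin> I"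
  shows "good F (w * h)"
proof -
  obtain u g where u: "w \<in> cox_piece k n u" and g: "g \<in> carrier (cox_ring k n)" "w = F * g"
    using assms(1) by (auto simp: good_def)
  have "w * h = F * (g * h)" using g by (simp add: mult.assoc)
  moreover have "g * h \<in> carrier (cox_ring k n)"
    using g assms(2) cox_piece_carrier by (blast intro: cox_carrier_mult)
  ultimately show ?thesis using assms(3) cox_piece_mult[OF u assms(2)] unfolding good_def by blast
qed

text \<open>Since \<open>I\<close> is radical, a divisor of \<open>F\<close> is a nonzerodivisor on the multiples of \<open>F\<close> modulo \<open>I\<close>.\<close>

lemma good_mult_divisor:
  assumes w: "good F w" and F: "F = y * F'" and F': "F' \<in> carrier (cox_ring k n)" and y: "y \<in> cox_piece k n d"
  shows "good F (w * y)"
proof (rule good_mult[OF w y])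
  obtain h where h: "h \<in> carrier (cox_ring k n)" "w = F * h" using w by (auto simp: good_def)
  show "w * y \<notin> I"
  proof
    assume "w * y \<in> I"
    then have "(F' * h) * (w * y) \<in> I" by (rule I_mult[OF cox_carrier_mult[OF F' h(1)]])
    moreover have "(F' * h) * (w * y) = w * w" using h(2) F by (simp add: ac_simps)
    ultimately have "w \<in> I" using square_I[OF good_carrier[OF w]] by simp
    then show False using w by (simp add: good_def)
  qed
qed

text \<open>The existence of eigenvectors over an algebraically closed field, homogenised with
  \<open>y\<close> in the place of 1. The linear factors of \<open>p\<close> are applied to
  \<open>w\<close> one after the other until one of them sends it into \<open>I\<close>. Factors
  \<open>y\<close> due to a drop of degree never do so, because \<open>y\<close> divides
  \<open>F\<close>.\<close>

lemma eigenvalue: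
  assumes x: "x \<in> cox_piece k n d" and y: "y \<in> cox_piece k n d"
    and F: "F = y * F'" and F': "F' \<in> carrier (cox_ring k n)"
  shows "p \<noteq> 0 \<Longrightarrow> degree p \<le> N \<Longrightarrow> good F w \<Longrightarrow> w * bform N p x y \<in> I \<Longrightarrow>
    \<exists>h c. h \<in> carrier (cox_ring k n) \<and> good F (w * h) \<and> w * h * (x - cst c * y) \<in> I"
proof (induction N arbitrary: p w)
  case 0
  have "coeff p 0 \<noteq> 0" using "0.prems" by (metis le_0_eq leading_coeff_neq_0)
  moreover have "cst (coeff p 0) * w \<in> I" using "0.prems"(4) by (simp add: bform_def mult.commute)
  ultimately have "w \<in> I" by (rule cst_mult_I[rotated])
  then show ?case using "0.prems"(3) by (simp add: good_def)
next
  case (Suc N)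
  have carr: "x \<in> carrier (cox_ring k n)" "y \<in> carrier (cox_ring k n)" using x y cox_piece_carrier by auto
  show ?case
  proof (cases "degree p \<le> N")
    case True
    have "w * y * bform N p x y \<in> I"
      using Suc.prems(4) bform_low_degree[OF True, of x y] by (simp add: mult.assoc)
    from Suc.IH[OF Suc.prems(1) True good_mult_divisor[OF Suc.prems(3) F F' y] this]
    obtain h c where "h \<in> carrier (cox_ring k n)" "good F (w * y * h)" "w * y * h * (x - cst c * y) \<in> I"
        by blast
    then show ?thesis using carr
      by (intro exI[of _ "y * h"] exI[of _ c]) (auto simp: mult.assoc intro: cox_carrier_mult)
  next
    case False
    then have deg: "degree p = Suc N" using Suc.prems(2) by simp
    then have "\<not> constant (poly p)" by (simp add: constant_degree)
    then obtain c where "poly p c = 0" using fundamental_theorem_of_algebra by blast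
    then obtain q where q: "p = [:- c, 1:] * q" by (auto simp: poly_eq_0_iff_dvd dvd_def)
    then have q0: "q \<noteq> 0" using Suc.prems(1) by auto
    then have "degree p = Suc (degree q)" unfolding q by (subst degree_mult_eq) auto
    then have dq: "degree q \<le> N" using deg by simp
    have xy: "x - cst c * y \<in> cox_piece k n d"
      by (rule cpoly.subspace_diff[OF subspace_cox_piece x cox_piece_cst_mult[OF y]])
    show ?thesis
    proof (cases "w * (x - cst c * y) \<in> I")
      case True
      then show ?thesis using Suc.prems(3) by (intro exI[of _ 1] exI[of _ c]) simp
    next
      case False
      have g: "good F (w * (x - cst c * y))" by (rule good_mult[OF Suc.prems(3) xy False])
      have "w * (x - cst c * y) * bform N q x y \<in> I"
        using Suc.prems(4) unfolding q bform_linear_factor[OF dq] by (simp add: mult.assoc)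
      from Suc.IH[OF q0 dq g this]
      obtain h c' where "h \<in> carrier (cox_ring k n)" "good F (w * (x - cst c * y) * h)"
        "w * (x - cst c * y) * h * (x - cst c' * y) \<in> I" by blast
      moreover have "x - cst c * y \<in> carrier (cox_ring k n)" using xy cox_piece_carrier by blast
      ultimately show ?thesis
        by (intro exI[of _ "(x - cst c * y) * h"] exI[of _ c']) (auto simp: mult.assoc intro: cox_carrier_mult)
    qed
  qed
qed

text \<open>The products of \<open>w\<close> with the \<open>r + 1\<close> monomials of degree
  \<open>r\<close> in \<open>x\<close> and \<open>y\<close> lie in one graded piece; their
  dependence modulo \<open>I\<close> is the polynomial that annihilates \<open>w\<close>.\<close>

lemma eigenvalue_exists:
  assumes x: "x \<in> cox_piece k n d" and y: "y \<in> cox_piece k n d"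
    and F: "F = y * F'" and F': "F' \<in> carrier (cox_ring k n)" and w: "good F w"
  shows "\<exists>h c. h \<in> carrier (cox_ring k n) \<and> good F (w * h) \<and> w * h * (x - cst c * y) \<in> I"
proof -
  obtain u where u: "w \<in> cox_piece k n u" using w by (auto simp: good_def)
  have "w * (y ^ (r - p) * x ^ p) \<in> cox_piece k n (\<lambda>i. u i + int r * d i)" if "p \<le> r" for p
  proof -
    have "int (r - p) * d i + int p * d i = int r * d i" for i
      using that by (simp add: of_nat_diff algebra_simps)
    then show ?thesis
      using cox_piece_mult[OF u cox_piece_mult[OF cox_piece_power[OF y] cox_piece_power[OF x]], of "r -
          p" p] by simp
  qed
  note pc = this
  have "\<exists>c. (\<exists>p\<le>r. c p \<noteq> 0) \<and>
      (\<Sum>p\<le>r. cscale (c p) (w * (y ^ (r - p) * x ^ p))) \<in> I \<inter> cox_piece k n (\<lambda>i. u i + int r * d i)"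
    by (rule dependent_modulo[OF subspace_I_piece Int_lower2 codim]) (rule pc)
  then obtain c where cc: "(\<exists>p\<le>r. c p \<noteq> 0) \<and>
      (\<Sum>p\<le>r. cscale (c p) (w * (y ^ (r - p) * x ^ p))) \<in> I \<inter> cox_piece k n (\<lambda>i. u i + int r * d i)"
    by (elim exE) (rule that)
  note c = cc[THEN conjunct1] IntD1[OF cc[THEN conjunct2]]
  define p where "p = (\<Sum>q\<le>r. monom (c q) q)"
  have cp: "coeff p q = c q" if "q \<le> r" for q
    using that by (simp add: p_def coeff_sum)
  have "p \<noteq> 0" using c(1) cp by force
  moreover have "degree p \<le> r"
    unfolding p_def by (intro degree_sum_le) (auto intro: order_trans[OF degree_monom_le])
  moreover have "w * bform r p x y \<in> I"
  proof -
    have "w * bform r p x y = (\<Sum>p\<le>r. cscale (c p) (w * (y ^ (r - p) * x ^ p)))"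
      unfolding bform_def sum_distrib_left by (intro sum.cong refl) (simp add: cp cscale_cst ac_simps)
    then show ?thesis using c(2) by simp
  qed
  ultimately show ?thesis using eigenvalue[OF x y F F' _ _ w] by blast
qed

text \<open>The elements that multiply \<open>F\<close> into \<open>I\<close> form an ideal. If it
  contained all monomials of degree \<open>(1, ..., 1)\<close>, it would contain the irrelevant
  ideal, and saturation would put \<open>F\<close> into \<open>I\<close>.\<close>

lemma saturated_monomial:
  assumes "F \<in> carrier (cox_ring k n)" "F \<notin> I"
  shows "\<exists>m\<in>cox_monos_deg k n (\<lambda>_. 1). F * single m 1 \<notin> I"
proof (rule ccontr)
  assume np: "\<not> ?thesis"
  define K where "K = {b \<in> carrier (cox_ring k n). F * b \<in> I}"
  have "ideal K (cox_ring k n)"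
  proof (rule cox_idealI)
    show "0 \<in> K" using cox_ideal_0[OF ideal_I] by (simp add: K_def)
    show "a + b \<in> K" if "a \<in> K" "b \<in> K" for a b
      using that by (auto simp: K_def ring_distribs intro: cox_carrier_add I_add)
    show "c * a \<in> K" if "c \<in> carrier (cox_ring k n)" "a \<in> K" for a c
      using that I_mult[of c "F * a"] by (auto simp: K_def ac_simps intro: cox_carrier_mult)
  qed (auto simp: K_def)
  moreover have "cox_piece k n (\<lambda>_. 1) \<subseteq> K"
  proof
    fix p assume p: "p \<in> cox_piece k n (\<lambda>_. 1)"
    have "F * p = (\<Sum>m\<in>cox_monos_deg k n (\<lambda>_. 1). F * single m (lookup p m))"
      using cox_piece_expand[OF p] by (metis sum_distrib_left)
    also have "\<dots> = (\<Sum>m\<in>cox_monos_deg k n (\<lambda>_. 1). cst (lookup p m) * (F * single m 1))"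
    proof (intro sum.cong refl)
      fix m
      have "single m (lookup p m) = cst (lookup p m) * single m 1"
        by (simp add: cst_def mult_single)
      then show "F * single m (lookup p m) = cst (lookup p m) * (F * single m 1)"
        by (simp only: ac_simps)
    qed
    also have "\<dots> \<in> I" by (rule I_sum, rule I_mult[OF cst_carrier]) (use np in blast)
    finally show "p \<in> K" using p cox_piece_carrier by (auto simp: K_def)
  qed
  ultimately have "irrelevant_ideal k n \<subseteq> K"
    unfolding irrelevant_ideal_def by (rule ring.genideal_minimal[OF ring_cox_ring])
  then have "F \<in> colon k n I (irrelevant_ideal k n)"
    using assms(1) by (auto simp: colon_def K_def)
  then show False using sat assms(2) by (simp add: saturated_def)
qed

text \<open>The variables are treated one at a time. Relations found earlier persist, because
  \<open>w\<close> is only multiplied further.\<close>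

lemma eigenvalues_exist:
  assumes l: "\<And>i. i \<in> {1..k} \<Longrightarrow> (i, l i) \<in> cox_vars k n"
    and F: "\<And>i. i \<in> {1..k} \<Longrightarrow> \<exists>F'\<in>carrier (cox_ring k n). F = cox_var (i, l i) * F'"
    and T: "finite T" "T \<subseteq> cox_vars k n" and w: "good F w0"
  shows "\<exists>w x. good F w \<and> (\<forall>v\<in>T. w * (cox_var v - cst (x v) * cox_var (fst v, l (fst v))) \<in> I)"
  using T
proof (induction T rule: finite_induct)
  case empty
  then show ?case using w by blast
next
  case (insert v T)
  then obtain w x where w: "good F w" and x: "\<And>v. v \<in> T \<Longrightarrow> w * (cox_var v - cst (x v) * cox_var (fst v, l
      (fst v))) \<in> I"
    by auto
  have v: "v \<in> cox_vars k n" using insert.prems by auto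
  then have i: "fst v \<in> {1..k}" by (auto simp: cox_vars_def)
  let ?d = "\<lambda>i'. if i' = fst v then 1 else (0::int)"
  have px: "cox_var v \<in> cox_piece k n ?d" using cox_var_piece[of "fst v" "snd v"] v by simp
  have py: "cox_var (fst v, l (fst v)) \<in> cox_piece k n ?d" by (rule cox_var_piece[OF l[OF i]])
  obtain F' where F': "F' \<in> carrier (cox_ring k n)" "F = cox_var (fst v, l (fst v)) * F'" using F[OF i] by blast
  from eigenvalue_exists[OF px py F'(2,1) w] obtain h c where h: "h \<in> carrier (cox_ring k n)"
    "good F (w * h)" "w * h * (cox_var v - cst c * cox_var (fst v, l (fst v))) \<in> I" by blast
  have "w * h * (cox_var v' - cst ((x(v := c)) v') * cox_var (fst v', l (fst v'))) \<in> I"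
      if v': "v' \<in> insert v T" for v'
  proof (cases "v' = v")
    case True then show ?thesis using h(3) by simp
  next
    case False
    then have "h * (w * (cox_var v' - cst (x v') * cox_var (fst v', l (fst v')))) \<in> I"
      using v' by (intro I_mult[OF h(1)] x) auto
    then show ?thesis using False by (simp add: ac_simps)
  qed
  then show ?case using h(2) by blast
qed

text \<open>Congruence modulo the annihilator of the class of \<open>w\<close>. It respects sums and
  products, so the relations for the variables extend to all polynomials.\<close>

definition congr_ann :: "cpoly \<Rightarrow> cpoly \<Rightarrow> cpoly \<Rightarrow> bool" where
  "congr_ann w f g \<longleftrightarrow> f \<in> carrier (cox_ring k n) \<and> g \<in> carrier (cox_ring k n) \<and> w * (f - g) \<in> I"

lemma congr_ann_refl: "f \<in> carrier (cox_ring k n) \<Longrightarrow> congr_ann w f f"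
  by (simp add: congr_ann_def cox_ideal_0[OF ideal_I])

lemma congr_ann_mult:
  assumes "congr_ann w f g" "congr_ann w f' g'"
  shows "congr_ann w (f * f') (g * g')"
proof -
  have "f' * (w * (f - g)) + g * (w * (f' - g')) \<in> I"
    by (intro I_add; rule I_mult) (use assms in \<open>auto simp: congr_ann_def\<close>)
  also have "f' * (w * (f - g)) + g * (w * (f' - g')) = w * (f * f' - g * g')"
    by (simp add: algebra_simps)
  finally show ?thesis using assms by (simp add: congr_ann_def cox_carrier_mult)
qed

lemma congr_ann_power: "congr_ann w f g \<Longrightarrow> congr_ann w (f ^ t) (g ^ t)"
  by (induction t) (auto intro: congr_ann_mult congr_ann_refl)

lemma congr_ann_prod: "(\<And>i. i \<in> A \<Longrightarrow> congr_ann w (f i) (g i)) \<Longrightarrow> congr_ann w (\<Prod>i\<in>A. f i) (\<Prod>i\<in>A. g i)"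
  by (induction A rule: infinite_finite_induct) (auto intro: congr_ann_mult congr_ann_refl)

lemma congr_ann_add:
  assumes "congr_ann w f g" "congr_ann w f' g'"
  shows "congr_ann w (f + f') (g + g')"
proof -
  have "w * (f - g) + w * (f' - g') \<in> I" using assms by (intro I_add) (auto simp: congr_ann_def)
  also have "w * (f - g) + w * (f' - g') = w * (f + f' - (g + g'))" by (simp add: algebra_simps)
  finally show ?thesis using assms by (simp add: congr_ann_def cox_carrier_add)
qed

lemma congr_ann_sum: "(\<And>i. i \<in> A \<Longrightarrow> congr_ann w (f i) (g i)) \<Longrightarrow> congr_ann w (\<Sum>i\<in>A. f i) (\<Sum>i\<in>A. g i)"
  by (induction A rule: infinite_finite_induct) (auto intro: congr_ann_add congr_ann_refl)

text \<open>On \<open>w\<close> each variable of the \<open>i\<close>-th factor acts as a multiple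
  of \<open>cox_var (i, l i)\<close>. All monomials of degree \<open>u\<close> thereby become
  multiples of one and the same monomial in these.\<close>

lemma congr_ann_poly_eval:
  assumes l: "\<And>i. i \<in> {1..k} \<Longrightarrow> (i, l i) \<in> cox_vars k n"
    and x: "\<And>v. v \<in> cox_vars k n \<Longrightarrow> congr_ann w (cox_var v) (cst (x v) * cox_var (fst v, l (fst v)))"
    and G: "G \<in> cox_piece k n u"
  shows "congr_ann w G (cst (poly_eval G x) * (\<Prod>i=1..k. cox_var (i, l i) ^ nat (u i)))"
proof -
  let ?Y = "\<Prod>i=1..k. cox_var (i, l i) ^ nat (u i)"
  have mono: "congr_ann w (single m 1) (cst (mon m x) * ?Y)" if m: "m \<in> cox_monos_deg k n u" for m
  proof -
    have km: "keys m \<subseteq> cox_vars k n" by (rule cox_monos_deg_keys[OF m])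
    have "(\<Prod>v\<in>keys m. cox_var (fst v, l (fst v)) ^ lookup m v) =
       (\<Prod>v\<in>cox_vars k n. cox_var (fst v, l (fst v)) ^ lookup m v)"
      by (rule prod.mono_neutral_left[OF finite_cox_vars km]) (auto simp: in_keys_iff)
    also have "\<dots> = (\<Prod>i=1..k. \<Prod>l'\<le>n i. cox_var (i, l i) ^ lookup m (i, l'))"
      unfolding cox_vars_def by (subst prod.Sigma) (auto simp: case_prod_unfold)
    also have "\<dots> = ?Y"
      by (intro prod.cong refl) (simp add: cox_monos_deg_sum[OF m] flip: power_sum)
    finally have Y: "(\<Prod>v\<in>keys m. cox_var (fst v, l (fst v)) ^ lookup m v) = ?Y" .
    have "congr_ann w (\<Prod>v\<in>keys m. cox_var v ^ lookup m v)
       (\<Prod>v\<in>keys m. (cst (x v) * cox_var (fst v, l (fst v))) ^ lookup m v)"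
      using km by (intro congr_ann_prod congr_ann_power x) auto
    also have "(\<Prod>v\<in>keys m. (cst (x v) * cox_var (fst v, l (fst v))) ^ lookup m v) = cst (mon m x) * ?Y"
      unfolding power_mult_distrib prod.distrib Y by (simp add: mon_def cst_prod cst_power)
    finally show ?thesis by (simp only: single_eq_prod_cox_var)
  qed
  have "congr_ann w (\<Sum>m\<in>cox_monos_deg k n u. cst (lookup G m) * single m 1)
      (\<Sum>m\<in>cox_monos_deg k n u. cst (lookup G m) * (cst (mon m x) * ?Y))"
    by (intro congr_ann_sum congr_ann_mult congr_ann_refl mono) auto
  also have "(\<Sum>m\<in>cox_monos_deg k n u. cst (lookup G m) * single m 1) = G"
    using cox_piece_expand[OF G] by (simp add: cst_def mult_single)
  also have "(\<Sum>m\<in>cox_monos_deg k n u. cst (lookup G m) * (cst (mon m x) * ?Y)) = cst (poly_eval G x) * ?Y"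
    unfolding cox_piece_poly_eval[OF G] cst_sum cst_mult sum_distrib_right by (simp only: mult.assoc)
  finally show ?thesis .
qed

definition zeros :: "(nat \<times> nat \<Rightarrow> complex) set" where
  "zeros = {x \<in> hom_coords k n. \<forall>u. \<forall>G\<in>I \<inter> cox_piece k n u. poly_eval G x = 0}"

text \<open>Saturation supplies a monomial \<open>m\<close> that contains a variable
  \<open>(i, l i)\<close> of every factor. These are the dehomogenising coordinates; since they
  divide \<open>F1\<close>, multiplying by them never sends a good element into \<open>I\<close>.
  The simultaneous eigenvalues are the coordinates of the zero.\<close>

lemma nullstellensatz:
  assumes F: "F \<in> cox_piece k n u" "F \<notin> I"
  shows "\<exists>x\<in>zeros. poly_eval F x \<noteq> 0"
proof -
  have Fc: "F \<in> carrier (cox_ring k n)" using F cox_piece_carrier by blast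
  obtain m where m: "m \<in> cox_monos_deg k n (\<lambda>_. 1)" "F * single m 1 \<notin> I"
    using saturated_monomial[OF Fc F(2)] by blast
  define F1 where "F1 = F * single m 1"
  have "\<exists>l\<le>n i. lookup m (i, l) \<noteq> 0" if "i \<in> {1..k}" for i
  proof (rule ccontr)
    assume "\<not> ?thesis"
    then have "(\<Sum>l\<le>n i. lookup m (i, l)) = 0" by simp
    then show False using cox_monos_deg_sum[OF m(1) that] by simp
  qed
  then have "\<forall>i\<in>{1..k}. \<exists>l. l \<le> n i \<and> lookup m (i, l) \<noteq> 0" by blast
  from bchoice[OF this] obtain l where ll: "\<And>i. i \<in> {1..k} \<Longrightarrow> l i \<le> n i \<and> lookup m (i, l i) \<noteq> 0"
    by blast
  have l: "(i, l i) \<in> cox_vars k n" if "i \<in> {1..k}" for i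
    using ll[OF that] that by (simp add: cox_vars_def)
  have div: "\<exists>F'\<in>carrier (cox_ring k n). F1 = cox_var (i, l i) * F'" if i: "i \<in> {1..k}" for i
  proof -
    define m' where "m' = m - single (i, l i) 1"
    have mm: "m = single (i, l i) 1 + m'"
      by (rule poly_mapping_eqI)
        (use ll[OF i] in \<open>auto simp: m'_def lookup_add lookup_minus lookup_single when_def\<close>)
    have "keys m' \<subseteq> keys m"
      by (auto simp: m'_def in_keys_iff lookup_minus)
    then have "m' \<in> cox_monos k n" using cox_monos_deg_keys[OF m(1)] by (auto simp: cox_monos_def)
    then have "F * single m' 1 \<in> carrier (cox_ring k n)"
      by (intro cox_carrier_mult Fc cox_carrier_single)
    moreover have "F1 = cox_var (i, l i) * (F * single m' 1)"
    proof -
      have "single m 1 = cox_var (i, l i) * single m' 1"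
        unfolding cox_var_def mult_single mm[symmetric] by simp
      then show ?thesis by (simp add: F1_def ac_simps)
    qed
    ultimately show ?thesis by blast
  qed
  have F1p: "F1 \<in> cox_piece k n (\<lambda>i. u i + 1)"
    unfolding F1_def by (rule cox_piece_mult[OF F(1) cox_piece_single[OF m(1)]])
  have "good F1 F1"
    unfolding good_def using m(2) F1p by (auto simp: F1_def intro!: bexI[of _ 1])
  from eigenvalues_exist[of l F1 "cox_vars k n" F1, OF l div finite_cox_vars order_refl this]
  obtain w x where w: "good F1 w"
    and x: "\<And>v. v \<in> cox_vars k n \<Longrightarrow> w * (cox_var v - cst (x v) * cox_var (fst v, l (fst v))) \<in> I" by blast
  have wc: "w \<in> carrier (cox_ring k n)" by (rule good_carrier[OF w])
  have cx: "congr_ann w (cox_var v) (cst (x v) * cox_var (fst v, l (fst v)))" if "v \<in> cox_vars k n" for v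
    using x[OF that] l[of "fst v"] that
    by (auto simp: congr_ann_def cox_vars_def intro!: cox_var_carrier cox_carrier_mult)
  \<comment> \<open>Here a dehomogenising variable is compared with itself: an eigenvalue other than
    one would put \<open>w * cox_var (i, l i)\<close> into \<open>I\<close>.\<close>
  have xl: "x (i, l i) = 1" if i: "i \<in> {1..k}" for i
  proof (rule ccontr)
    assume "x (i, l i) \<noteq> 1"
    then have ne: "1 - x (i, l i) \<noteq> 0" by simp
    have "w * (cox_var (i, l i) - cst (x (i, l i)) * cox_var (i, l i)) =
        cst (1 - x (i, l i)) * (w * cox_var (i, l i))"
      by (simp add: cst_diff algebra_simps)
    then have "w * cox_var (i, l i) \<in> I" using x[OF l[OF i]] cst_mult_I[OF _ ne] by simp
    moreover obtain F' where "F' \<in> carrier (cox_ring k n)" "F1 = cox_var (i, l i) * F'" using div[OF i] by blast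
    then have "good F1 (w * cox_var (i, l i))"
      using good_mult_divisor[OF w _ _ cox_var_piece[OF l[OF i]]] by blast
    ultimately show False by (simp add: good_def)
  qed
  have Y: "good F1 (w * (\<Prod>i\<in>A. cox_var (i, l i) ^ a i))" if "finite A" "A \<subseteq> {1..k}" for A and a :: "nat \<Rightarrow> nat"
    using that
  proof (induction A rule: finite_induct)
    case empty
    then show ?case using w by simp
  next
    case (insert i A)
    have i: "i \<in> {1..k}" using insert.prems by simp
    obtain F' where F': "F1 = cox_var (i, l i) * F'" "F' \<in> carrier (cox_ring k n)" using div[OF i] by blast
    have pow: "good F1 (w' * cox_var (i, l i) ^ t)" if "good F1 w'" for w' t
    proof (induction t)
      case 0
      then show ?case using that by simp
    next
      case (Suc t)
      show ?case using good_mult_divisor[OF Suc.IH F' cox_var_piece[OF l[OF i]]] by (simp add: ac_simps)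
    qed
    have "good F1 (w * (\<Prod>i\<in>A. cox_var (i, l i) ^ a i))" using insert by simp
    from pow[OF this, of "a i"] show ?case using insert.hyps by (simp add: ac_simps)
  qed
  have nz: "w * (\<Prod>i=1..k. cox_var (i, l i) ^ a i) \<notin> I" for a
    using Y[of "{1..k}" a] by (simp add: good_def)
  \<comment> \<open>Modulo \<open>I\<close>, \<open>w * G\<close> is the value of \<open>G\<close>
    times the product of \<open>w\<close> with a monomial in the dehomogenising variables. That
    product is not in \<open>I\<close>, so the value is zero.\<close>
  have ev: "poly_eval G x = 0" if G: "G \<in> cox_piece k n u'" and wG: "w * G \<in> I" for G u'
  proof (rule ccontr)
    assume ne: "poly_eval G x \<noteq> 0"
    let ?Y = "\<Prod>i=1..k. cox_var (i, l i) ^ nat (u' i)"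
    have "w * (G - cst (poly_eval G x) * ?Y) \<in> I"
      using congr_ann_poly_eval[OF l cx G] by (simp add: congr_ann_def)
    then have "w * G - w * (G - cst (poly_eval G x) * ?Y) \<in> I" by (rule I_diff[OF wG])
    moreover have "w * G - w * (G - cst (poly_eval G x) * ?Y) = cst (poly_eval G x) * (w * ?Y)"
      by (simp add: algebra_simps)
    ultimately have "w * ?Y \<in> I" using cst_mult_I[OF _ ne] by simp
    with nz[of "\<lambda>i. nat (u' i)"] show False by contradiction
  qed
  have "x \<in> zeros"
    unfolding zeros_def hom_coords_def
  proof (intro CollectI conjI ballI allI)
    show "\<exists>l\<le>n i. x (i, l) \<noteq> 0" if "i \<in> {1..k}" for i
      using xl[OF that] ll[OF that] by (intro exI[of _ "l i"]) simp
    show "poly_eval G x = 0" if "G \<in> I \<inter> cox_piece k n u" for u G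
      using that ev[of G u] I_mult[OF wc, of G] by simp
  qed
  \<comment> \<open>If the value were zero, \<open>w * F1\<close> would be in \<open>I\<close>,
    hence also \<open>w * w\<close>, as \<open>w\<close> is a multiple of \<open>F1\<close>;
    radicality then gives a contradiction.\<close>
  moreover have "poly_eval F1 x \<noteq> 0"
  proof
    assume 0: "poly_eval F1 x = 0"
    have "w * F1 \<in> I"
      using congr_ann_poly_eval[OF l cx F1p] 0 by (simp add: congr_ann_def)
    moreover obtain h where h: "h \<in> carrier (cox_ring k n)" "w = F1 * h" using w by (auto simp: good_def)
    ultimately have "h * (w * F1) \<in> I" using I_mult[OF h(1)] by blast
    then have "w * w \<in> I" using h(2) by (simp add: ac_simps)
    then have "w \<in> I" by (rule square_I[OF wc])
    then show False using w by (simp add: good_def)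
  qed
  then have "poly_eval F x \<noteq> 0" by (auto simp: F1_def poly_eval_mult)
  ultimately show ?thesis by blast
qed

end

section \<open>Double points and semicontinuity\<close>

lemma cox_monos_deg_cong: "(\<And>i. i \<in> {1..k} \<Longrightarrow> u i = u' i) \<Longrightarrow> cox_monos_deg k n u = cox_monos_deg k n u'"
  by (auto simp: cox_monos_deg_def has_mdeg_def)

lemma cox_piece_cong: "(\<And>i. i \<in> {1..k} \<Longrightarrow> u i = u' i) \<Longrightarrow> cox_piece k n u = cox_piece k n u'"
  unfolding cox_piece_def using cox_monos_deg_cong[of k u u' n] by simp

text \<open>In each factor the monomial is a power of a single variable that is nonzero at
  \<open>y\<close>.\<close>

lemma exists_nonvanishing_mono:
  assumes y: "y \<in> hom_coords k n" and u: "\<And>i. i \<in> {1..k} \<Longrightarrow> u i \<ge> 0"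
  shows "\<exists>m\<in>cox_monos_deg k n u. mon m y \<noteq> 0"
proof -
  have "\<forall>i\<in>{1..k}. \<exists>l. l \<le> n i \<and> y (i, l) \<noteq> 0" using y by (auto simp: hom_coords_def)
  from bchoice[OF this] obtain l where l: "\<And>i. i \<in> {1..k} \<Longrightarrow> l i \<le> n i \<and> y (i, l i) \<noteq> 0" by blast
  define m where "m = (\<Sum>i=1..k. single (i, l i) (nat (u i)))"
  have lk: "lookup m (i, l') = (if i \<in> {1..k} \<and> l' = l i then nat (u i) else 0)" for i l'
  proof -
    have "lookup m (i, l') = (\<Sum>i'=1..k. if i' = i then (if l' = l i then nat (u i) else 0) else 0)"
      unfolding m_def lookup_sum by (intro sum.cong refl) (auto simp: lookup_single when_def)
    then show ?thesis by (simp add: sum.delta)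
  qed
  have keys: "i \<in> {1..k} \<and> l' = l i" if "(i, l') \<in> keys m" for i l'
    using that lk[of i l'] by (auto simp: in_keys_iff split: if_splits)
  have "m \<in> cox_monos k n"
    unfolding cox_monos_def cox_vars_def using keys l by fastforce
  moreover have "has_mdeg k n m u"
    unfolding has_mdeg_def
  proof
    fix i assume i: "i \<in> {1..k}"
    have "(\<Sum>l'\<le>n i. lookup m (i, l')) = (\<Sum>l'\<le>n i. if l' = l i then nat (u i) else 0)"
      by (intro sum.cong refl) (simp add: lk i[simplified])
    also have "\<dots> = nat (u i)" using l[OF i] by (simp add: sum.delta)
    finally show "int (\<Sum>l'\<le>n i. lookup m (i, l')) = u i" using u[OF i] by simp
  qed
  moreover have "mon m y \<noteq> 0"
    unfolding mon_eq_0_iff using keys l by fastforce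
  ultimately show ?thesis unfolding cox_monos_deg_def by blast
qed

lemma functional_eval:
  assumes "\<And>m. m \<in> cox_monos_deg k n u \<Longrightarrow> (\<Sum>s\<in>A. c s * mon m (x s)) = 0" "p \<in> cox_piece k n u"
  shows "(\<Sum>s\<in>A. c s * poly_eval p (x s)) = 0"
proof -
  have "(\<Sum>s\<in>A. c s * poly_eval p (x s)) = (\<Sum>s\<in>A. \<Sum>m\<in>cox_monos_deg k n u. lookup p m * (c s * mon m (x s)))"
    by (intro sum.cong refl) (simp add: cox_piece_poly_eval[OF assms(2)] sum_distrib_left ac_simps)
  also have "\<dots> = (\<Sum>m\<in>cox_monos_deg k n u. lookup p m * (\<Sum>s\<in>A. c s * mon m (x s)))"
    by (subst sum.swap) (simp add: sum_distrib_left)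
  also have "\<dots> = 0" by (simp add: assms(1))
  finally show ?thesis .
qed

lemma cox_piece_poly_eval':
  "p \<in> cox_piece k n u \<Longrightarrow> (\<Sum>m\<in>cox_monos_deg k n u. mon m y * lookup p m) = poly_eval p y"
  by (simp add: cox_piece_poly_eval mult.commute)

lemma mon_deriv_superset:
  assumes "finite A" "keys m \<subseteq> A"
  shows "mon_deriv v m y = of_nat (lookup m v) * y v ^ (lookup m v - 1) *
     (\<Prod>w\<in>A - {v}. y w ^ lookup m w)"
proof -
  have "(\<Prod>w\<in>keys m - {v}. y w ^ lookup m w) = (\<Prod>w\<in>A - {v}. y w ^ lookup m w)"
  proof (rule prod.mono_neutral_left)
    show "\<forall>w\<in>A - {v} - (keys m - {v}). y w ^ lookup m w = 1"
    proof
      fix w assume "w \<in> A - {v} - (keys m - {v})"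
      then have "lookup m w = 0" by (auto simp: in_keys_iff)
      then show "y w ^ lookup m w = 1" by simp
    qed
  qed (use assms in auto)
  then show ?thesis by (simp add: mon_deriv_def)
qed

lemma mon_deriv_add:
  assumes "v \<notin> keys m'"
  shows "mon_deriv v (m + m') y = mon_deriv v m y * mon m' y"
proof -
  define A where "A = keys m \<union> keys m'"
  have A: "finite A" "keys m \<subseteq> A" "keys m' \<subseteq> A" "keys (m + m') \<subseteq> A"
    using Poly_Mapping.keys_add[of m m'] by (auto simp: A_def)
  have v: "lookup m' v = 0" using assms by (simp add: in_keys_iff)
  have "mon m' y = (\<Prod>w\<in>A - {v}. y w ^ lookup m' w)"
    by (rule mon_superset) (use A assms in auto)
  then show ?thesis
    unfolding mon_deriv_superset[OF A(1,2)] mon_deriv_superset[OF A(1,4)]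
    by (simp add: lookup_add v power_add prod.distrib)
qed

lemma tan_fun_indep_mono:
  assumes jk: "j \<le> k" and u: "\<And>i. i \<in> {1..j} \<Longrightarrow> d i \<le> u i" "\<And>i. i \<in> {j<..k} \<Longrightarrow> u i = d i"
    and y: "\<And>s i. y s (i, 0) = 1"
    and ind: "indep_on (tan_index r j n) (cox_monos_deg k n d) (tan_fun y)"
  shows "indep_on (tan_index r j n) (cox_monos_deg k n u) (tan_fun y)"
proof (rule indep_onI)
  fix x q
  assume q: "q \<in> tan_index r j n"
    and eq: "\<And>m. m \<in> cox_monos_deg k n u \<Longrightarrow> (\<Sum>q\<in>tan_index r j n. x q * tan_fun y q m) = 0"
  have "\<exists>g\<in>cox_monos_deg k n (\<lambda>i. u i - d i). mon g (\<lambda>v. if snd v = 0 then 1 else 0) \<noteq> 0"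
  proof (rule exists_nonvanishing_mono)
    show "u i - d i \<ge> 0" if "i \<in> {1..k}" for i
      using u(1)[of i] u(2)[of i] that by (cases "i \<le> j") auto
  qed (auto simp: hom_coords_def)
  then obtain g where g: "g \<in> cox_monos_deg k n (\<lambda>i. u i - d i)" "mon g (\<lambda>v. if snd v = 0 then 1 else 0) \<noteq> 0"
    by blast
  have gk: "snd v = 0" if "v \<in> keys g" for v
    using g(2) that unfolding mon_eq_0_iff by (auto split: if_splits)
  have gy: "mon g (y s) = 1" for s
    unfolding mon_def using gk y by (intro prod.neutral ballI) (metis power_one prod.collapse)
  have tf: "tan_fun y q (m + g) = tan_fun y q m" if "q \<in> tan_index r j n" for q m
  proof -
    have "snd q = (0, 0) \<or> snd q \<notin> keys g"
      using that gk by (fastforce simp: tan_index_def tan_dirs_def)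
    then show ?thesis using gy
      by (auto simp: tan_fun_def mon_add mon_deriv_add)
  qed
  show "x q = 0"
  proof (rule indep_onD[OF ind _ q])
    fix m assume "m \<in> cox_monos_deg k n d"
    then have "m + g \<in> cox_monos_deg k n u" using cox_monos_deg_add[OF _ g(1), of m d] by simp
    from eq[OF this] show "(\<Sum>q\<in>tan_index r j n. x q * tan_fun y q m) = 0" by (simp add: tf)
  qed
qed

lemma poly_eval_has_derivative:
  "((\<lambda>t. poly_eval p (\<lambda>w. y w + t * (if w = v then 1 else 0))) has_field_derivative
    (\<Sum>m\<in>keys p. lookup p m * mon_deriv v m y)) (at 0)"
  unfolding poly_eval_eq
proof (rule DERIV_sum)
  fix m
  have "(\<Sum>w\<in>keys m. (if w = v then 1 else 0) * mon_deriv w m y) = (\<Sum>w\<in>keys m.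
      if w = v then mon_deriv w m y else 0)"
    by (intro sum.cong) auto
  also have "\<dots> = mon_deriv v m y" by (auto simp: sum.delta mon_deriv_eq_0)
  finally have "((\<lambda>t. mon m (\<lambda>w. y w + t * (if w = v then 1 else 0))) has_field_derivative mon_deriv v m
      y) (at 0)"
    using mon_has_derivative[of m y "\<lambda>w. if w = v then 1 else 0"] by simp
  then show "((\<lambda>t. lookup p m * mon m (\<lambda>w. y w + t * (if w = v then 1 else 0))) has_field_derivative
      lookup p m * mon_deriv v m y) (at 0)"
    by (rule DERIV_cmult)
qed

text \<open>Leibniz rule: each term of the derivative keeps one of the two vanishing
  factors.\<close>

lemma product_vanishes_doubly:
  assumes fg: "f * g \<in> cox_piece k n u"
    and f: "\<And>s. s < r \<Longrightarrow> poly_eval f (y s) = 0" and g: "\<And>s. s < r \<Longrightarrow> poly_eval g (y s) = 0"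
    and q: "q \<in> tan_index r j n"
  shows "(\<Sum>m\<in>cox_monos_deg k n u. tan_fun y q m * lookup (f * g) m) = 0"
proof -
  obtain s v where sv: "q = (s, v)" "s < r" using q by (auto simp: tan_index_def)
  show ?thesis
  proof (cases "v = (0, 0)")
    case True
    then show ?thesis using cox_piece_poly_eval'[OF fg, of "y s"] f[OF sv(2)] sv(1)
      by (simp add: tan_fun_def poly_eval_mult)
  next
    case False
    let ?L = "\<lambda>t w. y s w + t * (if w = v then 1 else 0)"
    note f' = poly_eval_has_derivative[of f "y s" v] and g' = poly_eval_has_derivative[of g "y s" v]
    have "((\<lambda>t. poly_eval (f * g) (?L t)) has_field_derivative 0) (at 0)"
      using DERIV_mult[OF f' g'] f[OF sv(2)] g[OF sv(2)] by (simp add: poly_eval_mult)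
    from DERIV_unique[OF this poly_eval_has_derivative]
    have "(\<Sum>m\<in>keys (f * g). lookup (f * g) m * mon_deriv v m (y s)) = 0" by simp
    moreover have "(\<Sum>m\<in>keys (f * g). lookup (f * g) m * mon_deriv v m (y s)) =
        (\<Sum>m\<in>cox_monos_deg k n u. lookup (f * g) m * mon_deriv v m (y s))"
      by (rule sum.mono_neutral_left)
        (use fg in \<open>auto simp: finite_cox_monos_deg cox_piece_def in_keys_iff\<close>)
    ultimately show ?thesis using False sv(1) by (simp add: tan_fun_def mult.commute)
  qed
qed

lemma lookup_mult_superset:
  fixes f g :: cpoly
  assumes "finite A" "keys f \<subseteq> A" "finite B" "keys g \<subseteq> B"
  shows "lookup (f * g) m =
    (\<Sum>a\<in>A. \<Sum>b\<in>B. if a + b = m then lookup f a * lookup g b else 0)"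
proof -
  have "lookup (f * g) m = (\<Sum>a\<in>keys f. \<Sum>b\<in>keys g.
      if a + b = m then lookup f a * lookup g b else 0)"
    unfolding poly_mapping_mult_sum[of f g] lookup_sum
    by (intro sum.cong refl) (simp add: lookup_single when_def)
  also have "\<dots> = (\<Sum>a\<in>keys f. \<Sum>b\<in>B. if a + b = m then lookup f a * lookup g b else 0)"
    by (intro sum.cong refl sum.mono_neutral_left) (use assms in \<open>auto simp: in_keys_iff\<close>)
  also have "\<dots> = (\<Sum>a\<in>A. \<Sum>b\<in>B. if a + b = m then lookup f a * lookup g b else 0)"
    by (rule sum.mono_neutral_left) (use assms in \<open>auto simp: in_keys_iff intro!: sum.neutral\<close>)
  finally show ?thesis .
qed

text \<open>The supports are bounded uniformly in \<open>t\<close>, so a coefficient of the product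
  is one fixed finite sum of products of coefficients.\<close>

lemma fun_alg_lookup_mult:
  assumes F: "fun_alg F" and fin: "finite A" "finite B"
    and f: "\<And>t. keys (f t) \<subseteq> A" "\<And>m. (\<lambda>t. lookup (f t) m) \<in> F"
    and g: "\<And>t. keys (g t) \<subseteq> B" "\<And>m. (\<lambda>t. lookup (g t) m) \<in> F"
  shows "(\<lambda>t. lookup (f t * g t :: cpoly) m) \<in> F"
proof -
  have "(\<lambda>t. if a + b = m then lookup (f t) a * lookup (g t) b else 0) \<in> F" for a b
    using fun_alg_mult[OF F f(2) g(2), of a b] fun_alg_const[OF F, of 0] by (cases "a + b = m") simp_all
  then show ?thesis
    unfolding lookup_mult_superset[OF fin(1) f(1) fin(2) g(1)]
    by (intro fun_alg_sum[OF F])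
qed

section \<open>Homogeneous components and the square of an ideal\<close>

text \<open>Normalised to 0 outside \<open>{1..k}\<close>, so that monomials of the same multidegree
  have equal \<open>mdeg\<close> as functions.\<close>

definition mdeg :: "nat \<Rightarrow> (nat \<Rightarrow> nat) \<Rightarrow> mono \<Rightarrow> nat \<Rightarrow> int" where
  "mdeg k n m = (\<lambda>i. if i \<in> {1..k} then int (\<Sum>l\<le>n i. lookup m (i, l)) else 0)"

lemma has_mdeg_iff: "has_mdeg k n m u \<longleftrightarrow> (\<forall>i\<in>{1..k}. mdeg k n m i = u i)"
  by (auto simp: has_mdeg_def mdeg_def)

lemma lookup_mdeg_component:
  "lookup (mdeg_component k n u p) m = (if has_mdeg k n m u then lookup p m else 0)"
  unfolding mdeg_component_def lookup_sum
  by (auto simp: lookup_single when_def sum.delta in_keys_iff)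

lemma mdeg_component_piece:
  assumes "p \<in> carrier (cox_ring k n)"
  shows "mdeg_component k n u p \<in> cox_piece k n u"
proof -
  have "m \<in> cox_monos_deg k n u" if "m \<in> keys (mdeg_component k n u p)" for m
    using that assms by (auto simp: in_keys_iff lookup_mdeg_component cox_carrier_iff cox_monos_deg_def
        split: if_splits)
  then show ?thesis by (auto simp: cox_piece_def)
qed

lemma mdeg_component_id: "p \<in> cox_piece k n u \<Longrightarrow> mdeg_component k n u p = p"
  by (rule poly_mapping_eqI) (auto simp: lookup_mdeg_component cox_piece_def cox_monos_deg_def in_keys_iff)

lemma mdeg_component_add: "mdeg_component k n u (p + q) = mdeg_component k n u p + mdeg_component k n u q"
  by (rule poly_mapping_eqI) (auto simp: lookup_mdeg_component lookup_add)

lemma mdeg_component_sum: "mdeg_component k n u (\<Sum>i\<in>A. f i) = (\<Sum>i\<in>A. mdeg_component k n u (f i))"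
  by (rule poly_mapping_eqI) (auto simp: lookup_mdeg_component lookup_sum)

lemma mdeg_component_eq_0:
  assumes "p \<in> cox_piece k n a" "\<not> (\<forall>i\<in>{1..k}. a i = u i)"
  shows "mdeg_component k n u p = 0"
proof (rule poly_mapping_eqI)
  fix m
  have "lookup p m = 0" if "has_mdeg k n m u"
  proof (rule ccontr)
    assume "lookup p m \<noteq> 0"
    then have "has_mdeg k n m a" using assms(1) by (auto simp: cox_piece_def cox_monos_deg_def in_keys_iff)
    then show False using that assms(2) by (auto simp: has_mdeg_iff)
  qed
  then show "lookup (mdeg_component k n u p) m = lookup 0 m"
    by (simp add: lookup_mdeg_component)
qed

lemma sum_mdeg_components:
  "p = (\<Sum>a\<in>mdeg k n ` keys p. mdeg_component k n a p)"
proof (rule poly_mapping_eqI)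
  fix m
  have "has_mdeg k n m a \<longleftrightarrow> a = mdeg k n m" if "a \<in> mdeg k n ` keys p" for a
    using that by (auto simp: has_mdeg_iff mdeg_def fun_eq_iff)
  then have "lookup (\<Sum>a\<in>mdeg k n ` keys p. mdeg_component k n a p) m =
      (\<Sum>a\<in>mdeg k n ` keys p. if a = mdeg k n m then lookup p m else 0)"
    unfolding lookup_sum lookup_mdeg_component by (intro sum.cong refl) simp
  also have "\<dots> = lookup p m"
    by (auto simp: sum.delta in_keys_iff)
  finally show "lookup p m = lookup (\<Sum>a\<in>mdeg k n ` keys p. mdeg_component k n a p) m" ..
qed

definition hom_products :: "nat \<Rightarrow> (nat \<Rightarrow> nat) \<Rightarrow> cpoly set \<Rightarrow> (nat \<Rightarrow> int) \<Rightarrow> cpoly set" where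
  "hom_products k n J u = {f * g | f g a b. f \<in> J \<inter> cox_piece k n a \<and> g \<in> J \<inter> cox_piece k n b \<and>
     (\<forall>i\<in>{1..k}. a i + b i = u i)}"

lemma hom_products_piece: "hom_products k n J u \<subseteq> cox_piece k n u"
proof
  fix p assume "p \<in> hom_products k n J u"
  then obtain f g a b where fg: "p = f * g" "f \<in> cox_piece k n a" "g \<in> cox_piece k n b"
      "\<forall>i\<in>{1..k}. a i + b i = u i"
    by (auto simp: hom_products_def)
  then show "p \<in> cox_piece k n u"
    using cox_piece_mult[OF fg(2,3)] cox_piece_cong[of k "\<lambda>i. a i + b i" u n] by simp
qed

text \<open>Both factors are split into homogeneous components, which lie in \<open>J\<close> again;
  only products whose degrees add up to \<open>u\<close> contribute.\<close>

lemma square_component_span: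
  assumes J: "homogeneous_ideal k n J" and p: "p \<in> ideal_prod (cox_ring k n) J J"
  shows "mdeg_component k n u p \<in> cpoly.span (hom_products k n J u)"
  using p
proof (induction rule: ideal_prod.induct)
  case (prod f g)
  have idJ: "ideal J (cox_ring k n)" using J by (simp add: homogeneous_ideal_def)
  have comp: "mdeg_component k n a h \<in> J \<inter> cox_piece k n a" if "h \<in> J" for h a
    using J that mdeg_component_piece[OF cox_ideal_carrier[OF idJ that]] by (simp add: homogeneous_ideal_def)
  have "f * g = (\<Sum>a\<in>mdeg k n ` keys f. \<Sum>b\<in>mdeg k n ` keys g.
      mdeg_component k n a f * mdeg_component k n b g)"
    unfolding sum_product[symmetric]
    by (intro arg_cong2[of _ _ _ _ "(*)"] sum_mdeg_components)
  then have "mdeg_component k n u (f * g) = (\<Sum>a\<in>mdeg k n ` keys f. \<Sum>b\<in>mdeg k n ` keys g.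
      mdeg_component k n u (mdeg_component k n a f * mdeg_component k n b g))"
    by (simp add: mdeg_component_sum)
  also have "\<dots> \<in> cpoly.span (hom_products k n J u)"
  proof (intro cpoly.span_sum)
    fix a b
    let ?h = "mdeg_component k n a f * mdeg_component k n b g"
    have h: "?h \<in> cox_piece k n (\<lambda>i. a i + b i)"
      using comp[OF prod(1), of a] comp[OF prod(2), of b] by (auto intro: cox_piece_mult)
    show "mdeg_component k n u ?h \<in> cpoly.span (hom_products k n J u)"
    proof (cases "\<forall>i\<in>{1..k}. a i + b i = u i")
      case True
      then have "?h \<in> hom_products k n J u"
        unfolding hom_products_def using comp[OF prod(1), of a] comp[OF prod(2), of b] by blast
      moreover from this have "mdeg_component k n u ?h = ?h"
        using hom_products_piece mdeg_component_id by blast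
      ultimately show ?thesis by (simp add: cpoly.span_base)
    next
      case False
      then show ?thesis using mdeg_component_eq_0[OF h] by (simp add: cpoly.span_zero)
    qed
  qed
  finally show ?case by simp
next
  case (sum p q)
  then show ?case by (simp add: mdeg_component_add cpoly.span_add)
qed

section \<open>Zeros imposing independent conditions, and their deformation\<close>

context points_ideal
begin

lemma zerosD: "x \<in> zeros \<Longrightarrow> G \<in> I \<Longrightarrow> G \<in> cox_piece k n u \<Longrightarrow> poly_eval G x = 0"
  by (auto simp: zeros_def)

lemma zeros_hom_coords: "x \<in> zeros \<Longrightarrow> x \<in> hom_coords k n"
  by (simp add: zeros_def)

text \<open>Greedy choice: as long as fewer than \<open>r\<close> zeros are chosen, some form
  outside \<open>I\<close> vanishes at all of them, and the Nullstellensatz yields a zero where it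
  does not. Evaluating a relation at this form isolates the new coefficient.\<close>

lemma independent_zeros_exist:
  assumes card: "cpoly.dim (I \<inter> cox_piece k n d) + r \<le> card (cox_monos_deg k n d)" and q: "q \<le> r"
  shows "\<exists>x. (\<forall>s<q. x s \<in> zeros) \<and> indep_on {..<q} (cox_monos_deg k n d) (\<lambda>s m. mon m (x s))"
  using q
proof (induction q)
  case 0
  then show ?case by (simp add: indep_on_def)
next
  case (Suc q)
  then obtain x where x: "\<And>s. s < q \<Longrightarrow> x s \<in> zeros"
    and ind: "indep_on {..<q} (cox_monos_deg k n d) (\<lambda>s m. mon m (x s))" by auto
  have "cpoly.dim (I \<inter> cox_piece k n d) + card {..<q} < card (cox_monos_deg k n d)"
    using card Suc.prems by simp
  from orthogonal_outside[OF subspace_I_piece Int_lower2 finite_lessThan this, of "\<lambda>s m. mon m (x s)"]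
  obtain p where p: "p \<in> cox_piece k n d" "p \<notin> I"
    and orth: "\<And>s. s < q \<Longrightarrow> (\<Sum>m\<in>cox_monos_deg k n d. mon m (x s) * lookup p m) = 0" by auto
  obtain x' where x': "x' \<in> zeros" "poly_eval p x' \<noteq> 0" using nullstellensatz[OF p] by blast
  have px: "poly_eval p (x s) = 0" if "s < q" for s
    using orth[OF that] cox_piece_poly_eval'[OF p(1)] by simp
  have "indep_on {..<Suc q} (cox_monos_deg k n d) (\<lambda>s m. mon m ((x(q := x')) s))"
  proof (rule indep_onI)
    fix c s assume s: "s \<in> {..<Suc q}"
      and eq: "\<And>m. m \<in> cox_monos_deg k n d \<Longrightarrow> (\<Sum>s\<in>{..<Suc q}. c s * mon m ((x(q := x')) s)) = 0"
    have "(\<Sum>s\<in>{..<Suc q}. c s * poly_eval p ((x(q := x')) s)) = 0"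
      by (rule functional_eval[OF eq p(1)])
    moreover have "(\<Sum>s\<in>{..<q}. c s * poly_eval p ((x(q := x')) s)) = 0"
      by (intro sum.neutral ballI) (simp add: px)
    ultimately have cq: "c q = 0" using x'(2) by simp
    have "c s = 0" if "s \<in> {..<q}" for s
    proof (rule indep_onD[OF ind _ that])
      fix m assume "m \<in> cox_monos_deg k n d"
      from eq[OF this] have "(\<Sum>s\<in>{..<q}. c s * mon m ((x(q := x')) s)) = 0" by (simp add: cq)
      moreover have "(\<Sum>s\<in>{..<q}. c s * mon m ((x(q := x')) s)) = (\<Sum>s\<in>{..<q}. c s * mon m (x s))"
        by (intro sum.cong) auto
      ultimately show "(\<Sum>s\<in>{..<q}. c s * mon m (x s)) = 0" by simp
    qed
    then show "c s = 0" using s cq by (cases "s = q") auto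
  qed
  then show ?case using x x'(1) by (intro exI[of _ "x(q := x')"]) (auto simp: less_Suc_eq)
qed

text \<open>Otherwise some zero \<open>x'\<close> has nonzero value under \<open>F\<close>, and the
  \<open>r + 1\<close> zeros impose independent conditions in degree \<open>a + d\<close>, against
  the codimension bound. Multiples of \<open>F\<close> isolate the coefficient of \<open>x'\<close>;
  multiplying by a monomial of degree \<open>a\<close> reduces the others to independence in degree
  \<open>d\<close>.\<close>

lemma vanishing_in_ideal:
  assumes x: "\<And>s. s < r \<Longrightarrow> x s \<in> zeros" and d: "\<And>i. i \<in> {1..k} \<Longrightarrow> d i \<ge> 0"
    and ind: "indep_on {..<r} (cox_monos_deg k n d) (\<lambda>s m. mon m (x s))"
    and F: "F \<in> cox_piece k n a" and Fx: "\<And>s. s < r \<Longrightarrow> poly_eval F (x s) = 0"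
  shows "F \<in> I"
proof (rule ccontr)
  assume FI: "F \<notin> I"
  obtain x' where x': "x' \<in> zeros" "poly_eval F x' \<noteq> 0" using nullstellensatz[OF F FI] by blast
  have "F \<noteq> 0" using FI cox_ideal_0[OF ideal_I] by auto
  then obtain m0 where m0: "m0 \<in> cox_monos_deg k n a" using cox_piece_lookup_eq_0_iff[OF F] by blast
  have a: "a i \<ge> 0" if "i \<in> {1..k}" for i
  proof -
    have "has_mdeg k n m0 a" using m0 by (simp add: cox_monos_deg_def)
    then have "int (\<Sum>l\<le>n i. lookup m0 (i, l)) = a i" unfolding has_mdeg_def using that by blast
    then show ?thesis by (metis of_nat_0_le_iff)
  qed
  define y where "y = x(r := x')"
  have yr: "y r = x'" and ys: "\<And>s. s < r \<Longrightarrow> y s = x s" by (auto simp: y_def)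
  have yz: "y s \<in> zeros" if "s < Suc r" for s using that x x'(1) by (auto simp: y_def less_Suc_eq)
  let ?M = "cox_monos_deg k n (\<lambda>i. a i + d i)"
  have "indep_on {..<Suc r} ?M (\<lambda>s m. mon m (y s))"
  proof (rule indep_onI)
    fix c s assume s: "s \<in> {..<Suc r}"
      and eq: "\<And>m. m \<in> ?M \<Longrightarrow> (\<Sum>s\<in>{..<Suc r}. c s * mon m (y s)) = 0"
    obtain g where g: "g \<in> cox_monos_deg k n d" "mon g x' \<noteq> 0"
      using exists_nonvanishing_mono[OF zeros_hom_coords[OF x'(1)], of d] d by blast
    have "F * single g 1 \<in> cox_piece k n (\<lambda>i. a i + d i)"
      by (rule cox_piece_mult[OF F cox_piece_single[OF g(1)]])
    from functional_eval[OF eq this]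
    have "(\<Sum>s\<in>{..<Suc r}. c s * (poly_eval F (y s) * mon g (y s))) = 0" by (simp add: poly_eval_mult)
    moreover have "(\<Sum>s\<in>{..<r}. c s * (poly_eval F (y s) * mon g (y s))) = 0"
      by (intro sum.neutral ballI) (simp add: ys Fx)
    ultimately have cr: "c r = 0" using x'(2) g(2) by (simp add: yr)
    have eq': "(\<Sum>s\<in>{..<r}. c s * mon m (x s)) = 0" if "m \<in> ?M" for m
    proof -
      have "(\<Sum>s\<in>{..<r}. c s * mon m (y s)) = 0" using eq[OF that] by (simp add: cr)
      moreover have "(\<Sum>s\<in>{..<r}. c s * mon m (y s)) = (\<Sum>s\<in>{..<r}. c s * mon m (x s))"
        by (intro sum.cong) (auto simp: ys)
      ultimately show ?thesis by simp
    qed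
    have "c s = 0" if s: "s \<in> {..<r}" for s
    proof -
      obtain h where h: "h \<in> cox_monos_deg k n a" "mon h (x s) \<noteq> 0"
        using exists_nonvanishing_mono[OF zeros_hom_coords[OF x], of s a] a s by blast
      have "c s * mon h (x s) = 0"
      proof (rule indep_onD[OF ind _ s, where x = "\<lambda>s. c s * mon h (x s)"])
        fix m assume "m \<in> cox_monos_deg k n d"
        from eq'[OF cox_monos_deg_add[OF h(1) this]]
        show "(\<Sum>s\<in>{..<r}. c s * mon h (x s) * mon m (x s)) = 0" by (simp add: mon_add mult.assoc)
      qed
      then show ?thesis using h(2) by simp
    qed
    then show "c s = 0" using s cr by (cases "s = r") auto
  qed
  then have "cpoly.dim (I \<inter> cox_piece k n (\<lambda>i. a i + d i)) + card {..<Suc r} \<le> card ?M"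
  proof (rule dim_add_card_le[OF subspace_I_piece Int_lower2 finite_lessThan])
    fix s p assume "s \<in> {..<Suc r}" "p \<in> I \<inter> cox_piece k n (\<lambda>i. a i + d i)"
    then show "(\<Sum>m\<in>?M. mon m (y s) * lookup p m) = 0"
      using zerosD[OF yz, of s p] cox_piece_poly_eval'[of p k n _ "y s"] by simp
  qed
  then show False using codim[of "\<lambda>i. a i + d i"] by simp
qed

text \<open>In a relation one of the points would be redundant. The other \<open>r - 1\<close>
  conditions are too few to force a form into \<open>I\<close>; yet a form satisfying them vanishes
  at the last point as well and so lies in \<open>I\<close>.\<close>

lemma zeros_independent:
  assumes van: "\<And>F. F \<in> cox_piece k n a \<Longrightarrow> (\<And>s. s < r \<Longrightarrow> poly_eval F (x s) = 0) \<Longrightarrow> F \<in> I"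
    and card: "cpoly.dim (I \<inter> cox_piece k n a) + r \<le> card (cox_monos_deg k n a)"
  shows "indep_on {..<r} (cox_monos_deg k n a) (\<lambda>s m. mon m (x s))"
proof (rule indep_onI, rule ccontr)
  fix c s0 assume s0: "s0 \<in> {..<r}" and cs: "c s0 \<noteq> 0"
    and eq: "\<And>m. m \<in> cox_monos_deg k n a \<Longrightarrow> (\<Sum>s\<in>{..<r}. c s * mon m (x s)) = 0"
  have "card ({..<r} - {s0}) < r" using s0 by simp
  then have "cpoly.dim (I \<inter> cox_piece k n a) + card ({..<r} - {s0}) < card (cox_monos_deg k n a)"
    using card by linarith
  from orthogonal_outside[OF subspace_I_piece Int_lower2 _ this, of "\<lambda>s m. mon m (x s)"]
  obtain p where p: "p \<in> cox_piece k n a" "p \<notin> I"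
    and orth: "\<And>s. s \<in> {..<r} - {s0} \<Longrightarrow> (\<Sum>m\<in>cox_monos_deg k n a. mon m (x s) * lookup p m) = 0"
    by auto
  have p0: "poly_eval p (x s) = 0" if "s \<in> {..<r} - {s0}" for s
    using orth[OF that] cox_piece_poly_eval'[OF p(1)] by simp
  have "(\<Sum>s\<in>{..<r}. c s * poly_eval p (x s)) = 0" by (rule functional_eval[OF eq p(1)])
  also have "(\<Sum>s\<in>{..<r}. c s * poly_eval p (x s)) = c s0 * poly_eval p (x s0) +
      (\<Sum>s\<in>{..<r} - {s0}. c s * poly_eval p (x s))"
    using s0 by (simp add: sum.remove)
  also have "(\<Sum>s\<in>{..<r} - {s0}. c s * poly_eval p (x s)) = 0"
    by (intro sum.neutral ballI) (simp only: p0 mult_zero_right)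
  finally have "poly_eval p (x s0) = 0" using cs by simp
  then have "poly_eval p (x s) = 0" if "s < r" for s using p0[of s] that by (cases "s = s0") auto
  then have "p \<in> I" by (rule van[OF p(1)])
  then show False using p(2) by blast
qed

text \<open>\<open>kernel_vector_extends\<close> for the matrix of monomials at the moving points,
  whose rows are independent at \<open>t = 0\<close>. The coefficient vector of \<open>f\<close> is
  in its kernel there.\<close>

lemma lift_along_path:
  assumes f: "f \<in> I \<inter> cox_piece k n a"
    and x0: "\<And>s. s < r \<Longrightarrow> z 0 s \<in> zeros"
    and z: "\<And>s. s < r \<Longrightarrow> \<exists>u v. \<forall>t. z t s = (\<lambda>w. u w + t * v w)"
    and ind: "indep_on {..<r} (cox_monos_deg k n a) (\<lambda>s m. mon m (z 0 s))"
  shows "\<exists>h c. c \<noteq> 0 \<and> (\<forall>t. h t \<in> cox_piece k n a) \<and> (\<forall>m. (\<lambda>t. lookup (h t) m) \<in> {f. \<exists>p. \<forall>t. f t = poly p t}) \<and>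
    (\<forall>t. \<forall>s<r. poly_eval (h t) (z t s) = 0) \<and> h 0 = cst c * f"
proof -
  let ?M = "cox_monos_deg k n a"
  let ?P = "{f. \<exists>p. \<forall>t::complex. f t = poly p t}"
  have ent: "(\<lambda>t. mon m (z t s)) \<in> ?P" if s: "s \<in> {..<r}" for s m
  proof -
    obtain u v where "\<And>t. z t s = (\<lambda>w. u w + t * v w)" using z[of s] s by auto
    then show ?thesis using polyfun_line[OF polyfun_mon[OF order_refl], of m u v] by simp
  qed
  have ker: "(\<Sum>m\<in>?M. mon m (z 0 s) * lookup f m) = 0" if "s \<in> {..<r}" for s
    using zerosD[OF x0, of s f a] f that cox_piece_poly_eval'[of f k n a] by simp
  have "\<exists>h c. c \<noteq> 0 \<and> (\<forall>m\<in>?M. (\<lambda>t. h t m) \<in> ?P) \<and> (\<forall>t. \<forall>s\<in>{..<r}. (\<Sum>m\<in>?M. mon m (z t s) * h t m) = 0) \<and>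
           (\<forall>m\<in>?M. h 0 m = c * lookup f m)"
    by (rule kernel_vector_extends[where a = "\<lambda>t s m. mon m (z t s)" and ?t0.0 =
        0, OF fun_alg_poly finite_lessThan finite_cox_monos_deg ent ind ker])
  then obtain h c where hc: "c \<noteq> 0 \<and> (\<forall>m\<in>?M. (\<lambda>t. h t m) \<in> ?P) \<and>
      (\<forall>t. \<forall>s\<in>{..<r}. (\<Sum>m\<in>?M. mon m (z t s) * h t m) = 0) \<and>
           (\<forall>m\<in>?M. h 0 m = c * lookup f m)" by (elim exE) (rule that)
  define g where "g t = (\<Sum>m\<in>?M. single m (h t m))" for t
  have lg: "lookup (g t) m = (if m \<in> ?M then h t m else 0)" for t m
    by (simp add: g_def lookup_sum lookup_single when_def sum.delta finite_cox_monos_deg)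
  have gp: "g t \<in> cox_piece k n a" for t
    unfolding g_def by (intro cpoly.subspace_sum[OF subspace_cox_piece] cox_piece_single)
  have "(\<lambda>t. lookup (g t) m) \<in> ?P" for m
    unfolding lg using hc fun_alg_const[OF fun_alg_poly, of 0] by (cases "m \<in> ?M") simp_all
  moreover have "poly_eval (g t) (z t s) = 0" if "s < r" for t s
  proof -
    have "(\<Sum>m\<in>?M. mon m (z t s) * h t m) = 0" using hc that by blast
    then show ?thesis unfolding cox_piece_poly_eval'[OF gp, symmetric] by (simp add: lg)
  qed
  moreover have "g 0 = cst c * f"
  proof (rule poly_mapping_eqI)
    fix m
    have "lookup (cst c * f) m = c * lookup f m" by (simp flip: cscale_cst)
    then show "lookup (g 0) m = lookup (cst c * f) m"
      using hc cox_piece_lookup[of f k n a m] f by (simp add: lg)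
  qed
  ultimately show ?thesis using hc gp by (intro exI[of _ g] exI[of _ c]) simp
qed

text \<open>The two independence statements are available at opposite ends of the line: the products
  are independent at \<open>t = 0\<close>, the tangent functionals at \<open>t = 1\<close>. A
  \<open>t\<close> outside both finite exceptional sets allows their numbers to be compared.\<close>

lemma square_codim:
  assumes hilb: "\<And>a. cpoly.dim (I \<inter> cox_piece k n a) + min r (card (cox_monos_deg k n a)) =
      card (cox_monos_deg k n a)"
    and jk: "j \<le> k" and d: "\<And>i. i \<in> {1..k} \<Longrightarrow> d i \<ge> 0"
    and rd: "r \<le> card (cox_monos_deg k n d)"
    and u: "\<And>i. i \<in> {1..j} \<Longrightarrow> d i \<le> u i" "\<And>i. i \<in> {j<..k} \<Longrightarrow> u i = d i"
    and y: "\<And>s i. y s (i, 0) = 1"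
    and ind: "indep_on (tan_index r j n) (cox_monos_deg k n d) (tan_fun y)"
  shows "cpoly.dim (ideal_prod (cox_ring k n) I I \<inter> cox_piece k n u) + card (tan_index r j n) \<le>
      card (cox_monos_deg k n u)"
proof -
  let ?P = "{f. \<exists>p. \<forall>t::complex. f t = poly p t}"
  let ?M = "cox_monos_deg k n u"
  let ?Q = "tan_index r j n"
  have "cpoly.dim (I \<inter> cox_piece k n d) + r \<le> card (cox_monos_deg k n d)" using hilb[of d] rd by simp
  from independent_zeros_exist[OF this order_refl]
  obtain x where x: "\<And>s. s < r \<Longrightarrow> x s \<in> zeros"
    and indx: "indep_on {..<r} (cox_monos_deg k n d) (\<lambda>s m. mon m (x s))" by blast
  \<comment> \<open>The line from the zeros of \<open>I\<close> at \<open>t = 0\<close> to the given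
    configuration at \<open>t = 1\<close>. Intermediate vectors need not be homogeneous coordinates
    of points; only the polynomial dependence on \<open>t\<close> matters.\<close>
  define z where "z t s = (\<lambda>w. x s w + t * (y s w - x s w))" for t s
  have z0: "z 0 = x" and z1: "z 1 = y" by (simp_all add: z_def fun_eq_iff)
  have zl: "\<exists>u v. \<forall>t. z t s = (\<lambda>w. u w + t * v w)" for s
    unfolding z_def by (intro exI allI, rule refl)
  \<comment> \<open>A nonzero element of \<open>I\<close> in degree \<open>a\<close> makes the
    Hilbert function smaller than the dimension of the piece, hence equal to
    \<open>r\<close>.\<close>
  have indz: "indep_on {..<r} (cox_monos_deg k n a) (\<lambda>s m. mon m (z 0 s))"
    if f: "f \<in> I \<inter> cox_piece k n a" "f \<noteq> 0" for f a
  proof -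
    have "\<not> I \<inter> cox_piece k n a \<subseteq> {0}" using f by blast
    have "cpoly.dim (I \<inter> cox_piece k n a) \<noteq> 0"
    proof
      assume "cpoly.dim (I \<inter> cox_piece k n a) = 0"
      moreover obtain B where "finite B" "card B = cpoly.dim (I \<inter> cox_piece k n a)" "cpoly.span B =
          I \<inter> cox_piece k n a"
        using cox_piece_basis[OF subspace_I_piece Int_lower2] by blast
      ultimately have "I \<inter> cox_piece k n a = {0}" by simp
      then show False using f by blast
    qed
    then have card: "cpoly.dim (I \<inter> cox_piece k n a) + r \<le> card (cox_monos_deg k n a)"
      using hilb[of a] by linarith
    show ?thesis unfolding z0
      by (rule zeros_independent[OF vanishing_in_ideal[OF x d indx] card])
  qed
  have "\<exists>g1\<in>?P. g1 1 \<noteq> 0 \<and> (\<forall>t. g1 t \<noteq> 0 \<longrightarrow> indep_on ?Q ?M (tan_fun (z t)))"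
  proof (rule indep_on_open[OF fun_alg_poly finite_tan_index])
    show "(\<lambda>t. tan_fun (z t) q m) \<in> ?P" for q m
    proof -
      have "polyfun UNIV (\<lambda>y. if snd q = (0, 0) then mon m y else mon_deriv (snd q) m y)"
        using polyfun_mon[of m UNIV] polyfun_mon_deriv[of m UNIV] by (cases "snd q = (0, 0)") simp_all
      from polyfun_line[OF this, of "x (fst q)" "\<lambda>w. y (fst q) w - x (fst q) w"]
      show ?thesis by (cases "snd q = (0, 0)") (simp_all add: tan_fun_def z_def)
    qed
    show "indep_on ?Q ?M (tan_fun (z 1))"
      unfolding z1 using jk u y ind by (rule tan_fun_indep_mono)
  qed
  then obtain p1 where p1: "poly p1 1 \<noteq> 0" "\<And>t. poly p1 t \<noteq> 0 \<Longrightarrow> indep_on ?Q ?M (tan_fun (z t))" by auto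
  \<comment> \<open>A basis consisting of actual products \<open>f * g\<close>, because a
    deformation is built from the two factors.\<close>
  obtain B where B: "B \<subseteq> hom_products k n I u" "cpoly.independent B" "hom_products k n I u \<subseteq> cpoly.span B"
    by (rule cpoly.maximal_independent_subset)
  have Bp: "B \<subseteq> cox_piece k n u" using B(1) hom_products_piece by blast
  have finB: "finite B"
  proof -
    obtain C where C: "finite C" "cpoly.span C = cox_piece k n u"
      using cox_piece_basis[OF subspace_cox_piece order_refl] by blast
    then show ?thesis using cpoly.independent_span_bound[OF C(1) B(2)] Bp by simp
  qed
  have "ideal_prod (cox_ring k n) I I \<inter> cox_piece k n u \<subseteq> cpoly.span B"
  proof
    fix p assume p: "p \<in> ideal_prod (cox_ring k n) I I \<inter> cox_piece k n u"
    then have "p \<in> cpoly.span (hom_products k n I u)"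
      using square_component_span[OF hom, of p u] mdeg_component_id[of p k n u] by simp
    then show "p \<in> cpoly.span B" using cpoly.span_minimal[OF B(3) cpoly.subspace_span] by blast
  qed
  then have dimB: "cpoly.dim (ideal_prod (cox_ring k n) I I \<inter> cox_piece k n u) \<le> card B"
    by (rule cpoly.dim_le_card[OF _ finB])
  have "\<exists>h c. c \<noteq> 0 \<and> (\<forall>t. h t \<in> cox_piece k n u) \<and> (\<forall>m. (\<lambda>t. lookup (h t) m) \<in> ?P) \<and>
      (\<forall>t. \<forall>q\<in>?Q. (\<Sum>m\<in>?M. tan_fun (z t) q m * lookup (h t) m) = 0) \<and> h 0 = cst c * b"
    if b: "b \<in> B" for b
  proof -
    have "b \<noteq> 0" using b B(2) cpoly.dependent_zero by blast
    obtain f g a a' where fg: "b = f * g" "f \<in> I \<inter> cox_piece k n a" "g \<in> I \<inter> cox_piece k n a'"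
      and deg: "\<forall>i\<in>{1..k}. a i + a' i = u i" using b B(1) unfolding hom_products_def by blast
    have nz: "f \<noteq> 0" "g \<noteq> 0" using \<open>b \<noteq> 0\<close> fg(1) by auto
    have x0: "z 0 s \<in> zeros" if "s < r" for s using x[OF that] by (simp add: z0)
    have "\<exists>h c. c \<noteq> 0 \<and> (\<forall>t. h t \<in> cox_piece k n a) \<and> (\<forall>m. (\<lambda>t. lookup (h t) m) \<in> ?P) \<and>
      (\<forall>t. \<forall>s<r. poly_eval (h t) (z t s) = 0) \<and> h 0 = cst c * f"
      by (rule lift_along_path[OF fg(2) _ zl indz[OF fg(2) nz(1)]]) (rule x0)
    then obtain hf c where hf: "c \<noteq> 0 \<and> (\<forall>t. hf t \<in> cox_piece k n a) \<and> (\<forall>m. (\<lambda>t. lookup (hf t) m) \<in> ?P) \<and>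
      (\<forall>t. \<forall>s<r. poly_eval (hf t) (z t s) = 0) \<and> hf 0 = cst c * f" by (elim exE) (rule that)
    have "\<exists>h c. c \<noteq> 0 \<and> (\<forall>t. h t \<in> cox_piece k n a') \<and> (\<forall>m. (\<lambda>t. lookup (h t) m) \<in> ?P) \<and>
      (\<forall>t. \<forall>s<r. poly_eval (h t) (z t s) = 0) \<and> h 0 = cst c * g"
      by (rule lift_along_path[OF fg(3) _ zl indz[OF fg(3) nz(2)]]) (rule x0)
    then obtain hg c' where hg: "c' \<noteq> 0 \<and> (\<forall>t. hg t \<in> cox_piece k n a') \<and> (\<forall>m. (\<lambda>t. lookup (hg t) m) \<in> ?P) \<and>
      (\<forall>t. \<forall>s<r. poly_eval (hg t) (z t s) = 0) \<and> hg 0 = cst c' * g" by (elim exE) (rule that)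
    have prod: "hf t * hg t \<in> cox_piece k n u" for t
    proof -
      have "hf t * hg t \<in> cox_piece k n (\<lambda>i. a i + a' i)" using hf hg by (intro cox_piece_mult) auto
      then show ?thesis using cox_piece_cong[of k "\<lambda>i. a i + a' i" u n] deg by simp
    qed
    have "(\<lambda>t. lookup (hf t * hg t) m) \<in> ?P" for m
      by (rule fun_alg_lookup_mult[OF fun_alg_poly finite_cox_monos_deg[of k n a]
          finite_cox_monos_deg[of k n a']])
        (use hf hg in \<open>simp_all add: cox_piece_def\<close>)
    moreover have "(\<Sum>m\<in>?M. tan_fun (z t) q m * lookup (hf t * hg t) m) = 0" if "q \<in> ?Q" for t q
      by (rule product_vanishes_doubly[OF prod _ _ that]) (use hf hg in blast)+
    moreover have "hf 0 * hg 0 = cst (c * c') * b" using hf hg fg(1) by (simp add: cst_mult ac_simps)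
    moreover have "c * c' \<noteq> 0" using hf hg by simp
    ultimately show ?thesis using prod by (intro exI[of _ "\<lambda>t. hf t * hg t"] exI[of _ "c * c'"] conjI
        allI ballI) blast+
  qed
  then have "\<forall>b\<in>B. \<exists>h. \<exists>c. c \<noteq> 0 \<and> (\<forall>t. h t \<in> cox_piece k n u) \<and> (\<forall>m. (\<lambda>t. lookup (h t) m) \<in> ?P) \<and>
      (\<forall>t. \<forall>q\<in>?Q. (\<Sum>m\<in>?M. tan_fun (z t) q m * lookup (h t) m) = 0) \<and> h 0 = cst c * b"
    by blast
  from bchoice[OF this] obtain h where h: "\<forall>b\<in>B. \<exists>c. c \<noteq> 0 \<and> (\<forall>t. h b t \<in> cox_piece k n u) \<and>
      (\<forall>m. (\<lambda>t. lookup (h b t) m) \<in> ?P) \<and>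
      (\<forall>t. \<forall>q\<in>?Q. (\<Sum>m\<in>?M. tan_fun (z t) q m * lookup (h b t) m) = 0) \<and> h b 0 = cst c * b"
    by (elim exE) (rule that)
  from bchoice[OF h] obtain c where c: "\<forall>b\<in>B. c b \<noteq> 0 \<and> (\<forall>t. h b t \<in> cox_piece k n u) \<and>
      (\<forall>m. (\<lambda>t. lookup (h b t) m) \<in> ?P) \<and>
      (\<forall>t. \<forall>q\<in>?Q. (\<Sum>m\<in>?M. tan_fun (z t) q m * lookup (h b t) m) = 0) \<and> h b 0 = cst (c b) * b"
    by (elim exE) (rule that)
  have "\<exists>g0\<in>?P. g0 0 \<noteq> 0 \<and> (\<forall>t. g0 t \<noteq> 0 \<longrightarrow> indep_on B ?M (\<lambda>b. lookup (h b t)))"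
  proof (rule indep_on_open[OF fun_alg_poly finB])
    show "(\<lambda>t. lookup (h b t) m) \<in> ?P" if "b \<in> B" for b m using c that by blast
    show "indep_on B ?M (\<lambda>b. lookup (h b 0))"
    proof (rule indep_onI)
      fix xx b assume b: "b \<in> B"
        and eq: "\<And>m. m \<in> ?M \<Longrightarrow> (\<Sum>b\<in>B. xx b * lookup (h b 0) m) = 0"
      have "xx b * c b = 0"
      proof (rule indep_onD[OF independent_indep_on[OF finB Bp B(2)] _ b, where x = "\<lambda>b. xx b * c b"])
        fix m assume m: "m \<in> ?M"
        have "(\<Sum>b\<in>B. xx b * c b * lookup b m) = (\<Sum>b\<in>B. xx b * lookup (h b 0) m)"
        proof (rule sum.cong[OF refl])
          fix b assume "b \<in> B"
          then have "h b 0 = cscale (c b) b" using c by (simp add: cscale_cst)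
          then show "xx b * c b * lookup b m = xx b * lookup (h b 0) m" by simp
        qed
        then show "(\<Sum>b\<in>B. xx b * c b * lookup b m) = 0" using eq[OF m] by simp
      qed
      then show "xx b = 0" using c b by simp
    qed
  qed
  then obtain p0 where p0: "poly p0 0 \<noteq> 0" "\<And>t. poly p0 t \<noteq> 0 \<Longrightarrow> indep_on B ?M (\<lambda>b. lookup (h b t))" by auto
  have "p0 * p1 \<noteq> 0" using p0(1) p1(1) by auto
  then have "finite {t. poly (p0 * p1) t = 0}" by (rule poly_roots_finite)
  then obtain t where "t \<notin> {t. poly (p0 * p1) t = 0}" using ex_new_if_finite[OF infinite_UNIV_char_0] by blast
  then have t: "poly p0 t \<noteq> 0" "poly p1 t \<noteq> 0" by auto
  have "card ?Q + card B \<le> card ?M"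
    by (rule indep_on_orthogonal_card[OF finite_tan_index finB finite_cox_monos_deg p1(2)[OF t(2)]
        p0(2)[OF t(1)]])
      (use c in blast)
  then show ?thesis using dimB by linarith
qed

end

section \<open>Families over the multigraded Hilbert functor\<close>

lemma finite_decompositions: "finite {(a :: 'v \<Rightarrow>\<^sub>0 nat, b). a + b = m}"
proof -
  define N where "N = (\<Sum>v\<in>keys m. lookup m v)"
  define A where "A = {a :: 'v \<Rightarrow>\<^sub>0 nat. keys a \<subseteq> keys m \<and> (\<forall>v\<in>keys m. lookup a v \<le> N)}"
  have "finite A" unfolding A_def by (rule finite_bounded_poly_mapping) simp
  have le: "a \<in> A" if "\<And>v. lookup a v \<le> lookup m v" for a
  proof -
    have "keys a \<subseteq> keys m"
    proof
      fix v assume "v \<in> keys a"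
      then show "v \<in> keys m" using that[of v] by (auto simp: in_keys_iff)
    qed
    moreover have "lookup a v \<le> N" if "v \<in> keys m" for v
    proof -
      have "lookup m v \<le> N" unfolding N_def by (rule member_le_sum) (use that in auto)
      then show ?thesis using \<open>\<And>v. lookup a v \<le> lookup m v\<close>[of v] by simp
    qed
    ultimately show ?thesis by (simp add: A_def)
  qed
  have "{(a, b). a + b = m} \<subseteq> A \<times> A"
  proof safe
    fix a b :: "'v \<Rightarrow>\<^sub>0 nat" assume m: "m = a + b"
    show "a \<in> A" "b \<in> A" by (auto intro!: le simp: m lookup_add)
  qed
  then show ?thesis using \<open>finite A\<close> by (meson finite_SigmaI finite_subset)
qed

text \<open>The shape in which multiplication in \<open>cox_ring_over\<close> is defined, so that
  specialisation can be compared with it term by term.\<close>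

lemma lookup_mult_decompositions:
  fixes p q :: cpoly
  shows "lookup (p * q) m = (\<Sum>(a, b)\<in>{(a, b). a + b = m}. lookup p a * lookup q b)"
proof -
  let ?D = "{(a :: mono, b). a + b = m}"
  define A where "A = keys p \<union> fst ` ?D"
  define B where "B = keys q \<union> snd ` ?D"
  have fin: "finite A" "finite B" using finite_decompositions[of m] by (auto simp: A_def B_def)
  have "lookup (p * q) m = (\<Sum>x\<in>A \<times> B. if fst x + snd x = m then lookup p (fst x) * lookup q (snd x) else 0)"
    by (subst lookup_mult_superset[of A _ B]) (use fin in \<open>auto simp: A_def B_def sum.cartesian_product
        case_prod_unfold\<close>)
  also have "\<dots> = (\<Sum>x\<in>{x \<in> A \<times> B. fst x + snd x = m}. lookup p (fst x) * lookup q (snd x))"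
    by (rule sum.inter_filter[symmetric]) (use fin in auto)
  also have "{x \<in> A \<times> B. fst x + snd x = m} = ?D" by (force simp: A_def B_def)
  finally show ?thesis by (simp add: case_prod_unfold)
qed

text \<open>The hypotheses say that the classes of the \<open>b i\<close> form a basis of the
  quotient of the piece by \<open>W\<close>.\<close>

lemma dim_complement:
  assumes W: "cpoly.subspace W" "W \<subseteq> cox_piece k n u" and b: "\<And>i. i < t \<Longrightarrow> b i \<in> cox_piece k n u"
    and ind: "\<And>c i. (\<Sum>i<t. cscale (c i) (b i)) \<in> W \<Longrightarrow> i < t \<Longrightarrow> c i = 0"
    and span: "\<And>p. p \<in> cox_piece k n u \<Longrightarrow> \<exists>c. p - (\<Sum>i<t. cscale (c i) (b i)) \<in> W"
  shows "cpoly.dim W + t = cox_dim k n u"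
proof (rule antisym)
  obtain B where B: "finite B" "B \<subseteq> W" "card B = cpoly.dim W" "cpoly.independent B" "cpoly.span B = W"
    using cox_piece_basis[OF W] by blast
  let ?M = "cox_monos_deg k n u"
  let ?P = "case_sum b (\<lambda>p. p)"
  have indP: "indep_on (Sum_Type.Plus {..<t} B) ?M (\<lambda>s. lookup (?P s))"
  proof (rule indep_onI)
    fix x s assume s: "s \<in> Sum_Type.Plus {..<t} B"
      and eq: "\<And>m. m \<in> ?M \<Longrightarrow> (\<Sum>s\<in>Sum_Type.Plus {..<t} B. x s * lookup (?P s) m) = 0"
    have BW: "(\<Sum>p\<in>B. cscale (x (Inr p)) p) \<in> W" by (rule sum_cscale_in[OF W(1)]) (use B in auto)
    have bt: "(\<Sum>i<t. cscale (x (Inl i)) (b i)) \<in> cox_piece k n u"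
      by (rule sum_cscale_in[OF subspace_cox_piece]) (use b in auto)
    have "(\<Sum>i<t. cscale (x (Inl i)) (b i)) + (\<Sum>p\<in>B. cscale (x (Inr p)) p) \<in> cox_piece k n u"
      using cpoly.subspace_add[OF subspace_cox_piece bt] BW W(2) by blast
    then have 0: "(\<Sum>i<t. cscale (x (Inl i)) (b i)) + (\<Sum>p\<in>B. cscale (x (Inr p)) p) = 0"
      by (rule cox_piece_eq_0) (use eq B(1) in \<open>simp add: lookup_add lookup_sum_cscale sum_Plus\<close>)
    then have "(\<Sum>i<t. cscale (x (Inl i)) (b i)) = - (\<Sum>p\<in>B. cscale (x (Inr p)) p)"
      by (simp add: add_eq_0_iff2)
    then have "(\<Sum>i<t. cscale (x (Inl i)) (b i)) \<in> W" using cpoly.subspace_neg[OF W(1) BW] by simp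
    then have xl: "x (Inl i) = 0" if "i < t" for i using ind[of "\<lambda>i. x (Inl i)"] that by blast
    then have "(\<Sum>i<t. cscale (x (Inl i)) (b i)) = 0" by (intro sum.neutral) simp
    then have "(\<Sum>p\<in>B. cscale (x (Inr p)) p) = 0" using 0 by simp
    then have "(\<Sum>p\<in>B. x (Inr p) * lookup p m) = 0" for m
      using lookup_sum_cscale[of "\<lambda>p. x (Inr p)" "\<lambda>p. p" B m] by simp
    moreover have "indep_on B ?M lookup"
      using B W(2) by (intro independent_indep_on) auto
    ultimately have "x (Inr p) = 0" if "p \<in> B" for p
      using that by (intro indep_onD[where x = "\<lambda>p. x (Inr p)"])
    then show "x s = 0" using xl s by auto
  qed
  have "card (Sum_Type.Plus {..<t} B) \<le> cox_dim k n u"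
    by (rule indep_on_card_le_dim[OF subspace_cox_piece order_refl _ _ indP]) (use B(1,2) W(2) b in
        \<open>auto simp: finite_Plus\<close>)
  then show "cpoly.dim W + t \<le> cox_dim k n u" using B by (simp add: card_Plus)
  have "cox_piece k n u \<subseteq> cpoly.span (b ` {..<t} \<union> B)"
  proof
    fix p assume "p \<in> cox_piece k n u"
    then obtain c where c: "p - (\<Sum>i<t. cscale (c i) (b i)) \<in> W" using span by blast
    have "p - (\<Sum>i<t. cscale (c i) (b i)) \<in> cpoly.span (b ` {..<t} \<union> B)"
      using c cpoly.span_mono[of B "b ` {..<t} \<union> B"] B(5) by blast
    moreover have "(\<Sum>i<t. cscale (c i) (b i)) \<in> cpoly.span (b ` {..<t} \<union> B)"
      by (intro cpoly.span_sum cpoly.span_scale cpoly.span_base) auto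
    ultimately have "p - (\<Sum>i<t. cscale (c i) (b i)) + (\<Sum>i<t. cscale (c i) (b i)) \<in> cpoly.span (b ` {..<t} \<union> B)"
      by (rule cpoly.span_add)
    then show "p \<in> cpoly.span (b ` {..<t} \<union> B)" by simp
  qed
  then have "cox_dim k n u \<le> card (b ` {..<t} \<union> B)" using B(1) by (intro cpoly.dim_le_card) auto
  also have "\<dots> \<le> card (b ` {..<t}) + card B" by (rule card_Un_le)
  also have "\<dots> \<le> t + card B" using card_image_le[of "{..<t}" b] by simp
  finally show "cox_dim k n u \<le> cpoly.dim W + t" using B(3) by simp
qed

text \<open>A family of ideals over the spectrum of \<open>R\<close>.
  \<open>smult_one_closed\<close> provides the constants through which complex coefficients are
  lifted to \<open>R\<close>.\<close>

locale hilb_family = cring R for R :: "(complex, 'r) module" (structure) +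
  fixes k :: nat and n :: "nat \<Rightarrow> nat" and h :: "(nat \<Rightarrow> int) \<Rightarrow> nat" and J :: "(mono \<Rightarrow> 'r) set"
  assumes smult_one_closed: "\<And>c. c \<odot> \<one> \<in> carrier R"
    and J: "J \<in> hilb_functor R k n h"
begin

abbreviation S :: "(mono \<Rightarrow> 'r) set" where "S \<equiv> carrier (cox_ring_over R k n)"

lemma S_iff: "f \<in> S \<longleftrightarrow> (\<forall>m. f m \<in> carrier R) \<and> (\<forall>m. m \<notin> cox_monos k n \<longrightarrow> f m = \<zero>) \<and> finite {m. f m \<noteq> \<zero>}"
  by (simp add: cox_ring_over_def)

lemma S_carrier: "f \<in> S \<Longrightarrow> f m \<in> carrier R"
  by (simp add: S_iff)

lemma SI:
  assumes "\<And>m. f m \<in> carrier R" "finite A" "A \<subseteq> cox_monos k n" "\<And>m. m \<notin> A \<Longrightarrow> f m = \<zero>"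
  shows "f \<in> S"
proof -
  have "{m. f m \<noteq> \<zero>} \<subseteq> A" using assms(4) by auto
  then show ?thesis unfolding S_iff using assms by (auto dest: finite_subset)
qed

section \<open>Specialisation at a complex point\<close>

context
  fixes \<phi> assumes \<phi>: "\<phi> \<in> complex_points R"
begin

lemma point_add: "x \<in> carrier R \<Longrightarrow> y \<in> carrier R \<Longrightarrow> \<phi> (x \<oplus> y) = \<phi> x + \<phi> y"
  and point_mult: "x \<in> carrier R \<Longrightarrow> y \<in> carrier R \<Longrightarrow> \<phi> (x \<otimes> y) = \<phi> x * \<phi> y"
  and point_one: "\<phi> \<one> = 1"
  using \<phi> by (auto simp: complex_points_def ring_hom_def complex_ring_def)

lemma point_scalar: "\<phi> (c \<odot> \<one>) = c"
  using \<phi> point_one by (simp add: complex_points_def)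

lemma point_zero: "\<phi> \<zero> = 0"
  using point_add[of \<zero> \<zero>] by simp

lemma point_uminus: "x \<in> carrier R \<Longrightarrow> \<phi> (\<ominus> x) = - \<phi> x"
  using point_add[of x "\<ominus> x"] point_zero by (simp add: r_neg add_eq_0_iff)

lemma point_minus: "x \<in> carrier R \<Longrightarrow> y \<in> carrier R \<Longrightarrow> \<phi> (x \<ominus> y) = \<phi> x - \<phi> y"
  by (simp add: a_minus_def point_add point_uminus)

lemma point_pow: "x \<in> carrier R \<Longrightarrow> \<phi> (x [^] (q::nat)) = \<phi> x ^ q"
  by (induction q) (simp_all add: point_one point_mult)

lemma point_finsum:
  assumes "finite A" "\<And>i. i \<in> A \<Longrightarrow> f i \<in> carrier R"
  shows "\<phi> (\<Oplus>i\<in>A. f i) = (\<Sum>i\<in>A. \<phi> (f i))"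
  using assms
proof (induction A rule: finite_induct)
  case (insert a A)
  then show ?case by (subst finsum_insert) (auto simp: point_add)
qed (simp add: point_zero)

definition spec :: "(mono \<Rightarrow> 'r) \<Rightarrow> cpoly" where
  "spec f = Abs_poly_mapping (\<lambda>m. \<phi> (f m))"

lemma lookup_spec: "f \<in> S \<Longrightarrow> lookup (spec f) m = \<phi> (f m)"
proof -
  assume "f \<in> S"
  moreover have "{m. \<phi> (f m) \<noteq> 0} \<subseteq> {m. f m \<noteq> \<zero>}" using point_zero by auto
  ultimately have "finite {m. \<phi> (f m) \<noteq> 0}" by (simp add: S_iff finite_subset)
  then show ?thesis by (simp add: spec_def)
qed

lemma spec_carrier: "f \<in> S \<Longrightarrow> spec f \<in> carrier (cox_ring k n)"
  unfolding cox_carrier_iff using lookup_spec[of f] point_zero by (auto simp: in_keys_iff S_iff)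

lemma spec_mult: 
  assumes "f \<in> S" "g \<in> S" "f \<otimes>\<^bsub>cox_ring_over R k n\<^esub> g \<in> S"
  shows "spec (f \<otimes>\<^bsub>cox_ring_over R k n\<^esub> g) = spec f * spec g"
proof (rule poly_mapping_eqI)
  fix m
  have "(f \<otimes>\<^bsub>cox_ring_over R k n\<^esub> g) m = (\<Oplus>x\<in>{(a, b). a + b = m}. f (fst x) \<otimes> g (snd x))"
    by (simp add: cox_ring_over_def case_prod_unfold)
  then have "\<phi> ((f \<otimes>\<^bsub>cox_ring_over R k n\<^esub> g) m) = (\<Sum>x\<in>{(a, b). a + b = m}. \<phi> (f (fst x)) * \<phi> (g (snd x)))"
    using assms(1,2) by (simp add: point_finsum[OF finite_decompositions] S_carrier point_mult)
  then show "lookup (spec (f \<otimes>\<^bsub>cox_ring_over R k n\<^esub> g)) m = lookup (spec f * spec g) m"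
    by (simp add: lookup_spec assms lookup_mult_decompositions case_prod_unfold)
qed

end

lemma homogeneous_J: "homogeneous_ideal_over R k n J"
  using J by (simp add: hilb_functor_def)

lemma ideal_J: "ideal J (cox_ring_over R k n)"
  using homogeneous_J by (simp add: homogeneous_ideal_over_def)

lemma J_S: "f \<in> J \<Longrightarrow> f \<in> S"
  using ideal.Icarr[OF ideal_J] .

lemma J_add: "f \<in> J \<Longrightarrow> g \<in> J \<Longrightarrow> (\<lambda>m. f m \<oplus> g m) \<in> J"
  using additive_subgroup.a_closed[OF ideal.axioms(1)[OF ideal_J], of f g] by (simp add: cox_ring_over_def)

lemma J_zero: "(\<lambda>m. \<zero>) \<in> J"
  using additive_subgroup.zero_closed[OF ideal.axioms(1)[OF ideal_J]] by (simp add: cox_ring_over_def)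

lemma J_component: "f \<in> J \<Longrightarrow> (\<lambda>m. if has_mdeg k n m u then f m else \<zero>) \<in> J"
  using homogeneous_J unfolding homogeneous_ideal_over_def by blast

lemma J_smult:
  assumes f: "f \<in> J" and x: "x \<in> carrier R"
  shows "(\<lambda>m. x \<otimes> f m) \<in> J"
proof -
  define c where "c m = (if m = 0 then x else \<zero>)" for m :: mono
  have "c \<in> S" by (rule SI[of _ "{0}"]) (auto simp: c_def x)
  then have "c \<otimes>\<^bsub>cox_ring_over R k n\<^esub> f \<in> J" by (rule ideal.I_l_closed[OF ideal_J f])
  moreover have "(c \<otimes>\<^bsub>cox_ring_over R k n\<^esub> f) m = x \<otimes> f m" for m
  proof -
    have fm: "f a \<in> carrier R" for a using S_carrier[OF J_S[OF f]] .
    have "(c \<otimes>\<^bsub>cox_ring_over R k n\<^esub> f) m = (\<Oplus>p\<in>{(a, b). a + b = m}. c (fst p) \<otimes> f (snd p))"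
      by (simp add: cox_ring_over_def case_prod_unfold)
    also have "\<dots> = (\<Oplus>p\<in>{(a, b). a + b = m}. if (0, m) = p then x \<otimes> f m else \<zero>)"
      by (rule finsum_cong') (auto simp: c_def x fm)
    also have "\<dots> = x \<otimes> f m"
      by (rule finsum_singleton) (auto simp: finite_decompositions x fm)
    finally show ?thesis .
  qed
  ultimately show ?thesis by (metis ext)
qed

text \<open>A right inverse of \<open>spec\<close>, the same for all complex points: coefficients
  become constants of \<open>R\<close>.\<close>

definition lift :: "cpoly \<Rightarrow> mono \<Rightarrow> 'r" where
  "lift p m = (if m \<in> keys p then lookup p m \<odot> \<one> else \<zero>)"

lemma lift_S: "p \<in> carrier (cox_ring k n) \<Longrightarrow> lift p \<in> S"
  by (rule SI[of _ "keys p"]) (auto simp: lift_def cox_carrier_iff smult_one_closed)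

lemma spec_lift: "\<phi> \<in> complex_points R \<Longrightarrow> p \<in> carrier (cox_ring k n) \<Longrightarrow> spec \<phi> (lift p) = p"
  by (rule poly_mapping_eqI)
    (auto simp: lookup_spec lift_S, auto simp: lift_def point_scalar point_zero in_keys_iff)

lemma family_fibre_eq:
  assumes "\<phi> \<in> complex_points R"
  shows "family_fibre k n \<phi> J = spec \<phi> ` J"
proof
  show "family_fibre k n \<phi> J \<subseteq> spec \<phi> ` J"
  proof
    fix p assume "p \<in> family_fibre k n \<phi> J"
    then obtain f where f: "f \<in> J" "\<And>m. lookup p m = \<phi> (f m)" by (auto simp: family_fibre_def)
    have "p = spec \<phi> f" by (rule poly_mapping_eqI) (simp add: f lookup_spec[OF assms J_S])
    then show "p \<in> spec \<phi> ` J" using f by blast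
  qed
  show "spec \<phi> ` J \<subseteq> family_fibre k n \<phi> J"
    using spec_carrier[OF assms J_S] lookup_spec[OF assms J_S] by (auto simp: family_fibre_def)
qed

lemma fibre_homogeneous:
  assumes \<phi>: "\<phi> \<in> complex_points R"
  shows "homogeneous_ideal k n (family_fibre k n \<phi> J)"
  unfolding homogeneous_ideal_def family_fibre_eq[OF \<phi>]
proof (intro conjI ballI allI)
  show "ideal (spec \<phi> ` J) (cox_ring k n)"
  proof (rule cox_idealI)
    show "spec \<phi> ` J \<subseteq> carrier (cox_ring k n)" using spec_carrier[OF \<phi> J_S] by blast
    have "spec \<phi> (\<lambda>_. \<zero>) = 0"
      by (rule poly_mapping_eqI) (simp add: lookup_spec[OF \<phi> J_S[OF J_zero]] point_zero[OF \<phi>])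
    then show "0 \<in> spec \<phi> ` J" using J_zero by (metis image_eqI)
    show "a + b \<in> spec \<phi> ` J" if ab: "a \<in> spec \<phi> ` J" "b \<in> spec \<phi> ` J" for a b
    proof -
      obtain f g where fg: "f \<in> J" "g \<in> J" "a = spec \<phi> f" "b = spec \<phi> g" using ab by blast
      have "a + b = spec \<phi> (\<lambda>m. f m \<oplus> g m)"
        by (rule poly_mapping_eqI)
          (simp add: fg lookup_add lookup_spec[OF \<phi>] J_S J_add point_add[OF \<phi>] S_carrier)
      then show ?thesis using J_add[OF fg(1,2)] by blast
    qed
    show "c * a \<in> spec \<phi> ` J" if c: "c \<in> carrier (cox_ring k n)" and a: "a \<in> spec \<phi> ` J" for c a
    proof -
      obtain f where f: "f \<in> J" "a = spec \<phi> f" using a by blast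
      have cf: "lift c \<otimes>\<^bsub>cox_ring_over R k n\<^esub> f \<in> J" by (rule ideal.I_l_closed[OF ideal_J f(1) lift_S[OF c]])
      have "c * a = spec \<phi> (lift c \<otimes>\<^bsub>cox_ring_over R k n\<^esub> f)"
        using spec_mult[OF \<phi> lift_S[OF c] J_S[OF f(1)] J_S[OF cf]] spec_lift[OF \<phi> c] f(2) by simp
      then show ?thesis using cf by blast
    qed
  qed
  fix p u assume "p \<in> spec \<phi> ` J"
  then obtain f where f: "f \<in> J" "p = spec \<phi> f" by blast
  have "mdeg_component k n u p = spec \<phi> (\<lambda>m. if has_mdeg k n m u then f m else \<zero>)"
    by (rule poly_mapping_eqI)
      (simp add: f(2) lookup_mdeg_component lookup_spec[OF \<phi> J_S[OF f(1)]] lookup_spec[OF \<phi> J_S[OF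
          J_component[OF f(1)]]] point_zero[OF \<phi>])
  then show "mdeg_component k n u p \<in> spec \<phi> ` J" using J_component[OF f(1)] by blast
qed

abbreviation piece :: "(nat \<Rightarrow> int) \<Rightarrow> (mono \<Rightarrow> 'r) set" where "piece u \<equiv> piece_over R k n u"

lemma piece_iff: "f \<in> piece u \<longleftrightarrow> (\<forall>m. f m \<in> carrier R) \<and> (\<forall>m. m \<notin> cox_monos_deg k n u \<longrightarrow> f m = \<zero>)"
proof
  assume "f \<in> piece u"
  then show "(\<forall>m. f m \<in> carrier R) \<and> (\<forall>m. m \<notin> cox_monos_deg k n u \<longrightarrow> f m = \<zero>)"
    by (auto simp: piece_over_def S_iff cox_monos_deg_def)
next
  assume f: "(\<forall>m. f m \<in> carrier R) \<and> (\<forall>m. m \<notin> cox_monos_deg k n u \<longrightarrow> f m = \<zero>)"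
  then have "f \<in> S"
    by (intro SI[of _ "cox_monos_deg k n u"]) (auto simp: finite_cox_monos_deg, auto simp: cox_monos_deg_def)
  then show "f \<in> piece u" using f by (auto simp: piece_over_def cox_monos_deg_def)
qed

lemma piece_S: "f \<in> piece u \<Longrightarrow> f \<in> S"
  by (simp add: piece_over_def)

lemma piece_carrier: "f \<in> piece u \<Longrightarrow> f m \<in> carrier R"
  by (simp add: piece_iff)

lemma piece_add: "f \<in> piece u \<Longrightarrow> g \<in> piece u \<Longrightarrow> (\<lambda>m. f m \<oplus> g m) \<in> piece u"
  by (auto simp: piece_iff)

lemma piece_smult: "f \<in> piece u \<Longrightarrow> x \<in> carrier R \<Longrightarrow> (\<lambda>m. x \<otimes> f m) \<in> piece u"
  by (auto simp: piece_iff)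

lemma spec_piece:
  assumes "\<phi> \<in> complex_points R" "f \<in> piece u"
  shows "spec \<phi> f \<in> cox_piece k n u"
  unfolding cox_piece_def
  using lookup_spec[OF assms(1) piece_S[OF assms(2)]] assms(2) point_zero[OF assms(1)]
  by (auto simp: in_keys_iff piece_iff)

section \<open>Base change of a local basis\<close>

definition comb :: "nat \<Rightarrow> (nat \<Rightarrow> mono \<Rightarrow> 'r) \<Rightarrow> (nat \<Rightarrow> 'r) \<Rightarrow> mono \<Rightarrow> 'r" where
  "comb t b c m = (\<Oplus>i\<in>{..<t}. c i \<otimes> b i m)"

context
  fixes t :: nat and b :: "nat \<Rightarrow> mono \<Rightarrow> 'r" and u :: "nat \<Rightarrow> int"
  assumes b: "\<And>i. i < t \<Longrightarrow> b i \<in> piece u"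
begin

lemma b_carrier: "i < t \<Longrightarrow> b i m \<in> carrier R"
  by (rule piece_carrier[OF b])

lemma comb_carrier: "c \<in> {..<t} \<rightarrow> carrier R \<Longrightarrow> comb t b c m \<in> carrier R"
  unfolding comb_def by (intro finsum_closed) (auto simp: Pi_iff b_carrier)

lemma comb_piece:
  assumes "c \<in> {..<t} \<rightarrow> carrier R"
  shows "comb t b c \<in> piece u"
  unfolding piece_iff
proof (intro conjI allI impI)
  show "comb t b c m \<in> carrier R" for m by (rule comb_carrier[OF assms])
  fix m assume "m \<notin> cox_monos_deg k n u"
  then have "b i m = \<zero>" if "i < t" for i using b[OF that] by (simp add: piece_iff)
  then show "comb t b c m = \<zero>" unfolding comb_def
    using assms by (intro add.finprod_one_eqI) (auto simp: Pi_iff)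
qed

lemma comb_smult:
  assumes "c \<in> {..<t} \<rightarrow> carrier R" "x \<in> carrier R"
  shows "comb t b (\<lambda>i. x \<otimes> c i) m = x \<otimes> comb t b c m"
proof -
  have "x \<otimes> comb t b c m = (\<Oplus>i\<in>{..<t}. x \<otimes> (c i \<otimes> b i m))"
    unfolding comb_def using assms by (intro finsum_rdistr) (auto simp: Pi_iff b_carrier)
  also have "\<dots> = comb t b (\<lambda>i. x \<otimes> c i) m"
    unfolding comb_def using assms by (intro finsum_cong') (auto simp: Pi_iff b_carrier m_assoc)
  finally show ?thesis ..
qed

lemma comb_add:
  assumes "c \<in> {..<t} \<rightarrow> carrier R" "c' \<in> {..<t} \<rightarrow> carrier R"
  shows "comb t b (\<lambda>i. c i \<oplus> c' i) m = comb t b c m \<oplus> comb t b c' m"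
proof -
  have "comb t b c m \<oplus> comb t b c' m = (\<Oplus>i\<in>{..<t}. c i \<otimes> b i m \<oplus> c' i \<otimes> b i m)"
    unfolding comb_def using assms by (intro finsum_addf[symmetric]) (auto simp: Pi_iff b_carrier)
  also have "\<dots> = comb t b (\<lambda>i. c i \<oplus> c' i) m"
    unfolding comb_def using assms by (intro finsum_cong') (auto simp: Pi_iff b_carrier l_distr)
  finally show ?thesis ..
qed

lemma point_comb:
  assumes "\<phi> \<in> complex_points R" "c \<in> {..<t} \<rightarrow> carrier R"
  shows "\<phi> (comb t b c m) = (\<Sum>i<t. \<phi> (c i) * lookup (spec \<phi> (b i)) m)"
proof -
  have "\<phi> (comb t b c m) = (\<Sum>i<t. \<phi> (c i \<otimes> b i m))"
    unfolding comb_def using assms by (intro point_finsum) (auto simp: Pi_iff b_carrier)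
  also have "\<dots> = (\<Sum>i<t. \<phi> (c i) * lookup (spec \<phi> (b i)) m)"
    using assms by (intro sum.cong refl)
      (auto simp: Pi_iff b_carrier point_mult[OF assms(1)] lookup_spec[OF assms(1) piece_S[OF b]])
  finally show ?thesis .
qed

text \<open>
  This lifts a linear relation in the fibre to a relation over \<open>R\<close> whose coefficients have the same
  values at \<open>\<phi>\<close>.
\<close>

lemma vanishing_combination:
  assumes \<phi>: "\<phi> \<in> complex_points R" and f: "f \<in> carrier R"
    and span: "\<And>x. x \<in> piece u \<Longrightarrow> \<exists>q::nat. \<exists>c\<in>{..<t} \<rightarrow> carrier R. (\<lambda>m. (f [^] q \<otimes> x m) \<ominus> comb t b c m) \<in> J"
    and E: "finite E" "E \<subseteq> cox_monos_deg k n u"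
  shows "e \<in> piece u \<Longrightarrow> (\<And>m. \<phi> (e m) = 0) \<Longrightarrow> (\<And>m. m \<notin> E \<Longrightarrow> e m = \<zero>) \<Longrightarrow>
    \<exists>q::nat. \<exists>c\<in>{..<t} \<rightarrow> carrier R. (\<forall>i<t. \<phi> (c i) = 0) \<and> (\<lambda>m. (f [^] q \<otimes> e m) \<ominus> comb t b c m) \<in> J"
  using E
proof (induction E arbitrary: e rule: finite_induct)
  case empty
  have "comb t b (\<lambda>_. \<zero>) m = \<zero>" for m
    unfolding comb_def by (intro add.finprod_one_eqI) (auto simp: b_carrier)
  then have "(\<lambda>m. (f [^] (0::nat) \<otimes> e m) \<ominus> comb t b (\<lambda>_. \<zero>) m) = (\<lambda>m. \<zero>)"
    using empty by (simp add: a_minus_def)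
  then show ?case using J_zero point_zero[OF \<phi>]
    by (intro exI[of _ 0] bexI[of _ "\<lambda>_. \<zero>"]) auto
next
  case (insert m0 E)
  have ec: "e m \<in> carrier R" for m by (rule piece_carrier[OF insert.prems(1)])
  \<comment> \<open>\<open>e\<close> is split into its coefficient at \<open>m0\<close> and the
    rest. The unit vector \<open>d\<close> does not vanish at \<open>\<phi>\<close>, but it is
    multiplied by the coefficient \<open>p\<close>, which does; so the new coefficients vanish at
    \<open>\<phi>\<close>.\<close>
  define e1 where "e1 m = (if m = m0 then \<zero> else e m)" for m
  define d where "d m = (if m = m0 then \<one> else \<zero>)" for m
  have m0: "m0 \<in> cox_monos_deg k n u" using insert.prems by auto
  have e1p: "e1 \<in> piece u" using insert.prems(1) by (auto simp: piece_iff e1_def)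
  have dp: "d \<in> piece u" using m0 by (auto simp: piece_iff d_def)
  have dc: "d m \<in> carrier R" and e1c: "e1 m \<in> carrier R" for m using dp e1p by (auto intro: piece_carrier)
  have "\<exists>q::nat. \<exists>c\<in>{..<t} \<rightarrow> carrier R. (\<forall>i<t. \<phi> (c i) = 0) \<and> (\<lambda>m. (f [^] q \<otimes> e1 m) \<ominus> comb t b c m) \<in> J"
  proof (rule insert.IH[OF e1p])
    show "\<phi> (e1 m) = 0" for m using insert.prems(2) by (simp add: e1_def point_zero[OF \<phi>])
    show "e1 m = \<zero>" if "m \<notin> E" for m using insert.prems(3)[of m] that by (auto simp: e1_def)
  qed (use insert.prems in auto)
  then obtain q1 :: nat and c1 where c1: "c1 \<in> {..<t} \<rightarrow> carrier R" "\<forall>i<t. \<phi> (c1 i) = 0"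
    and K1: "(\<lambda>m. (f [^] q1 \<otimes> e1 m) \<ominus> comb t b c1 m) \<in> J" by blast
  obtain q2 :: nat and c2 where c2: "c2 \<in> {..<t} \<rightarrow> carrier R"
    and K2: "(\<lambda>m. (f [^] q2 \<otimes> d m) \<ominus> comb t b c2 m) \<in> J" using span[OF dp] by blast
  define p where "p = e m0"
  have p: "p \<in> carrier R" "\<phi> p = 0" using ec insert.prems(2) by (auto simp: p_def)
  define g1 where "g1 = f [^] q1"
  define g2 where "g2 = f [^] q2"
  have g: "g1 \<in> carrier R" "g2 \<in> carrier R" using f by (auto simp: g1_def g2_def)
  \<comment> \<open>Cross-multiplication brings both relations to the common power
    \<open>q1 + q2\<close> of \<open>f\<close>.\<close>
  define c where "c i = g2 \<otimes> c1 i \<oplus> (g1 \<otimes> p) \<otimes> c2 i" for i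
  have cc: "c \<in> {..<t} \<rightarrow> carrier R" using c1(1) c2 g p by (auto simp: c_def Pi_iff)
  have "\<phi> (c i) = 0" if "i < t" for i
    using that c1 c2 g p by (auto simp: c_def Pi_iff point_add[OF \<phi>] point_mult[OF \<phi>])
  moreover have "(\<lambda>m. (f [^] (q1 + q2) \<otimes> e m) \<ominus> comb t b c m) \<in> J"
  proof -
    have "(\<lambda>m. g2 \<otimes> ((g1 \<otimes> e1 m) \<ominus> comb t b c1 m) \<oplus> (g1 \<otimes> p) \<otimes> ((g2 \<otimes> d m) \<ominus> comb t b c2 m)) \<in> J"
      using K1 K2 g p unfolding g1_def[symmetric] g2_def[symmetric] by (intro J_add J_smult) auto
    also have "(\<lambda>m. g2 \<otimes> ((g1 \<otimes> e1 m) \<ominus> comb t b c1 m) \<oplus> (g1 \<otimes> p) \<otimes> ((g2 \<otimes> d m) \<ominus> comb t b c2 m)) =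
        (\<lambda>m. (f [^] (q1 + q2) \<otimes> e m) \<ominus> comb t b c m)"
    proof (rule ext)
      fix m
      have cm: "comb t b c m = g2 \<otimes> comb t b c1 m \<oplus> (g1 \<otimes> p) \<otimes> comb t b c2 m"
        unfolding c_def using c1(1) c2 g p by (subst comb_add) (auto simp: comb_smult Pi_iff)
      have fm: "f [^] (q1 + q2) = g1 \<otimes> g2" using f by (simp add: g1_def g2_def nat_pow_mult)
      have em: "e m = e1 m \<oplus> p \<otimes> d m" using ec p by (simp add: e1_def d_def p_def)
      note cl = comb_carrier[OF c1(1), of m] comb_carrier[OF c2, of m] g p(1) dc[of m] e1c[of m]
      show "g2 \<otimes> ((g1 \<otimes> e1 m) \<ominus> comb t b c1 m) \<oplus> (g1 \<otimes> p) \<otimes> ((g2 \<otimes> d m) \<ominus> comb t b c2 m) =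
          (f [^] (q1 + q2) \<otimes> e m) \<ominus> comb t b c m"
        unfolding cm fm em using cl
        by (simp add: a_minus_def r_distr l_distr r_minus l_minus minus_add m_ac a_ac)
    qed
    finally show ?thesis .
  qed
  ultimately show ?case using cc by blast
qed

end

text \<open>The prime at which local freeness is evaluated; the resulting \<open>f\<close> is
  nonzero at \<open>\<phi>\<close>.\<close>

lemma primeideal_point:
  assumes \<phi>: "\<phi> \<in> complex_points R"
  shows "primeideal {x \<in> carrier R. \<phi> x = 0} R"
proof (rule primeidealI)
  show "ideal {x \<in> carrier R. \<phi> x = 0} R"
  proof (rule idealI[OF ring_axioms])
    show "subgroup {x \<in> carrier R. \<phi> x = 0} (add_monoid R)"
      by (rule add.subgroupI) (auto simp: point_zero[OF \<phi>] point_add[OF \<phi>] point_uminus[OF \<phi>])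
  qed (auto simp: point_mult[OF \<phi>])
  show "carrier R \<noteq> {x \<in> carrier R. \<phi> x = 0}" 
  proof -
    have "\<one> \<notin> {x \<in> carrier R. \<phi> x = 0}" using point_one[OF \<phi>] by simp
    then show ?thesis using one_closed by blast
  qed
qed (auto simp: point_mult[OF \<phi>] is_cring)

text \<open>The specialised \<open>b i\<close> are a basis modulo the fibre. Spanning follows by
  specialising the relations of lifted polynomials. For independence, a relation in the fibre lifts
  to \<open>R\<close> only up to an error vanishing at \<open>\<phi>\<close>;
  \<open>vanishing_combination\<close> absorbs the error into coefficients that vanish at
  \<open>\<phi>\<close>, after which freeness applies.\<close>

lemma fibre_hilb_fun:
  assumes \<phi>: "\<phi> \<in> complex_points R"
  shows "hilb_fun k n (family_fibre k n \<phi> J) u = h u"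
proof -
  define t where "t = h u"
  define W where "W = family_fibre k n \<phi> J \<inter> cox_piece k n u"
  have idF: "ideal (family_fibre k n \<phi> J) (cox_ring k n)"
    using fibre_homogeneous[OF \<phi>] by (simp add: homogeneous_ideal_def)
  have sW: "cpoly.subspace W"
    unfolding W_def by (intro cpoly.subspace_inter subspace_cox_ideal[OF idF] subspace_cox_piece)
  have "locally_free_quotient R (piece u) (J \<inter> piece u) t"
    using J by (simp add: hilb_functor_def t_def)
  from this[unfolded locally_free_quotient_def, rule_format, OF primeideal_point[OF \<phi>]]
  obtain f where f: "f \<in> carrier R" "\<phi> f \<noteq> 0" and free: "free_quotient_at R (piece u) (J \<inter> piece u) f t"
    by auto
  from free[unfolded free_quotient_at_def, folded comb_def] obtain b where
    bb: "(\<forall>i<t. b i \<in> piece u) \<and>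
        (\<forall>x\<in>piece u. \<exists>q::nat. \<exists>c\<in>{..<t} \<rightarrow> carrier R. (\<lambda>m. (f [^] q \<otimes> x m) \<ominus> comb t b c m) \<in> J \<inter> piece u) \<and>
        (\<forall>c\<in>{..<t} \<rightarrow> carrier R. (\<lambda>m. comb t b c m) \<in> J \<inter> piece u \<longrightarrow>
           (\<exists>q::nat. \<forall>i<t. f [^] q \<otimes> c i = \<zero>))"
    by (elim exE) (rule that)
  have b: "\<And>i. i < t \<Longrightarrow> b i \<in> piece u" using bb by blast
  have cbc: "comb t b c m \<in> carrier R" if "c \<in> {..<t} \<rightarrow> carrier R" for c m
    using b that by (rule comb_carrier)
  have cbs: "comb t b (\<lambda>i. x \<otimes> c i) m = x \<otimes> comb t b c m"
    if "c \<in> {..<t} \<rightarrow> carrier R" "x \<in> carrier R" for c x m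
    using b that by (rule comb_smult)
  have cbp: "\<phi> (comb t b c m) = (\<Sum>i<t. \<phi> (c i) * lookup (spec \<phi> (b i)) m)"
    if "c \<in> {..<t} \<rightarrow> carrier R" for c m
    using b \<phi> that by (rule point_comb)
  have span: "\<exists>q::nat. \<exists>c\<in>{..<t} \<rightarrow> carrier R. (\<lambda>m. (f [^] q \<otimes> x m) \<ominus> comb t b c m) \<in> J"
    if "x \<in> piece u" for x using bb that by blast
  have free: "\<exists>q::nat. \<forall>i<t. f [^] q \<otimes> c i = \<zero>"
    if "c \<in> {..<t} \<rightarrow> carrier R" "comb t b c \<in> J" for c
  proof -
    have "comb t b c \<in> piece u" by (rule comb_piece[OF b that(1)])
    then show ?thesis using bb that by blast
  qed
  have "cpoly.dim W + t = cox_dim k n u"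
  proof (rule dim_complement[OF sW])
    show "W \<subseteq> cox_piece k n u" by (simp add: W_def)
    show "spec \<phi> (b i) \<in> cox_piece k n u" if "i < t" for i by (rule spec_piece[OF \<phi> b[OF that]])
    show "\<exists>c. p - (\<Sum>i<t. cscale (c i) (spec \<phi> (b i))) \<in> W" if p: "p \<in> cox_piece k n u" for p
    proof -
      have pc: "p \<in> carrier (cox_ring k n)" using p cox_piece_carrier by blast
      have lp: "lift p \<in> piece u"
        using p S_carrier[OF lift_S[OF pc]] by (auto simp: piece_iff lift_def cox_piece_def)
      obtain q :: nat and c where c: "c \<in> {..<t} \<rightarrow> carrier R"
        and K: "(\<lambda>m. (f [^] q \<otimes> lift p m) \<ominus> comb t b c m) \<in> J" using span[OF lp] by blast
      have fq: "\<phi> f ^ q \<noteq> 0" using f by simp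
      have "spec \<phi> (\<lambda>m. (f [^] q \<otimes> lift p m) \<ominus> comb t b c m) =
          cscale (\<phi> f ^ q) p - (\<Sum>i<t. cscale (\<phi> (c i)) (spec \<phi> (b i)))"
      proof (rule poly_mapping_eqI)
        fix m
        have "\<phi> (lift p m) = lookup p m"
          using lookup_spec[OF \<phi> lift_S[OF pc], of m] spec_lift[OF \<phi> pc] by simp
        then show "lookup (spec \<phi> (\<lambda>m. (f [^] q \<otimes> lift p m) \<ominus> comb t b c m)) m =
            lookup (cscale (\<phi> f ^ q) p - (\<Sum>i<t. cscale (\<phi> (c i)) (spec \<phi> (b i)))) m"
          using f(1) S_carrier[OF lift_S[OF pc], of m]
          by (simp add: lookup_spec[OF \<phi> J_S[OF K]] lookup_minus lookup_sum_cscale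
              point_minus[OF \<phi>] point_mult[OF \<phi>] point_pow[OF \<phi>] cbp[OF c] cbc[OF c])
      qed
      then have "cscale (\<phi> f ^ q) p - (\<Sum>i<t. cscale (\<phi> (c i)) (spec \<phi> (b i))) \<in> family_fibre k n \<phi> J"
        using K unfolding family_fibre_eq[OF \<phi>] by (metis image_eqI)
      moreover have "(\<Sum>i<t. cscale (\<phi> (c i)) (spec \<phi> (b i))) \<in> cox_piece k n u"
        by (rule sum_cscale_in[OF subspace_cox_piece]) (auto intro: spec_piece[OF \<phi> b])
      then have "cscale (\<phi> f ^ q) p - (\<Sum>i<t. cscale (\<phi> (c i)) (spec \<phi> (b i))) \<in> cox_piece k n u"
        by (intro cpoly.subspace_diff[OF subspace_cox_piece] cpoly.subspace_scale[OF subspace_cox_piece] p)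
      ultimately have "cscale (1 / \<phi> f ^ q) (cscale (\<phi> f ^ q) p - (\<Sum>i<t. cscale (\<phi> (c i)) (spec \<phi> (b i)))) \<in> W"
        unfolding W_def using sW[unfolded W_def] by (intro cpoly.subspace_scale) auto
      moreover have "cscale (1 / \<phi> f ^ q) (cscale (\<phi> f ^ q) p - (\<Sum>i<t. cscale (\<phi> (c i)) (spec \<phi> (b i)))) =
          p - (\<Sum>i<t. cscale (\<phi> (c i) / \<phi> f ^ q) (spec \<phi> (b i)))"
        by (rule poly_mapping_eqI)
          (use fq in \<open>simp add: lookup_minus lookup_sum_cscale right_diff_distrib sum_distrib_left\<close>)
      ultimately show ?thesis by (intro exI[of _ "\<lambda>i. \<phi> (c i) / \<phi> f ^ q"]) simp
    qed
    fix \<gamma> i assume W: "(\<Sum>i<t. cscale (\<gamma> i) (spec \<phi> (b i))) \<in> W" and i: "i < t"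
    then obtain g0 where g0: "g0 \<in> J" "(\<Sum>i<t. cscale (\<gamma> i) (spec \<phi> (b i))) = spec \<phi> g0"
      unfolding W_def family_fibre_eq[OF \<phi>] by blast
    \<comment> \<open>Only the degree \<open>u\<close> component is kept, since \<open>g0\<close>
      may have further components that vanish merely after specialisation.\<close>
    define g where "g m = (if has_mdeg k n m u then g0 m else \<zero>)" for m
    have gJ: "g \<in> J" unfolding g_def by (rule J_component[OF g0(1)])
    have gc: "g m \<in> carrier R" for m by (rule S_carrier[OF J_S[OF gJ]])
    have gp: "g \<in> piece u"
      using J_S[OF g0(1)] gc by (auto simp: piece_iff g_def S_iff cox_monos_deg_def)
    have gl: "\<phi> (g m) = (\<Sum>i<t. \<gamma> i * lookup (spec \<phi> (b i)) m)" for m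
    proof -
      have 1: "(\<Sum>i<t. \<gamma> i * lookup (spec \<phi> (b i)) m) = \<phi> (g0 m)"
        using arg_cong[OF g0(2), of "\<lambda>p. lookup p m"]
        by (simp add: lookup_sum_cscale lookup_spec[OF \<phi> J_S[OF g0(1)]])
      have 2: "lookup (spec \<phi> (b i)) m = 0" if "\<not> has_mdeg k n m u" "i < t" for i
        using cox_piece_lookup[OF spec_piece[OF \<phi> b[OF that(2)]], of m] that(1) by (simp add: cox_monos_deg_def)
      show ?thesis using 1 2 by (cases "has_mdeg k n m u") (simp_all add: g_def point_zero[OF \<phi>])
    qed
    define c0 where "c0 i = \<gamma> i \<odot> \<one>" for i
    have c0: "c0 \<in> {..<t} \<rightarrow> carrier R" by (simp add: c0_def smult_one_closed)
    \<comment> \<open>The error of the lifted relation: it vanishes at \<open>\<phi>\<close> in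
      every coefficient, but not necessarily over \<open>R\<close>.\<close>
    define e where "e m = comb t b c0 m \<oplus> (\<ominus> \<one>) \<otimes> g m" for m
    have "comb t b c0 \<in> piece u" using b c0 by (rule comb_piece)
    then have ep: "e \<in> piece u"
      unfolding e_def by (intro piece_add piece_smult gp) auto
    have e0: "\<phi> (e m) = 0" for m
      by (simp add: e_def point_add[OF \<phi>] point_mult[OF \<phi>] point_uminus[OF \<phi>] point_one[OF \<phi>]
          cbc[OF c0] gc cbp[OF c0] gl c0_def point_scalar[OF \<phi>])
    have "\<exists>q::nat. \<exists>c\<in>{..<t} \<rightarrow> carrier R. (\<forall>i<t. \<phi> (c i) = 0) \<and> (\<lambda>m. (f [^] q \<otimes> e m) \<ominus> comb t b c m) \<in> J"
    proof (rule vanishing_combination[where E = "cox_monos_deg k n u" and u = u])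
      show "e m = \<zero>" if "m \<notin> cox_monos_deg k n u" for m using ep that by (simp add: piece_iff)
    qed (use b \<phi> f(1) span ep e0 in \<open>auto simp: finite_cox_monos_deg\<close>)
    then obtain q :: nat and c where c: "c \<in> {..<t} \<rightarrow> carrier R" "\<forall>i<t. \<phi> (c i) = 0"
      and K: "(\<lambda>m. (f [^] q \<otimes> e m) \<ominus> comb t b c m) \<in> J" by blast
    \<comment> \<open>The corrected coefficients belong to an element of \<open>J\<close>, and at
      \<open>\<phi>\<close> they agree with \<open>\<gamma>\<close> up to a power of
      \<open>\<phi> f\<close>.\<close>
    define c' where "c' i = f [^] q \<otimes> c0 i \<oplus> (\<ominus> \<one>) \<otimes> c i" for i
    have c': "c' \<in> {..<t} \<rightarrow> carrier R" using c(1) c0 f(1) by (auto simp: c'_def Pi_iff)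
    have "(\<lambda>m. ((f [^] q \<otimes> e m) \<ominus> comb t b c m) \<oplus> f [^] q \<otimes> g m) \<in> J"
      using f(1) by (intro J_add J_smult K gJ) auto
    also have "(\<lambda>m. ((f [^] q \<otimes> e m) \<ominus> comb t b c m) \<oplus> f [^] q \<otimes> g m) = comb t b c'"
    proof (rule ext)
      fix m
      define F where "F = f [^] q"
      have F: "F \<in> carrier R" using f(1) by (simp add: F_def)
      have "comb t b c' m = comb t b (\<lambda>i. F \<otimes> c0 i) m \<oplus> comb t b (\<lambda>i. (\<ominus> \<one>) \<otimes> c i) m"
        unfolding c'_def F_def[symmetric] using F c0 c(1) by (intro comb_add[OF b]) (auto simp: Pi_iff)
      also have "\<dots> = F \<otimes> comb t b c0 m \<oplus> (\<ominus> \<one>) \<otimes> comb t b c m"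
        using F by (simp add: cbs[OF c0] cbs[OF c(1)])
      finally have cm: "comb t b c' m = F \<otimes> comb t b c0 m \<oplus> (\<ominus> \<one>) \<otimes> comb t b c m" .
      define A where "A = F \<otimes> comb t b c0 m"
      define B where "B = F \<otimes> g m"
      define C where "C = comb t b c m"
      have cl: "A \<in> carrier R" "B \<in> carrier R" "C \<in> carrier R"
        using F gc cbc[OF c0, of m] cbc[OF c(1), of m] by (auto simp: A_def B_def C_def)
      have "F \<otimes> e m = A \<oplus> \<ominus> B"
        using F gc[of m] cbc[OF c0, of m] by (simp add: e_def A_def B_def r_distr l_minus r_minus)
      then have "((F \<otimes> e m) \<ominus> C) \<oplus> B = A \<oplus> \<ominus> C"
        using cl by (simp add: a_minus_def a_assoc a_lcomm[of "\<ominus> B"] l_neg a_comm[of "\<ominus> C" B])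
          (simp add: r_neg a_assoc[symmetric])
      then show "((f [^] q \<otimes> e m) \<ominus> comb t b c m) \<oplus> f [^] q \<otimes> g m = comb t b c' m"
        unfolding cm F_def[symmetric] A_def[symmetric] B_def[symmetric] C_def[symmetric]
        using cl by (simp add: l_minus)
    qed
    finally have "comb t b c' \<in> J" .
    from free[OF c' this] obtain q' :: nat where q': "\<And>i. i < t \<Longrightarrow> f [^] q' \<otimes> c' i = \<zero>" by blast
    have "\<phi> (f [^] q' \<otimes> c' i) = \<phi> f ^ q' * (\<phi> f ^ q * \<gamma> i)"
      using f(1) c(1) c0 i c' c(2)
      by (auto simp: Pi_iff c'_def point_mult[OF \<phi>] point_add[OF \<phi>] point_pow[OF \<phi>] point_uminus[OF \<phi>]
          c0_def point_scalar[OF \<phi>])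
    then have "\<phi> f ^ q' * (\<phi> f ^ q * \<gamma> i) = 0" using q'[OF i] point_zero[OF \<phi>] by simp
    then show "\<gamma> i = 0" using f(2) by simp
  qed
  then show ?thesis unfolding hilb_fun_def W_def[symmetric] t_def by simp
qed

lemma fibre_hilb_point: "\<phi> \<in> complex_points R \<Longrightarrow> family_fibre k n \<phi> J \<in> hilb_points k n h"
  by (simp add: hilb_points_def fibre_homogeneous fibre_hilb_fun)

end

section \<open>The square of an ideal in the closure\<close>

lemma ideal_prod_is_cox_ideal:
  assumes "ideal J (cox_ring k n)"
  shows "ideal (ideal_prod (cox_ring k n) J J) (cox_ring k n)"
  by (rule ring.ideal_prod_is_ideal[OF ring_cox_ring assms assms])

lemma hom_products_square: "hom_products k n J u \<subseteq> ideal_prod (cox_ring k n) J J"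
proof
  fix p assume "p \<in> hom_products k n J u"
  then obtain f g where "p = f * g" "f \<in> J" "g \<in> J" by (auto simp: hom_products_def)
  then show "p \<in> ideal_prod (cox_ring k n) J J" using ideal_prod.prod[of f J g J "cox_ring k n"] by simp
qed

lemma square_component:
  assumes J: "homogeneous_ideal k n J" and p: "p \<in> ideal_prod (cox_ring k n) J J"
  shows "mdeg_component k n u p \<in> ideal_prod (cox_ring k n) J J \<inter> cox_piece k n u"
proof -
  have idJ: "ideal J (cox_ring k n)" using J by (simp add: homogeneous_ideal_def)
  have "cpoly.span (hom_products k n J u) \<subseteq> ideal_prod (cox_ring k n) J J \<inter> cox_piece k n u"
    by (rule cpoly.span_minimal)
      (auto intro: cpoly.subspace_inter subspace_cox_ideal ideal_prod_is_cox_ideal[OF idJ] subspace_cox_piece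
        dest: subsetD[OF hom_products_square] subsetD[OF hom_products_piece])
  then show ?thesis using square_component_span[OF J p] by blast
qed

lemma subspace_square_piece:
  "ideal J (cox_ring k n) \<Longrightarrow> cpoly.subspace (ideal_prod (cox_ring k n) J J \<inter> cox_piece k n u)"
  by (intro cpoly.subspace_inter subspace_cox_ideal[OF ideal_prod_is_cox_ideal] subspace_cox_piece)

section \<open>Semicontinuity of the rank of the square\<close>

context hilb_family
begin

text \<open>Agreement is required on \<open>complex_points R\<close> only; this allows total
  functions to be used as elements of a function algebra.\<close>

definition eval_fun :: "(('r \<Rightarrow> complex) \<Rightarrow> complex) set" where
  "eval_fun = {g. \<exists>x\<in>carrier R. \<forall>\<psi>\<in>complex_points R. g \<psi> = \<psi> x}"

lemma eval_funI: "x \<in> carrier R \<Longrightarrow> (\<And>\<psi>. \<psi> \<in> complex_points R \<Longrightarrow> g \<psi> = \<psi> x) \<Longrightarrow> g \<in> eval_fun"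
  by (auto simp: eval_fun_def)

lemma fun_alg_eval_fun: "fun_alg eval_fun"
  unfolding fun_alg_def
proof (intro conjI allI ballI)
  show "(\<lambda>_. c) \<in> eval_fun" for c
    by (rule eval_funI[of "c \<odot> \<one>"]) (auto simp: smult_one_closed point_scalar)
  fix f g assume "f \<in> eval_fun" "g \<in> eval_fun"
  then obtain x y where xy: "x \<in> carrier R" "y \<in> carrier R"
    "\<And>\<psi>. \<psi> \<in> complex_points R \<Longrightarrow> f \<psi> = \<psi> x" "\<And>\<psi>. \<psi> \<in> complex_points R \<Longrightarrow> g \<psi> = \<psi> y"
    by (auto simp: eval_fun_def)
  show "(\<lambda>t. f t + g t) \<in> eval_fun"
    by (rule eval_funI[of "x \<oplus> y"]) (auto simp: xy point_add)
  show "(\<lambda>t. f t * g t) \<in> eval_fun"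
    by (rule eval_funI[of "x \<otimes> y"]) (auto simp: xy point_mult)
qed

text \<open>Outside the set of points the specialisation is set to zero to keep the supports bounded.\<close>

definition spec0 :: "('r \<Rightarrow> complex) \<Rightarrow> (mono \<Rightarrow> 'r) \<Rightarrow> cpoly" where
  "spec0 \<psi> f = (if \<psi> \<in> complex_points R then spec \<psi> f else 0)"

lemma spec0_keys: "f \<in> S \<Longrightarrow> keys (spec0 \<psi> f) \<subseteq> {m. f m \<noteq> \<zero>}"
  by (auto simp: spec0_def in_keys_iff lookup_spec point_zero)

lemma spec0_lookup: "f \<in> S \<Longrightarrow> (\<lambda>\<psi>. lookup (spec0 \<psi> f) m) \<in> eval_fun"
  by (rule eval_funI[of "f m"]) (auto simp: spec0_def lookup_spec S_carrier)

text \<open>Elements of the fibre at \<open>\<phi>\<close> come from elements of \<open>J\<close>,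
  which can be specialised at every other point too. Products and sums of these specialisations stay
  in the squares of the fibres.\<close>

lemma square_lifts:
  assumes \<phi>: "\<phi> \<in> complex_points R" and p: "p \<in> ideal_prod (cox_ring k n) (family_fibre k n \<phi> J)
      (family_fibre k n \<phi> J)"
  shows "\<exists>P A. P \<phi> = p \<and> (\<forall>\<psi>\<in>complex_points R. P \<psi> \<in> ideal_prod (cox_ring k n) (family_fibre k n \<psi> J)
      (family_fibre k n \<psi> J)) \<and>
    finite A \<and> (\<forall>\<psi>. keys (P \<psi>) \<subseteq> A) \<and> (\<forall>m. (\<lambda>\<psi>. lookup (P \<psi>) m) \<in> eval_fun)"
  using p
proof (induction rule: ideal_prod.induct)
  case (prod a b)
  obtain f g where fg: "f \<in> J" "g \<in> J" "a = spec \<phi> f" "b = spec \<phi> g"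
    using prod unfolding family_fibre_eq[OF \<phi>] by blast
  have fS: "f \<in> S" and gS: "g \<in> S" using J_S fg by auto
  define A where "A = {m. f m \<noteq> \<zero>}"
  define B where "B = {m. g m \<noteq> \<zero>}"
  have fin: "finite A" "finite B" using fS gS by (auto simp: A_def B_def S_iff)
  have kA: "keys (spec0 \<psi> f) \<subseteq> A" for \<psi> unfolding A_def by (rule spec0_keys[OF fS])
  have kB: "keys (spec0 \<psi> g) \<subseteq> B" for \<psi> unfolding B_def by (rule spec0_keys[OF gS])
  show ?case
  proof (intro exI[of _ "\<lambda>\<psi>. spec0 \<psi> f * spec0 \<psi> g"] exI[of _ "(\<lambda>(x, y). x + y) ` (A \<times> B)"] conjI ballI allI)
    show "spec0 \<phi> f * spec0 \<phi> g = a \<otimes>\<^bsub>cox_ring k n\<^esub> b" using fg \<phi> by (simp add: spec0_def)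
    show "spec0 \<psi> f * spec0 \<psi> g \<in> ideal_prod (cox_ring k n) (family_fibre k n \<psi> J) (family_fibre k n \<psi> J)"
      if \<psi>: "\<psi> \<in> complex_points R" for \<psi>
    proof -
      have "spec0 \<psi> f \<in> family_fibre k n \<psi> J" "spec0 \<psi> g \<in> family_fibre k n \<psi> J"
        using fg(1,2) \<psi> by (auto simp: family_fibre_eq[OF \<psi>] spec0_def)
      from ideal_prod.prod[OF this, of "cox_ring k n"] show ?thesis by simp
    qed
    show "finite ((\<lambda>(x, y). x + y) ` (A \<times> B))" using fin by simp
    show "keys (spec0 \<psi> f * spec0 \<psi> g) \<subseteq> (\<lambda>(x, y). x + y) ` (A \<times> B)" for \<psi>
    proof
      fix t assume "t \<in> keys (spec0 \<psi> f * spec0 \<psi> g)"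
      then obtain x y where "x \<in> keys (spec0 \<psi> f)" "y \<in> keys (spec0 \<psi> g)" "t = x + y"
        using keys_mult[of "spec0 \<psi> f" "spec0 \<psi> g"] by blast
      then show "t \<in> (\<lambda>(x, y). x + y) ` (A \<times> B)" using kA[of \<psi>] kB[of \<psi>] by blast
    qed
    show "(\<lambda>\<psi>. lookup (spec0 \<psi> f * spec0 \<psi> g) m) \<in> eval_fun" for m
      by (rule fun_alg_lookup_mult[OF fun_alg_eval_fun fin kA spec0_lookup[OF fS] kB spec0_lookup[OF gS]])
  qed
next
  case (sum p q)
  from sum.IH(1) obtain P A where P: "P \<phi> = p \<and> (\<forall>\<psi>\<in>complex_points R. P \<psi> \<in> ideal_prod (cox_ring k n)
      (family_fibre k n \<psi> J) (family_fibre k n \<psi> J)) \<and>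
    finite A \<and> (\<forall>\<psi>. keys (P \<psi>) \<subseteq> A) \<and> (\<forall>m. (\<lambda>\<psi>. lookup (P \<psi>) m) \<in> eval_fun)"
    by (elim exE) (rule that)
  from sum.IH(2) obtain Q B where Q: "Q \<phi> = q \<and> (\<forall>\<psi>\<in>complex_points R. Q \<psi> \<in> ideal_prod (cox_ring k n)
      (family_fibre k n \<psi> J) (family_fibre k n \<psi> J)) \<and>
    finite B \<and> (\<forall>\<psi>. keys (Q \<psi>) \<subseteq> B) \<and> (\<forall>m. (\<lambda>\<psi>. lookup (Q \<psi>) m) \<in> eval_fun)"
    by (elim exE) (rule that)
  show ?case
  proof (intro exI[of _ "\<lambda>\<psi>. P \<psi> + Q \<psi>"] exI[of _ "A \<union> B"] conjI ballI allI)
    show "P \<psi> + Q \<psi> \<in> ideal_prod (cox_ring k n) (family_fibre k n \<psi> J) (family_fibre k n \<psi> J)"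
      if "\<psi> \<in> complex_points R" for \<psi>
      using ideal_prod.sum[of "P \<psi>" "cox_ring k n" "family_fibre k n \<psi> J" "family_fibre k n \<psi> J"
          "Q \<psi>"] P Q that by simp
    show "keys (P \<psi> + Q \<psi>) \<subseteq> A \<union> B" for \<psi>
      using Poly_Mapping.keys_add[of "P \<psi>" "Q \<psi>"] P Q by blast
    show "(\<lambda>\<psi>. lookup (P \<psi> + Q \<psi>) m) \<in> eval_fun" for m
      unfolding lookup_add by (rule fun_alg_add[OF fun_alg_eval_fun]) (use P Q in blast)+
  qed (use P Q in auto)
qed

text \<open>A basis of the degree \<open>u\<close> part of the square at \<open>\<phi>\<close>
  extends to elements of the squares at all points, with coefficients given by elements of
  \<open>R\<close>; \<open>x\<close> represents the product of pivots that keeps them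
  independent.\<close>

lemma square_rank_open:
  assumes \<phi>: "\<phi> \<in> complex_points R"
  shows "\<exists>x\<in>carrier R. \<phi> x \<noteq> 0 \<and> (\<forall>\<psi>\<in>complex_points R. \<psi> x \<noteq> 0 \<longrightarrow>
    cpoly.dim (ideal_prod (cox_ring k n) (family_fibre k n \<phi> J) (family_fibre k n \<phi> J) \<inter> cox_piece k n u) \<le>
    cpoly.dim (ideal_prod (cox_ring k n) (family_fibre k n \<psi> J) (family_fibre k n \<psi> J) \<inter> cox_piece k n u))"
proof -
  let ?I = "\<lambda>\<psi>. ideal_prod (cox_ring k n) (family_fibre k n \<psi> J) (family_fibre k n \<psi> J)"
  have id: "ideal (family_fibre k n \<psi> J) (cox_ring k n)" if "\<psi> \<in> complex_points R" for \<psi>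
    using fibre_homogeneous[OF that] by (simp add: homogeneous_ideal_def)
  define W where "W = ?I \<phi> \<inter> cox_piece k n u"
  have W: "cpoly.subspace W" "W \<subseteq> cox_piece k n u"
    unfolding W_def by (rule subspace_square_piece[OF id[OF \<phi>]]) simp
  obtain B where Bc: "finite B" "B \<subseteq> W" "card B = cpoly.dim W" "cpoly.independent B"
    using cox_piece_basis[OF W] by blast
  note B = Bc[unfolded W_def]
  have "\<exists>P. P \<phi> = b \<and> (\<forall>\<psi>\<in>complex_points R. P \<psi> \<in> ?I \<psi> \<inter> cox_piece k n u) \<and>
      (\<forall>m. (\<lambda>\<psi>. lookup (P \<psi>) m) \<in> eval_fun)"
    if b: "b \<in> B" for b
  proof -
    have "b \<in> ?I \<phi>" and bu: "b \<in> cox_piece k n u" using b B(2) by auto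
    from square_lifts[OF \<phi> this(1)] obtain P A where
      P: "P \<phi> = b \<and> (\<forall>\<psi>\<in>complex_points R. P \<psi> \<in> ?I \<psi>) \<and>
        finite A \<and> (\<forall>\<psi>. keys (P \<psi>) \<subseteq> A) \<and> (\<forall>m. (\<lambda>\<psi>. lookup (P \<psi>) m) \<in> eval_fun)"
      by (elim exE) (rule that)
    show ?thesis
    \<comment> \<open>The lift of \<open>b\<close> is known to be homogeneous at
      \<open>\<phi>\<close> only; its degree \<open>u\<close> component agrees with it
      there.\<close>
    proof (intro exI[of _ "\<lambda>\<psi>. mdeg_component k n u (P \<psi>)"] conjI ballI allI)
      show "mdeg_component k n u (P \<phi>) = b" using P mdeg_component_id[OF bu] by simp
      show "mdeg_component k n u (P \<psi>) \<in> ?I \<psi> \<inter> cox_piece k n u" if "\<psi> \<in> complex_points R" for \<psi>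
        by (rule square_component[OF fibre_homogeneous[OF that]]) (use P that in blast)
      show "(\<lambda>\<psi>. lookup (mdeg_component k n u (P \<psi>)) m) \<in> eval_fun" for m
        unfolding lookup_mdeg_component
        using P fun_alg_const[OF fun_alg_eval_fun, of 0] by (cases "has_mdeg k n m u") simp_all
    qed
  qed
  then have "\<forall>b\<in>B. \<exists>P. P \<phi> = b \<and> (\<forall>\<psi>\<in>complex_points R. P \<psi> \<in> ?I \<psi> \<inter> cox_piece k n u) \<and>
      (\<forall>m. (\<lambda>\<psi>. lookup (P \<psi>) m) \<in> eval_fun)"
    by blast
  from bchoice[OF this] obtain P where
    P: "\<forall>b\<in>B. P b \<phi> = b \<and> (\<forall>\<psi>\<in>complex_points R. P b \<psi> \<in> ?I \<psi> \<inter> cox_piece k n u) \<and>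
        (\<forall>m. (\<lambda>\<psi>. lookup (P b \<psi>) m) \<in> eval_fun)"
    by (elim exE) (rule that)
  let ?M = "cox_monos_deg k n u"
  have "\<exists>g\<in>eval_fun. g \<phi> \<noteq> 0 \<and> (\<forall>\<psi>. g \<psi> \<noteq> 0 \<longrightarrow> indep_on B ?M (\<lambda>b. lookup (P b \<psi>)))"
  proof (rule indep_on_open[OF fun_alg_eval_fun B(1)])
    show "(\<lambda>\<psi>. lookup (P b \<psi>) m) \<in> eval_fun" if "b \<in> B" for b m using P that by blast
    have "indep_on B ?M lookup" using B by (intro independent_indep_on) auto
    then show "indep_on B ?M (\<lambda>b. lookup (P b \<phi>))"
      unfolding indep_on_def using P by simp
  qed
  then obtain g where g: "g \<in> eval_fun" "g \<phi> \<noteq> 0" "\<And>\<psi>. g \<psi> \<noteq> 0 \<Longrightarrow> indep_on B ?M (\<lambda>b. lookup (P b \<psi>))" by blast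
  obtain x where x: "x \<in> carrier R" "\<And>\<psi>. \<psi> \<in> complex_points R \<Longrightarrow>
      g \<psi> = \<psi> x" using g(1) by (auto simp: eval_fun_def)
  show ?thesis
  proof (intro bexI[of _ x] conjI ballI impI)
    show "\<phi> x \<noteq> 0" using g(2) x(2)[OF \<phi>] by simp
    fix \<psi> assume \<psi>: "\<psi> \<in> complex_points R" and "\<psi> x \<noteq> 0"
    then have "indep_on B ?M (\<lambda>b. lookup (P b \<psi>))" using g(3)[of \<psi>] x(2)[OF \<psi>] by simp
    then have "card B \<le> cpoly.dim (?I \<psi> \<inter> cox_piece k n u)"
      by (rule indep_on_card_le_dim[OF subspace_square_piece[OF id[OF \<psi>]] Int_lower2 B(1), rotated])
        (use P \<psi> in blast)
    then show "cpoly.dim (?I \<phi> \<inter> cox_piece k n u) \<le> cpoly.dim (?I \<psi> \<inter> cox_piece k n u)" using B(3) by simp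
  qed (use x in auto)
qed

end

section \<open>Closedness of the bound and passage to the closure\<close>

lemma hilb_familyI:
  fixes R :: "(complex, 'r) module"
  assumes "Module.algebra complex_ring R" "J \<in> hilb_functor R k n h"
  shows "hilb_family R k n h J"
proof -
  interpret A: Module.algebra complex_ring R by fact
  have "cring R" using assms(1) by (simp add: Module.algebra_def)
  moreover have "c \<odot>\<^bsub>R\<^esub> \<one>\<^bsub>R\<^esub> \<in> carrier R" for c
    by (rule A.smult_closed) (auto simp: complex_ring_def)
  ultimately show ?thesis
    using assms(2) by (simp add: hilb_family_def hilb_family_axioms_def)
qed

lemma hilb_closed_square:
  "hilb_closed k n h {I \<in> hilb_points k n h. c \<le> hilb_fun k n (ideal_prod (cox_ring k n) I I) u}"
    (is "hilb_closed k n h ?Z")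
  unfolding hilb_closed_def
proof (intro conjI allI impI)
  show "?Z \<subseteq> hilb_points k n h" by blast
  fix R :: "(complex, alg_elem) module" and J
  assume RJ: "Module.algebra complex_ring R \<and> J \<in> hilb_functor R k n h"
  interpret hilb_family R k n h J using RJ by (intro hilb_familyI) auto
  \<comment> \<open>The elements vanishing on the preimage of \<open>?Z\<close>. A point outside is
    detected by the element from \<open>square_rank_open\<close>: where that element is nonzero, the
    Hilbert function of the square is at most its value at the point, hence below
    \<open>c\<close>.\<close>
  define E where "E = {x \<in> carrier R. \<forall>\<psi>\<in>complex_points R. family_fibre k n \<psi> J \<in> ?Z \<longrightarrow> \<psi> x = 0}"
  show "\<exists>E\<subseteq>carrier R. \<forall>\<phi>\<in>complex_points R. (family_fibre k n \<phi> J \<in> ?Z) = (\<forall>x\<in>E. \<phi> x = 0)"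
  proof (intro exI[of _ E] conjI ballI)
    show "E \<subseteq> carrier R" by (auto simp: E_def)
    fix \<phi> assume \<phi>: "\<phi> \<in> complex_points R"
    show "(family_fibre k n \<phi> J \<in> ?Z) = (\<forall>x\<in>E. \<phi> x = 0)"
    proof
      assume "family_fibre k n \<phi> J \<in> ?Z"
      then show "\<forall>x\<in>E. \<phi> x = 0" using \<phi> unfolding E_def by blast
    next
      assume E0: "\<forall>x\<in>E. \<phi> x = 0"
      show "family_fibre k n \<phi> J \<in> ?Z"
      proof (rule ccontr)
        assume "family_fibre k n \<phi> J \<notin> ?Z"
        then have less: "\<not> c \<le> hilb_fun k n (ideal_prod (cox_ring k n) (family_fibre k n \<phi> J)
            (family_fibre k n \<phi> J)) u"
          using fibre_hilb_point[OF \<phi>] by blast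
        obtain x where x: "x \<in> carrier R" "\<phi> x \<noteq> 0" "\<forall>\<psi>\<in>complex_points R. \<psi> x \<noteq> 0 \<longrightarrow>
            cpoly.dim (ideal_prod (cox_ring k n) (family_fibre k n \<phi> J) (family_fibre k n \<phi> J) \<inter>
                cox_piece k n u) \<le>
            cpoly.dim (ideal_prod (cox_ring k n) (family_fibre k n \<psi> J) (family_fibre k n \<psi> J) \<inter>
                cox_piece k n u)"
          using square_rank_open[OF \<phi>, of u] by blast
        have "x \<in> E"
          unfolding E_def
        proof (intro CollectI conjI ballI impI)
          fix \<psi> assume \<psi>: "\<psi> \<in> complex_points R" and Z: "family_fibre k n \<psi> J \<in> ?Z"
          show "\<psi> x = 0"
          proof (rule ccontr)
            assume "\<psi> x \<noteq> 0"
            with x(3) \<psi> have "hilb_fun k n (ideal_prod (cox_ring k n) (family_fibre k n \<psi> J)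
                (family_fibre k n \<psi> J)) u \<le>
               hilb_fun k n (ideal_prod (cox_ring k n) (family_fibre k n \<phi> J) (family_fibre k n \<phi> J)) u"
              unfolding hilb_fun_def by (intro diff_le_mono2) blast
            then show False using Z less by simp
          qed
        qed (rule x(1))
        then show False using E0 x(2) by blast
      qed
    qed
  qed
qed

text \<open>The complement of \<open>Z\<close> is one of the generating open sets and misses all
  radical saturated ideals, so it misses their closure.\<close>

lemma slip_subset_closed:
  assumes Z: "hilb_closed k n (h_generic r k n) Z"
    and sub: "{J \<in> hilb_points k n (h_generic r k n). radical_ideal k n J \<and> saturated k n J} \<subseteq> Z"
  shows "slip r k n \<subseteq> Z"
proof
  let ?T = "hilb_topology k n (h_generic r k n)"
  fix I assume "I \<in> slip r k n"
  then have I: "I \<in> topspace ?T" and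
    cl: "\<And>U. I \<in> U \<Longrightarrow> openin ?T U \<Longrightarrow> \<exists>J\<in>{J \<in> hilb_points k n (h_generic r k n). radical_ideal k n J \<and>
        saturated k n J}. J \<in> U"
    unfolding slip_def closure_of_def by blast+
  have "I \<in> hilb_points k n (h_generic r k n)"
    using I unfolding hilb_topology_def topology_generated_by_topspace by blast
  moreover have "openin ?T (hilb_points k n (h_generic r k n) - Z)"
    unfolding hilb_topology_def by (rule topology_generated_by_Basis) (use Z in blast)
  ultimately show "I \<in> Z" using cl[of "hilb_points k n (h_generic r k n) - Z"] sub by blast
qed

text \<open>A monomial of degree 0 in the factors after \<open>j\<close> contains none of their
  variables.\<close>

lemma cox_monos_deg_extend:
  assumes "j \<le> k"
  shows "cox_monos_deg k n (extend_by_zero j d) = cox_monos_deg j n d"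
proof (rule Set.set_eqI)
  fix m
  have ext: "extend_by_zero j d i = (if i \<le> j then d i else 0)" for i by (simp add: extend_by_zero_def)
  show "m \<in> cox_monos_deg k n (extend_by_zero j d) \<longleftrightarrow> m \<in> cox_monos_deg j n d"
  proof
    assume m: "m \<in> cox_monos_deg k n (extend_by_zero j d)"
    have "v \<in> cox_vars j n" if v: "v \<in> keys m" for v
    proof -
      obtain i l where il: "v = (i, l)" "i \<in> {1..k}" "l \<le> n i" using cox_monos_deg_keys[OF m] v
          by (auto simp: cox_vars_def)
      have "i \<le> j"
      proof (rule ccontr)
        assume "\<not> i \<le> j"
        then have "(\<Sum>l\<le>n i. lookup m (i, l)) = 0" using cox_monos_deg_sum[OF m il(2)] by (simp add: ext)
        then show False using v il by (auto simp: in_keys_iff)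
      qed
      then show ?thesis using il by (simp add: cox_vars_def)
    qed
    then have "m \<in> cox_monos j n" by (auto simp: cox_monos_def)
    moreover have "has_mdeg j n m d"
      using m assms unfolding cox_monos_deg_def has_mdeg_def by (auto simp: ext)
    ultimately show "m \<in> cox_monos_deg j n d" by (simp add: cox_monos_deg_def)
  next
    assume m: "m \<in> cox_monos_deg j n d"
    have km: "keys m \<subseteq> cox_vars j n" by (rule cox_monos_deg_keys[OF m])
    have "cox_vars j n \<subseteq> cox_vars k n" using assms by (auto simp: cox_vars_def)
    then have "m \<in> cox_monos k n" using km by (auto simp: cox_monos_def)
    moreover have "has_mdeg k n m (extend_by_zero j d)"
      unfolding has_mdeg_def
    proof
      fix i assume i: "i \<in> {1..k}"
      show "int (\<Sum>l\<le>n i. lookup m (i, l)) = extend_by_zero j d i"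
      proof (cases "i \<le> j")
        case True
        then have "int (\<Sum>l\<le>n i. lookup m (i, l)) = d i"
          using m i unfolding cox_monos_deg_def has_mdeg_def by auto
        then show ?thesis using True by (simp add: ext)
      next
        case False
        then have "lookup m (i, l) = 0" for l using km by (auto simp: cox_vars_def in_keys_iff)
        then show ?thesis using False by (simp add: ext)
      qed
    qed
    ultimately show "m \<in> cox_monos_deg k n (extend_by_zero j d)" by (simp add: cox_monos_deg_def)
  qed
qed

lemma radical_saturated_square:
  fixes d e :: "nat \<Rightarrow> int"
  assumes jk: "j \<le> k" and r: "r > 0" and d: "\<forall>i\<in>{1..j}. d i > 0"
    and dim: "r * (dim_product j n + 1) \<le> cox_dim k n (extend_by_zero j d)"
    and nd: "not_secant_defective r j n d" and e: "\<forall>i\<in>{1..j}. e i \<ge> d i"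
    and I: "I \<in> hilb_points k n (h_generic r k n)" "radical_ideal k n I" "saturated k n I"
  shows "r * (dim_product j n + 1) \<le> hilb_fun k n (ideal_prod (cox_ring k n) I I) (extend_by_zero j e)"
proof -
  let ?M = "cox_monos_deg k n (extend_by_zero j d)"
  have homI: "homogeneous_ideal k n I" and hI: "\<And>u. hilb_fun k n I u = min r (cox_dim k n u)"
    using I(1) by (auto simp: hilb_points_def h_generic_def)
  have idI: "ideal I (cox_ring k n)" using homI by (simp add: homogeneous_ideal_def)
  \<comment> \<open>\<open>hilb_fun\<close> is a truncated difference; the inequality of dimensions
    turns it into an equation.\<close>
  have hilb: "cpoly.dim (I \<inter> cox_piece k n u) + min r (card (cox_monos_deg k n u)) =
      card (cox_monos_deg k n u)" for u
  proof -
    have "cpoly.subspace (I \<inter> cox_piece k n u)"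
      by (intro cpoly.subspace_inter subspace_cox_ideal[OF idI] subspace_cox_piece)
    from dim_add_card_le[OF this Int_lower2, of "{}"]
    have "cpoly.dim (I \<inter> cox_piece k n u) \<le> card (cox_monos_deg k n u)" by (simp add: indep_on_def)
    then show ?thesis using hI[of u] unfolding hilb_fun_def cox_dim_eq by linarith
  qed
  interpret points_ideal k n I r
  proof
    show "card (cox_monos_deg k n u) \<le> cpoly.dim (I \<inter> cox_piece k n u) + r" for u
      using hilb[of u] by linarith
  qed (use homI I in auto)
  have M: "?M = cox_monos_deg j n d" by (rule cox_monos_deg_extend[OF jk])
  have cM: "r * (dim_product j n + 1) \<le> card ?M" using dim by (simp add: cox_dim_eq)
  have "0 < r * (dim_product j n + 1)" using r by simp
  then have "0 < card ?M" using cM by linarith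
  then have ne: "cox_monos_deg j n d \<noteq> {}" by (metis M card.empty less_irrefl)
  have "cox_dim j n d = card ?M" by (simp add: cox_dim_eq M)
  \<comment> \<open>The numerical hypothesis decides the minimum in the expected dimension.\<close>
  then have "min (cox_dim j n d - 1) (r * (dim_product j n + 1) - 1) = r * (dim_product j n + 1) - 1"
    using cM by (intro min.absorb2 diff_le_mono) simp
  then have "krull_dim (subtopology (zariski_proj (cox_monos_deg j n d))
      (secant_variety (cox_monos_deg j n d) (embedded_product j n d) r)) = enat (r * (dim_product j n + 1) - 1)"
    using nd by (simp add: not_secant_defective_def Let_def)
  from terracini[OF this r ne] obtain z where z: "indep_on (tan_index r j n) ?M (tan_fun (chart z))"
    unfolding M by blast
  have "cpoly.dim (ideal_prod (cox_ring k n) I I \<inter> cox_piece k n (extend_by_zero j e)) + card (tan_index r j n)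
      \<le> card (cox_monos_deg k n (extend_by_zero j e))"
  proof (rule square_codim[OF hilb jk])
    show "extend_by_zero j d i \<ge> 0" if "i \<in> {1..k}" for i
      using d that by (auto simp: extend_by_zero_def intro: less_imp_le)
    have "r * 1 \<le> r * (dim_product j n + 1)" by (rule mult_le_mono2) simp
    then show "r \<le> card ?M" using cM by simp
    show "indep_on (tan_index r j n) ?M (tan_fun (chart z))" by (rule z)
    show "extend_by_zero j d i \<le> extend_by_zero j e i" if "i \<in> {1..j}" for i
      using e that by (auto simp: extend_by_zero_def)
    show "extend_by_zero j e i = extend_by_zero j d i" if "i \<in> {j<..k}" for i
      using that by (simp add: extend_by_zero_def)
  qed (simp add: chart_def)
  then show ?thesis unfolding hilb_fun_def cox_dim_eq card_tan_index by linarith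
qed

theorem proposition7p2:
  fixes j k r :: nat and n :: "nat \<Rightarrow> nat" and d e :: "nat \<Rightarrow> int" and I :: "cpoly set"
  assumes "1 \<le> j" and "j \<le> k"
    and "r > 0" and "\<forall>i\<in>{1..j}. d i > 0"
    and "r * (dim_product j n + 1) \<le> cox_dim k n (extend_by_zero j d)"
    and "not_secant_defective r j n d"
    and "I \<in> slip r k n"
    and "\<forall>i\<in>{1..j}. e i \<ge> d i"
  shows "hilb_fun k n (ideal_prod (cox_ring k n) I I) (extend_by_zero j e)
           \<ge> r * (dim_product j n + 1)"
proof -
  let ?Z = "{I \<in> hilb_points k n (h_generic r k n).
    r * (dim_product j n + 1) \<le> hilb_fun k n (ideal_prod (cox_ring k n) I I) (extend_by_zero j e)}"
  have "slip r k n \<subseteq> ?Z"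
    by (rule slip_subset_closed[OF hilb_closed_square])
      (use radical_saturated_square[OF assms(2-6,8)] in blast)
  then show ?thesis using assms(7) by blast
qed

end
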